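(* Let $n\ge 1$ and $b\ge 2$ be integers, and let $M=(M(i,j))_{0\le i,j\le n-1}$ be the transition matrix of the Markov chain of carries arising when $n$ random numbers are added in base $b$. Then for all $0\le i,j\le n-1$, $$M(i,j)=[\phi_i,\,b^{\ell-n}\phi_j],$$ where $b^{\ell-n}\phi_j$ denotes the function $\pi\mapsto b^{\ell(\pi)-n}\phi_j(\pi)$ on $S_n$.
   Context: Carries chain: $M(i,j)$ is the probability that the next carry is $j$ given that the last carry is $i$, when adding $n$ numbers in base $b$ whose digits are independent and uniform on $\{0,1,\ldots,b-1\}$; that is, $M(i,j)=\Pr\bigl(\lfloor (i+U_1+\cdots+U_n)/b\rfloor=j\bigr)$ with $U_1,\ldots,U_n$ independent and uniform on $\{0,\ldots,b-1\}$. For $\pi\in S_n$, $\ell(\pi)$ is the number of cycles of $\pi$ (fixed points included), and $C_i=\{\pi\in S_n\mid \ell(\pi)=i\}$ for $1\le i\le n$; in particular $C_1$ is the set of $n$-cycles. $\mathrm{CF}_\ell(S_n)$ is the complex vector space of all functions $\vartheta:S_n\to\mathbb{C}$ that depend only on $\ell$; for such $\vartheta$, $\vartheta(C_i)$ is the common value of $\vartheta$ on $C_i$. The inner product on $\mathrm{CF}_\ell(S_n)$ is $$[\vartheta,\psi]=\frac{1}{|S_n|}\sum_{i,j=1}^{n}\vartheta(C_i)\,\overline{\psi(C_j)}\;\mathbf{E}\,|\sigma C_i\cap\tau C_j|,$$ where $\sigma,\tau$ are independent and uniformly random elements of $C_1$, $\sigma C_i=\{\sigma x\mid x\in C_i\}$,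 and $\mathbf{E}$ is expectation. For $0\le i\le n-1$, the Foulkes character $\phi_i$ of $S_n$ is the character afforded by the direct sum of the (skew) Specht modules $V_\beta$, one for each border shape $\beta$ (connected skew shape containing no $2\times 2$ square) with $n$ boxes and $i+1$ rows. Equivalently, $\phi_i(\pi)=\sum_{j=0}^{n-1}(-1)^{i-j}\binom{n+1}{i-j}(j+1)^{\ell(\pi)}$, with $\binom{a}{b}=0$ for $b<0$. *)

theory Defs
  imports
    "HOL-Probability.Probability"
    "HOL-Combinatorics.Combinatorics"
    "HOL-Library.Function_Algebras"
begin

section \<open>The carries chain\<close>

definition carries :: "nat \<Rightarrow> nat \<Rightarrow> nat \<Rightarrow> nat \<Rightarrow> real" where
  "carries n b i j =
     measure_pmf.prob (Pi_pmf {1..n} 0 (\<lambda>_. pmf_of_set {0..<b}))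
       {U. (i + (\<Sum>k=1..n. U k)) div b = j}"


section \<open>Functions of the number of cycles\<close>

definition Sym :: "nat \<Rightarrow> (nat \<Rightarrow> nat) set" where
  "Sym n = {\<pi>. \<pi> permutes {1..n}}"

text \<open>The cycles of \<open>\<pi>\<close>, fixed points included, are its orbits on \<open>{1..n}\<close>.\<close>

definition num_cycles :: "nat \<Rightarrow> (nat \<Rightarrow> nat) \<Rightarrow> nat" where
  "num_cycles n \<pi> = card (orbit \<pi> ` {1..n})"

definition cycle_class :: "nat \<Rightarrow> nat \<Rightarrow> (nat \<Rightarrow> nat) set" where
  "cycle_class n i = {\<pi> \<in> Sym n. num_cycles n \<pi> = i}"

text \<open>
  The common value on \<open>cycle_class n i\<close> of a function that depends only on the number of cycles.
  The classes with \<open>1 \<le> i \<le> n\<close> are nonempty, so this value is unique; for a function that is not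
  constant on the class it is unspecified.
\<close>

definition class_value :: "nat \<Rightarrow> ((nat \<Rightarrow> nat) \<Rightarrow> complex) \<Rightarrow> nat \<Rightarrow> complex" where
  "class_value n \<theta> i = (THE c. \<forall>\<pi>\<in>cycle_class n i. \<theta> \<pi> = c)"

definition mean_overlap :: "nat \<Rightarrow> nat \<Rightarrow> nat \<Rightarrow> real" where
  "mean_overlap n i j =
     measure_pmf.expectation
       (pair_pmf (pmf_of_set (cycle_class n 1)) (pmf_of_set (cycle_class n 1)))
       (\<lambda>(\<sigma>, \<tau>). real (card ((\<lambda>x. \<sigma> \<circ> x) ` cycle_class n i \<inter> (\<lambda>x. \<tau> \<circ> x) ` cycle_class n j)))"

definition cf_inner ::
  "nat \<Rightarrow> ((nat \<Rightarrow> nat) \<Rightarrow> complex) \<Rightarrow> ((nat \<Rightarrow> nat) \<Rightarrow> complex) \<Rightarrow> complex" where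
  "cf_inner n \<theta> \<psi> =
     1 / of_nat (card (Sym n)) *
     (\<Sum>i=1..n. \<Sum>j=1..n.
        class_value n \<theta> i * cnj (class_value n \<psi> j) * of_real (mean_overlap n i j))"


section \<open>Border shapes\<close>

text \<open>Boxes are pairs (row, column), counted from 0; rows go downwards.\<close>

type_synonym box = "nat \<times> nat"

definition young_diagram :: "box set \<Rightarrow> bool" where
  "young_diagram D \<longleftrightarrow>
     finite D \<and> (\<forall>r c r' c'. (r, c) \<in> D \<longrightarrow> r' \<le> r \<longrightarrow> c' \<le> c \<longrightarrow> (r', c') \<in> D)"

definition skew_shape :: "box set \<Rightarrow> bool" where
  "skew_shape D \<longleftrightarrow>
     (\<exists>\<Lambda> M. young_diagram \<Lambda> \<and> young_diagram M \<and> M \<subseteq> \<Lambda> \<and> D = \<Lambda> - M)"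

definition adjacent :: "box \<Rightarrow> box \<Rightarrow> bool" where
  "adjacent x y \<longleftrightarrow>
     fst x = fst y \<and> (snd y = Suc (snd x) \<or> snd x = Suc (snd y)) \<or>
     snd x = snd y \<and> (fst y = Suc (fst x) \<or> fst x = Suc (fst y))"

definition connected_shape :: "box set \<Rightarrow> bool" where
  "connected_shape D \<longleftrightarrow>
     (\<forall>x\<in>D. \<forall>y\<in>D. (x, y) \<in> {(u, v). u \<in> D \<and> v \<in> D \<and> adjacent u v}\<^sup>*)"

definition border_shape :: "box set \<Rightarrow> bool" where
  "border_shape D \<longleftrightarrow>
     skew_shape D \<and> connected_shape D \<and>
     \<not> (\<exists>r c. {(r, c), (r, Suc c), (Suc r, c), (Suc r, Suc c)} \<subseteq> D)"

text \<open>
  Shapes that differ by a translation are identified. The representative chosen is the one that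
  meets row 0 and column 0.
\<close>

definition border_shapes :: "nat \<Rightarrow> nat \<Rightarrow> box set set" where
  "border_shapes n k =
     {D. border_shape D \<and> 0 \<in> fst ` D \<and> 0 \<in> snd ` D \<and> card D = n \<and> card (fst ` D) = k}"


section \<open>Skew Specht modules\<close>

text \<open>A tableau is only relevant through its restriction to \<open>D\<close>.\<close>

definition tableaux :: "nat \<Rightarrow> box set \<Rightarrow> (box \<Rightarrow> nat) set" where
  "tableaux n D = {T. bij_betw T D {1..n}}"

text \<open>The tabloid of a tableau records the set of entries of each row.\<close>

definition tabloid :: "box set \<Rightarrow> (box \<Rightarrow> nat) \<Rightarrow> (nat \<Rightarrow> nat set)" where
  "tabloid D T = (\<lambda>r. T ` {x \<in> D. fst x = r})"

definition column_stabilizer :: "nat \<Rightarrow> box set \<Rightarrow> (box \<Rightarrow> nat) \<Rightarrow> (nat \<Rightarrow> nat) set" where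
  "column_stabilizer n D T =
     {\<kappa> \<in> Sym n. \<forall>x\<in>D. \<exists>y\<in>D. snd y = snd x \<and> \<kappa> (T x) = T y}"

text \<open>Formal linear combinations of tabloids are their coefficient functions.\<close>

definition polytabloid :: "nat \<Rightarrow> box set \<Rightarrow> (box \<Rightarrow> nat) \<Rightarrow> ((nat \<Rightarrow> nat set) \<Rightarrow> complex)" where
  "polytabloid n D T =
     (\<lambda>X. \<Sum>\<kappa>\<in>column_stabilizer n D T.
        of_int (sign \<kappa>) * (if tabloid D (\<kappa> \<circ> T) = X then 1 else 0))"

global_interpretation cfun: vector_space "\<lambda>(c::complex) (f :: 'a \<Rightarrow> complex) x. c * f x"
  defines cfun_span = cfun.span
    and cfun_dependent = cfun.dependent
    and cfun_representation = cfun.representation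
  by unfold_locales (auto simp: fun_eq_iff algebra_simps)

definition specht_module :: "nat \<Rightarrow> box set \<Rightarrow> ((nat \<Rightarrow> nat set) \<Rightarrow> complex) set" where
  "specht_module n D = cfun_span (polytabloid n D ` tableaux n D)"

text \<open>
  A permutation acts on tabloids by applying it to the entries, and hence on linear combinations
  of tabloids by sending the basis vector \<open>X\<close> to \<open>\<pi> X\<close>.
\<close>

definition tabloid_action ::
  "(nat \<Rightarrow> nat) \<Rightarrow> ((nat \<Rightarrow> nat set) \<Rightarrow> complex) \<Rightarrow> ((nat \<Rightarrow> nat set) \<Rightarrow> complex)" where
  "tabloid_action \<pi> f = (\<lambda>X. f (\<lambda>r. inv \<pi> ` X r))"

text \<open>The trace of a linear map on a finite-dimensional invariant subspace, in any basis.\<close>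

definition subspace_trace ::
  "('a \<Rightarrow> complex) set \<Rightarrow> (('a \<Rightarrow> complex) \<Rightarrow> ('a \<Rightarrow> complex)) \<Rightarrow> complex" where
  "subspace_trace V L =
     (let B = (SOME B. B \<subseteq> V \<and> \<not> cfun_dependent B \<and> cfun_span B = V)
      in \<Sum>v\<in>B. cfun_representation B (L v) v)"

definition specht_character :: "nat \<Rightarrow> box set \<Rightarrow> (nat \<Rightarrow> nat) \<Rightarrow> complex" where
  "specht_character n D \<pi> = subspace_trace (specht_module n D) (tabloid_action \<pi>)"

text \<open>The character of a direct sum is the sum of the characters.\<close>

definition foulkes :: "nat \<Rightarrow> nat \<Rightarrow> (nat \<Rightarrow> nat) \<Rightarrow> complex" where
  "foulkes n i \<pi> = (\<Sum>D\<in>border_shapes n (i + 1). specht_character n D \<pi>)"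

end

theory Submission
  imports Defs
begin

text \<open>
  Write \<open>P t x = (x + n - 1 - t) choose n\<close> and let \<open>\<ell>\<close> be the number of cycles. Three identities give
  the theorem.

  (1) \<open>x ^ \<ell> \<pi> = (\<Sum>t<n. foulkes n t \<pi> * P t x)\<close> for every \<open>x\<close>. The Specht module of a ribbon is the
  common kernel of the maps that merge two consecutive rows of a tabloid. Peeling off these maps one
  at a time shows that the permutation character on the tabloids with row boundaries \<open>S\<close> is the sum of the
  ribbon characters of all \<open>T \<subseteq> S\<close>, and \<open>x ^ \<ell> \<pi>\<close> counts the \<open>\<pi>\<close>-invariant colourings of \<open>{1..n}\<close> with \<open>x\<close>
  colours, each of which is such a tabloid with an increasing choice of colours.

  (2) \<open>[x ^ \<ell>, y ^ \<ell>] = (\<Sum>t<n. P t x * P t y)\<close>. The inner product is a coefficient of a product of class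
  functions in the group algebra, two of which are the sum of all \<open>n\<close>-cycles. That sum is a signed sum of
  Young symmetrizers of hooks, on which class functions act by scalars; for \<open>x ^ \<ell>\<close> and the hook with
  \<open>t + 1\<close> rows the scalar is \<open>fact n * P t x\<close>.

  (3) \<open>P i (b * x) = b ^ n * (\<Sum>k<n. carries n b i k * P k x)\<close>, by counting the \<open>y\<close> with
  \<open>i + y 1 + \<dots> + y n < b * x\<close> after dividing each \<open>y p\<close> by \<open>b\<close> with remainder.

  The values of \<open>P\<close> at \<open>x = 1, \<dots>, n\<close> form a unitriangular matrix. So (1) expresses \<open>foulkes n t\<close> as a
  combination of the functions \<open>x ^ \<ell>\<close>, (2) turns into the orthonormality of the Foulkes characters, and
  (3) says that \<open>b ^ (\<ell> - n) * foulkes n j\<close> has the coordinates \<open>carries n b i j\<close> with respect to them.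
\<close>

section \<open>Cycles of a permutation\<close>

text \<open>The binomial \<open>(x + n - 1 - t) choose n\<close> enters from three sides. It is
  \<open>1 / fact n\<close> times the product of \<open>x + c\<close> over the contents
  \<open>c = -t, \<dots>, n - 1 - t\<close> of a hook; it is a Vandermonde sum over the supersets of
  a set of \<open>t\<close> row boundaries; and it counts the vectors of \<open>n\<close> naturals
  with sum below \<open>x - t\<close>. This coincidence is what lets the three identities fit
  together. The overlap of two translated classes counts the \<open>\<pi>\<close> with
  \<open>inv \<sigma> \<circ> \<pi>\<close> in one class and \<open>inv \<tau> \<circ> \<pi>\<close>
  in the other; this is how the sum of all n-cycles gets into the inner product. Hooks suffice
  because the irreducible characters that do not vanish on an n-cycle are those of hooks. The
  Foulkes characters are given as traces in unspecified bases, not by a formula, so nothing can be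
  computed from them directly. The proof uses families dual to the evaluations at chains with
  prescribed descents: there a coordinate is a mere value, and traces add along the merging
  maps.\<close>

lemma orbit_eq_of_mem:
  assumes "permutation p" "y \<in> orbit p x"
  shows "orbit p y = orbit p x"
  using assms cyclic_on_orbit'[of p x] orbit_cyclic_eq3[of p "orbit p x" y] by simp

text \<open>\<open>num_cycles\<close> on an arbitrary set: the inductions below insert one point at
  a time, and the two factors of a hook permutation need their cycles counted on their own
  supports.\<close>

definition cyc :: "('a \<Rightarrow> 'a) \<Rightarrow> 'a set \<Rightarrow> nat" where
  "cyc p A = card (orbit p ` A)"

text \<open>\<open>Transposition.transpose x b \<circ> p\<close> splices the new point
  \<open>x\<close> into the cycle of \<open>b\<close>, immediately before \<open>b\<close>: the
  former preimage of \<open>b\<close> goes to \<open>x\<close>, and \<open>x\<close> goes to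
  \<open>b\<close>.\<close>

lemma orbit_insert_Int:
  assumes p: "p permutes B" and x: "x \<notin> B" and b: "b \<in> B" and y: "y \<in> B"
  shows "orbit (Transposition.transpose x b \<circ> p) y \<inter> B = orbit p y"
proof -
  let ?p = "Transposition.transpose x b \<circ> p"
  have pB: "z \<in> B \<Longrightarrow> p z \<in> B" for z using permutes_in_image[OF p] by blast
  have px: "p x = x" using p x by (simp add: permutes_not_in)
  have p'x: "?p x = b" using px by simp
  have p'b: "?p z = x" if "p z = b" for z using that by simp
  have p'o: "?p z = p z" if "z \<in> B" "p z \<noteq> b" for z
    using that pB[OF that(1)] x by (auto simp: Transposition.transpose_def)
  have sub: "z \<in> B" if "z \<in> orbit p y" for z
    using that y pB by (induction) auto
  have 1: "z \<in> orbit ?p y" if "z \<in> orbit p y" for z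
    using that
  proof induction
    case base
    show ?case
      using orbit.base[of ?p y] orbit.step[OF orbit.base[of ?p y]] p'b[of y] p'o[OF y] p'x
      by (cases "p y = b") (simp_all del: comp_apply)
  next
    case (step z)
    then show ?case
      using orbit.step[of z ?p y] orbit.step[of "?p z" ?p y] p'b[of z] p'o[OF sub[OF step.hyps]] p'x
      by (cases "p z = b") (simp_all del: comp_apply)
  qed
  have 2: "(z \<in> B \<longrightarrow> z \<in> orbit p y) \<and> (z = x \<longrightarrow> b \<in> orbit p y) \<and> z \<in> insert x B" 
    if "z \<in> orbit ?p y" for z
    using that
  proof induction
    case base
    show ?case
      by (cases "p y = b") (use y pB x p'b p'o orbit.base[of p y] in \<open>auto simp del: comp_apply\<close>)
  next
    case (step z)
    show ?case
    proof (cases "z = x")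
      case True
      then show ?thesis using step.IH p'x b x by auto
    next
      case False
      then have z: "z \<in> B" "z \<in> orbit p y" using step.IH by auto
      show ?thesis
        by (cases "p z = b") (use z pB x p'b p'o orbit.step[of z p y] in \<open>auto simp del: comp_apply\<close>)
    qed
  qed
  show ?thesis using 1 2 sub by blast
qed

text \<open>For \<open>b = x\<close> the new point is a cycle of its own; otherwise it joins an
  existing cycle, and intersecting with \<open>B\<close> matches the new cycles with the old ones.
  This is the recursion behind all cycle counts below.\<close>

lemma cyc_insert:
  assumes fin: "finite B" and p: "p permutes B" and x: "x \<notin> B" and b: "b \<in> insert x B"
  shows "cyc (Transposition.transpose x b \<circ> p) (insert x B) = (if b = x then Suc (cyc p B) else cyc p B)"
proof (cases "b = x")
  case True
  have sub: "orbit p z \<subseteq> B" if "z \<in> B" for z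
    using permutes_orbit_subset[OF p that] .
  have "orbit p x = {x}" using p x by (simp add: orbit_eq_singleton_iff permutes_not_in)
  moreover have "{x} \<notin> orbit p ` B" using sub x by (metis imageE insert_subset)
  ultimately show ?thesis using True fin by (simp add: cyc_def)
next
  case False
  with b have b: "b \<in> B" by simp
  let ?p = "Transposition.transpose x b \<circ> p"
  have p': "?p permutes insert x B"
    using p b by (intro permutes_compose permutes_swap_id permutes_imp_permutes_insert) auto
  have perm: "permutation ?p" using p' fin by (metis finite_insert permutes_imp_permutation)
  have "?p x = b" using p x by (simp add: permutes_not_in)
  then have "orbit ?p x = orbit ?p b"
    using orbit_eq_of_mem[OF perm] orbit.base[of ?p x] by auto
  then have "orbit ?p ` insert x B = orbit ?p ` B" using b by auto
  moreover have "card (orbit ?p ` B) = card (orbit p ` B)"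
  proof -
    have "bij_betw (\<lambda>Q. Q \<inter> B) (orbit ?p ` B) (orbit p ` B)"
    proof (rule bij_betw_imageI)
      show "inj_on (\<lambda>Q. Q \<inter> B) (orbit ?p ` B)"
      proof (rule inj_onI, clarify)
        fix y z assume yz: "y \<in> B" "z \<in> B" "orbit ?p y \<inter> B = orbit ?p z \<inter> B"
        have "y \<in> orbit ?p y" using perm by (rule permutation_self_in_orbit)
        then show "orbit ?p y = orbit ?p z" using yz orbit_eq_of_mem[OF perm] by blast
      qed
      show "(\<lambda>Q. Q \<inter> B) ` orbit ?p ` B = orbit p ` B"
        using orbit_insert_Int[OF p x b] by (force simp: image_image)
    qed
    then show ?thesis by (rule bij_betw_same_card)
  qed
  ultimately show ?thesis using False by (simp add: cyc_def)
qed

lemma permutes_insertE: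
  assumes "p permutes insert x B"
  obtains b q where "p = Transposition.transpose x b \<circ> q" "b \<in> insert x B" "q permutes B"
proof -
  have "p \<in> {p. p permutes insert x B}" using assms by simp
  then show thesis unfolding permutes_insert[of x B] using that by auto
qed

lemma permutes_insert_induct [consumes 2, case_names empty insert]:
  assumes "finite S" "p permutes S"
    and "P {} id"
    and "\<And>x B b p. finite B \<Longrightarrow> x \<notin> B \<Longrightarrow> p permutes B \<Longrightarrow> b \<in> insert x B \<Longrightarrow> P B p
           \<Longrightarrow> P (insert x B) (Transposition.transpose x b \<circ> p)"
  shows "P S p"
  using assms(1,2)
proof (induction S arbitrary: p rule: finite_induct)
  case empty
  then have "p = id" by simp
  with assms(3) show ?case by (simp only:)
next
  case (insert x F)
  obtain b q where *: "p = Transposition.transpose x b \<circ> q" "b \<in> insert x F" "q permutes F"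
    using insert.prems by (rule permutes_insertE)
  show ?case unfolding *(1) by (rule assms(4)[OF insert.hyps *(3,2) insert.IH[OF *(3)]])
qed

lemma sign_cyc:
  assumes "finite S" "p permutes S"
  shows "sign p = (-1) ^ (card S + cyc p S)"
  using assms
proof (induction rule: permutes_insert_induct)
  case empty
  then show ?case by (simp add: cyc_def)
next
  case (insert x B b p)
  have "permutation p" using insert by (auto intro: permutes_imp_permutation)
  then have "sign (Transposition.transpose x b \<circ> p) = sign (Transposition.transpose x b) * sign p"
    by (simp add: sign_compose permutation_swap_id)
  moreover have "cyc (Transposition.transpose x b \<circ> p) (insert x B) = (if b = x then Suc (cyc p B) else cyc p B)"
    using insert.hyps by (intro cyc_insert)
  ultimately show ?case using insert.hyps(1,2)
    by (cases "b = x") (simp_all only: insert.IH sign_swap_id card_insert_disjoint, simp_all)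
qed

text \<open>The supports share only \<open>j\<close>, so the cycles of \<open>q\<close> and
  \<open>p\<close> through \<open>j\<close> fuse into one and all others survive. The induction
  inserts the points of \<open>B\<close> into \<open>p\<close>. Since \<open>q\<close> fixes the
  inserted \<open>x\<close>, moving \<open>q\<close> past the transposition turns an insertion into
  \<open>p\<close> at \<open>b\<close> into an insertion into \<open>q \<circ> p\<close> at
  \<open>q b\<close>.\<close>

lemma cyc_join:
  assumes "finite A" "finite B" and "j \<notin> A" "j \<notin> B" "A \<inter> B = {}"
    and q: "q permutes insert j A" and p: "p permutes insert j B"
  shows "Suc (cyc (q \<circ> p) (insert j (A \<union> B))) = cyc q (insert j A) + cyc p (insert j B)"
  using assms(2,4,5,7)
proof (induction B arbitrary: p rule: finite_induct)
  case empty
  then have p: "p = id" by simp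
  have "cyc (id :: 'a \<Rightarrow> 'a) {j} = 1" by (simp add: cyc_def)
  then show ?case unfolding p by (simp only: comp_id Un_empty_right)
next
  case (insert x B)
  let ?B = "insert j B"
  have "p permutes insert x ?B" using insert.prems by (simp add: insert_commute)
  then obtain b p' where p: "p = Transposition.transpose x b \<circ> p'" "b \<in> insert x ?B" "p' permutes ?B"
    by (rule permutes_insertE)
  have xA: "x \<notin> insert j A" using insert by auto
  have qx: "q x = x" using q xA by (simp add: permutes_not_in)
  have qp: "q \<circ> p' permutes insert j (A \<union> B)"
    using permutes_subset[OF q, of "insert j (A \<union> B)"] permutes_subset[OF p(3), of "insert j (A \<union> B)"]
    by (auto intro: permutes_compose)
  have "q \<circ> Transposition.transpose x b = Transposition.transpose x (q b) \<circ> q"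
    using transpose_comp_eq[OF permutes_bij[OF q], of x "q b"] permutes_inverses(2)[OF q] qx
      permutes_inv_eq[OF q, of x x] by simp
  then have eq: "q \<circ> p = Transposition.transpose x (q b) \<circ> (q \<circ> p')" unfolding p(1) by (simp add: o_assoc)
  have b': "q b \<in> insert x (insert j (A \<union> B))"
    using p(2) qx permutes_in_image[OF permutes_subset[OF q, of "insert j (A \<union> B)"], of b] by auto
  have qb: "q b = x \<longleftrightarrow> b = x" using qx permutes_inj[OF q] by (metis injD)
  have ih: "Suc (cyc (q \<circ> p') (insert j (A \<union> B))) = cyc q (insert j A) + cyc p' ?B"
    by (rule insert.IH[OF _ _ p(3)]) (use insert.prems in auto)
  have c1: "cyc (q \<circ> p) (insert x (insert j (A \<union> B))) = (if b = x then Suc (cyc (q \<circ> p') (insert j (A \<union> B))) else cyc (q \<circ> p') (insert j (A \<union> B)))"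
    unfolding eq qb[symmetric] by (rule cyc_insert[OF _ qp _ b']) (use xA insert assms(1) in auto)
  have c2: "cyc p (insert x ?B) = (if b = x then Suc (cyc p' ?B) else cyc p' ?B)"
    unfolding p(1) by (rule cyc_insert[OF _ p(3) _ p(2)]) (use insert xA in auto)
  have e: "insert j (A \<union> insert x B) = insert x (insert j (A \<union> B))" "insert j (insert x B) = insert x ?B" by auto
  show ?case unfolding e c1 c2 using ih by presburger
qed

text \<open>The generating function of the Stirling numbers of the first kind. Inserting a point
  multiplies it by \<open>y\<close> for a new fixed point plus 1 for each place in an existing
  cycle.\<close>

lemma sum_power_cyc:
  fixes y :: "'b::comm_ring_1"
  assumes "finite S"
  shows "(\<Sum>p | p permutes S. y ^ cyc p S) = pochhammer y (card S)"
  using assms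
proof (induction S rule: finite_induct)
  case empty
  then show ?case by (simp add: cyc_def)
next
  case (insert x F)
  have "(\<Sum>p | p permutes insert x F. y ^ cyc p (insert x F)) =
    (\<Sum>b\<in>insert x F. \<Sum>q | q permutes F. y ^ cyc (Transposition.transpose x b \<circ> q) (insert x F))"
    using insert.hyps by (rule sum_over_permutations_insert)
  also have "\<dots> = (\<Sum>b\<in>insert x F. \<Sum>q | q permutes F. (if b = x then y else 1) * y ^ cyc q F)"
    by (intro sum.cong refl) (use cyc_insert insert.hyps in \<open>force simp del: comp_apply\<close>)
  also have "\<dots> = (\<Sum>b\<in>insert x F. (if b = x then y else 1)) * pochhammer y (card F)"
    unfolding insert.IH[symmetric] by (simp add: sum_product)
  also have "(\<Sum>b\<in>insert x F. (if b = x then y else 1)) = y + of_nat (card F)"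
  proof -
    have "(\<Sum>b\<in>F. (if b = x then y else 1)) = (\<Sum>b\<in>F. 1)" using insert by (intro sum.cong) auto
    then show ?thesis using insert by simp
  qed
  finally show ?case using insert by (simp add: pochhammer_Suc mult.commute)
qed

text \<open>A single cycle arises only by inserting a point, not as a fixed point, into a single
  cycle; there is one way for each point already present.\<close>

lemma card_cyc_1:
  assumes "finite F" "x \<notin> F"
  shows "card {p. p permutes insert x F \<and> cyc p (insert x F) = 1} = fact (card F)"
  using assms
proof (induction F rule: finite_induct)
  case empty
  have "{p. p permutes {x} \<and> cyc p {x} = 1} = {id}" by (auto simp: cyc_def)
  then show ?case by simp
next
  case (insert z F)
  let ?G = "insert x F"
  have pos: "cyc q ?G \<noteq> 0" for q using insert by (simp add: cyc_def)
  have z: "z \<notin> ?G" using insert by auto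
  have "card {p. p permutes insert z ?G \<and> cyc p (insert z ?G) = 1}
      = (\<Sum>p | p permutes insert z ?G. of_bool (cyc p (insert z ?G) = 1))"
    using insert by (simp add: finite_permutations Int_def)
  also have "\<dots> = (\<Sum>b\<in>insert z ?G. \<Sum>q | q permutes ?G. of_bool (cyc (Transposition.transpose z b \<circ> q) (insert z ?G) = 1))"
    using insert z by (intro sum_over_permutations_insert) auto
  also have "\<dots> = (\<Sum>b\<in>insert z ?G. \<Sum>q | q permutes ?G. of_bool (b \<noteq> z) * of_bool (cyc q ?G = 1))"
    
  proof (intro sum.cong refl)
    fix b q assume b: "b \<in> insert z ?G" and q: "q \<in> {q. q permutes ?G}"
    then have c: "cyc (Transposition.transpose z b \<circ> q) (insert z ?G) = (if b = z then Suc (cyc q ?G) else cyc q ?G)"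
      using z insert.hyps(1) by (intro cyc_insert) auto
    show "(of_bool (cyc (Transposition.transpose z b \<circ> q) (insert z ?G) = 1) :: nat) = of_bool (b \<noteq> z) * of_bool (cyc q ?G = 1)"
      unfolding c using pos[of q] by simp
  qed
  also have "\<dots> = (\<Sum>b\<in>insert z ?G. of_bool (b \<noteq> z)) * (\<Sum>q | q permutes ?G. of_bool (cyc q ?G = 1))"
    by (simp add: sum_product)
  also have "(\<Sum>q | q permutes ?G. of_bool (cyc q ?G = 1)) = card {p. p permutes ?G \<and> cyc p ?G = 1}"
    using insert by (simp add: finite_permutations Int_def)
  also have "(\<Sum>b\<in>insert z ?G. of_bool (b \<noteq> z)) = card ?G"
  proof -
    have "insert z ?G \<inter> {b. b \<noteq> z} = ?G" using z by auto
    then show ?thesis using insert by simp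
  qed
  finally show ?case using insert by (simp add: insert_commute)
qed

section \<open>Hook symmetrizers in the group algebra\<close>

lemma inv_o_permutes:
  assumes "p permutes S" "q permutes S"
  shows "inv (p \<circ> q) = inv q \<circ> inv p"
  using assms by (simp add: o_inv_distrib permutes_bij)

lemma o_inv_cancel:
  assumes "p permutes S"
  shows "p \<circ> (inv p \<circ> g) = g" "inv p \<circ> (p \<circ> g) = g" "(g \<circ> p) \<circ> inv p = g" "(g \<circ> inv p) \<circ> p = g"
  using permutes_inverses[OF assms] by (simp_all add: fun_eq_iff)

definition conv :: "'a set \<Rightarrow> (('a \<Rightarrow> 'a) \<Rightarrow> 'b::comm_ring_1) \<Rightarrow> (('a \<Rightarrow> 'a) \<Rightarrow> 'b) \<Rightarrow> ('a \<Rightarrow> 'a) \<Rightarrow> 'b" where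
  "conv S F G \<pi> = (\<Sum>\<sigma> | \<sigma> permutes S. F \<sigma> * G (inv \<sigma> \<circ> \<pi>))"

lemma sum_permutes_left:
  assumes "q permutes S"
  shows "(\<Sum>\<sigma> | \<sigma> permutes S. f \<sigma>) = (\<Sum>\<sigma> | \<sigma> permutes S. f (q \<circ> \<sigma>))"
proof (rule sum.reindex_bij_witness[where j = "\<lambda>\<sigma>. inv q \<circ> \<sigma>" and i = "\<lambda>\<sigma>. q \<circ> \<sigma>"])
qed (simp_all add: o_inv_cancel[OF assms] permutes_compose[OF _ assms] permutes_compose[OF _ permutes_inv[OF assms]])

lemma conv_assoc:
  assumes "\<pi> permutes S"
  shows "conv S (conv S F G) H \<pi> = conv S F (conv S G H) \<pi>"
proof -
  have "conv S (conv S F G) H \<pi> =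
      (\<Sum>\<rho> | \<rho> permutes S. \<Sum>\<sigma> | \<sigma> permutes S. F \<rho> * (G (inv \<rho> \<circ> \<sigma>) * H (inv \<sigma> \<circ> \<pi>)))"
    unfolding conv_def by (subst sum.swap) (simp add: sum_distrib_right mult.assoc)
  also have "\<dots> = (\<Sum>\<rho> | \<rho> permutes S. \<Sum>\<sigma> | \<sigma> permutes S. F \<rho> * (G \<sigma> * H (inv \<sigma> \<circ> (inv \<rho> \<circ> \<pi>))))"
  proof (rule sum.cong[OF refl])
    fix \<rho> assume "\<rho> \<in> {\<rho>. \<rho> permutes S}"
    then have \<rho>: "\<rho> permutes S" by simp
    show "(\<Sum>\<sigma> | \<sigma> permutes S. F \<rho> * (G (inv \<rho> \<circ> \<sigma>) * H (inv \<sigma> \<circ> \<pi>))) =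
      (\<Sum>\<sigma> | \<sigma> permutes S. F \<rho> * (G \<sigma> * H (inv \<sigma> \<circ> (inv \<rho> \<circ> \<pi>))))"
      by (subst sum_permutes_left[OF \<rho>], intro sum.cong refl)
         (use \<rho> in \<open>simp add: o_inv_cancel inv_o_permutes comp_assoc\<close>)
  qed
  also have "\<dots> = conv S F (conv S G H) \<pi>"
    unfolding conv_def by (simp add: sum_distrib_left)
  finally show ?thesis .
qed

text \<open>Invariance under inversion is included. Functions of the number of cycles have it, and
  it identifies the sum of \<open>F \<pi> * G \<pi>\<close> with the coefficient of a convolution at
  \<open>id\<close>.\<close>

definition class_fun :: "'a set \<Rightarrow> (('a \<Rightarrow> 'a) \<Rightarrow> 'b) \<Rightarrow> bool" where
  "class_fun S Z \<longleftrightarrow>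
    (\<forall>\<sigma> \<rho>. \<sigma> permutes S \<longrightarrow> \<rho> permutes S \<longrightarrow> Z (\<sigma> \<circ> \<rho>) = Z (\<rho> \<circ> \<sigma>)) \<and>
    (\<forall>\<sigma>. \<sigma> permutes S \<longrightarrow> Z (inv \<sigma>) = Z \<sigma>)"

lemma orbit_image_mem:
  assumes "y \<in> orbit h x" and "\<And>z. g (h z) = k (g z)"
  shows "g y \<in> orbit k (g x)"
  using assms(1) by induction (auto simp: assms(2) intro: orbit.intros)

lemma orbit_comp_swap: "y \<in> orbit (f \<circ> g) x \<Longrightarrow> g y \<in> orbit (g \<circ> f) (g x)"
  by (erule orbit_image_mem) simp

text \<open>\<open>\<rho>\<close> maps the orbits of \<open>\<sigma> \<circ> \<rho>\<close>
  injectively to orbits of \<open>\<rho> \<circ> \<sigma>\<close>. This gives one inequality between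
  the numbers of cycles; exchanging the two permutations gives the other.\<close>

lemma class_fun_cyc:
  assumes S: "finite S"
  shows "class_fun S (\<lambda>\<sigma>. h (cyc \<sigma> S))"
proof -
  have le: "cyc (\<sigma> \<circ> \<rho>) S \<le> cyc (\<rho> \<circ> \<sigma>) S" if "\<sigma> permutes S" "\<rho> permutes S" for \<sigma> \<rho>
  proof -
    have "bij \<rho>" using that permutes_bij by blast
    have 1: "\<rho> ` orbit (\<sigma> \<circ> \<rho>) x \<subseteq> orbit (\<rho> \<circ> \<sigma>) (\<rho> x)" for x
      using orbit_comp_swap[of _ \<sigma> \<rho> x] by auto
    have 2: "orbit (\<rho> \<circ> \<sigma>) (\<rho> x) \<subseteq> \<rho> ` orbit (\<sigma> \<circ> \<rho>) x" for x
    proof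
      fix y assume "y \<in> orbit (\<rho> \<circ> \<sigma>) (\<rho> x)"
      then have "\<sigma> y \<in> orbit (\<sigma> \<circ> \<rho>) (\<sigma> (\<rho> x))" by (rule orbit_comp_swap)
      also have "orbit (\<sigma> \<circ> \<rho>) (\<sigma> (\<rho> x)) = orbit (\<sigma> \<circ> \<rho>) x"
      proof -
        have "permutation (\<sigma> \<circ> \<rho>)" using that S permutes_compose permutes_imp_permutation by blast
        then show ?thesis using permutation_orbit_step[of "\<sigma> \<circ> \<rho>" x] by simp
      qed
      finally have y: "\<sigma> y \<in> orbit (\<sigma> \<circ> \<rho>) x" .
      define z where "z = inv \<rho> y"
      have z: "\<rho> z = y" unfolding z_def using that permutes_inverses by metis
      have perm: "permutation (\<sigma> \<circ> \<rho>)" using that S permutes_compose permutes_imp_permutation by blast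
      have "(\<sigma> \<circ> \<rho>) z \<in> orbit (\<sigma> \<circ> \<rho>) x" using y z by simp
      then have "orbit (\<sigma> \<circ> \<rho>) z = orbit (\<sigma> \<circ> \<rho>) x"
        using orbit_eq_of_mem[OF perm] permutation_orbit_step[OF perm, of z] by metis
      then have "z \<in> orbit (\<sigma> \<circ> \<rho>) x" using permutation_self_in_orbit[OF perm, of z] by simp
      then show "y \<in> \<rho> ` orbit (\<sigma> \<circ> \<rho>) x" using z by blast
    qed
    have eq: "\<rho> ` orbit (\<sigma> \<circ> \<rho>) x = orbit (\<rho> \<circ> \<sigma>) (\<rho> x)" for x using 1 2 by blast
    have "(`) \<rho> ` (orbit (\<sigma> \<circ> \<rho>) ` S) \<subseteq> orbit (\<rho> \<circ> \<sigma>) ` S"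
      using eq permutes_in_image[OF that(2)] by auto
    moreover have "inj_on ((`) \<rho>) (orbit (\<sigma> \<circ> \<rho>) ` S)"
      using \<open>bij \<rho>\<close> by (intro inj_onI) (metis bij_is_inj inj_image_eq_iff)
    ultimately show ?thesis unfolding cyc_def using S by (intro card_inj_on_le) auto
  qed
  show ?thesis unfolding class_fun_def
    using le S by (auto intro!: arg_cong[of _ _ h] antisym simp: cyc_def orbit_inv_eq permutes_imp_permutation)
qed

text \<open>
  The Young symmetrizer of the hook with corner \<open>j\<close>, column \<open>insert j A\<close> and row \<open>insert j B\<close>.
\<close>

definition hook_elem :: "'a \<Rightarrow> 'a set \<Rightarrow> 'a set \<Rightarrow> ('a \<Rightarrow> 'a) \<Rightarrow> 'b::comm_ring_1" where
  "hook_elem j A B \<pi> = (\<Sum>q | q permutes insert j A. \<Sum>p | p permutes insert j B.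
     if \<pi> = q \<circ> p then of_int (sign q) else 0)"

context
  fixes S A B :: "'a set" and j :: 'a
  assumes fin: "finite S" and S: "S = insert j (A \<union> B)"
    and disj: "A \<inter> B = {}" "j \<notin> A" "j \<notin> B"
begin

lemma finAB: "finite A" "finite B" using fin S by auto

lemma hook_sub:
  "q permutes insert j A \<Longrightarrow> q permutes S" "p permutes insert j B \<Longrightarrow> p permutes S"
  using S by (auto elim!: permutes_subset)

text \<open>\<open>p\<close> and \<open>p'\<close> fix \<open>A\<close>, so \<open>q\<close> and
  \<open>q'\<close> agree there; outside \<open>insert j A\<close> both are the identity, and a
  bijection is determined by its values at all points but one.\<close>

lemma hook_factor_unique:
  assumes "q permutes insert j A" "q' permutes insert j A" "p permutes insert j B" "p' permutes insert j B"
    and eq: "q \<circ> p = q' \<circ> p'"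
  shows "q = q'" "p = p'"
proof -
  have 1: "q x = q' x" if "x \<noteq> j" for x
  proof (cases "x \<in> A")
    case True
    then have "p x = x" "p' x = x" using assms(3,4) disj by (auto simp: permutes_def)
    then show ?thesis using fun_cong[OF eq, of x] by simp
  next
    case False
    then show ?thesis using that assms(1,2) by (auto simp: permutes_def)
  qed
  have "q j = q' j"
  proof (rule ccontr)
    assume ne: "q j \<noteq> q' j"
    obtain x where x: "q x = q' j" using permutes_surj[OF assms(1)] by (metis surjD)
    with ne have "x \<noteq> j" by auto
    with 1 x have "q' x = q' j" by metis
    then show False using permutes_inj[OF assms(2)] \<open>x \<noteq> j\<close> by (auto dest: injD)
  qed
  with 1 show "q = q'" by (intro ext) metis
  with eq show "p = p'"
    using o_inv_cancel(2)[OF assms(2)] by metis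
qed

lemma hook_elem_comp:
  assumes "q permutes insert j A" "p permutes insert j B"
  shows "hook_elem j A B (q \<circ> p) = (of_int (sign q) :: 'b::comm_ring_1)"
proof -
  have "(hook_elem j A B (q \<circ> p) :: 'b) = (\<Sum>q' | q' permutes insert j A. \<Sum>p' | p' permutes insert j B.
     if q' = q then (if p' = p then of_int (sign q) else 0) else 0)"
    unfolding hook_elem_def
  proof (intro sum.cong refl)
    fix q' p' assume "q' \<in> {q. q permutes insert j A}" "p' \<in> {p. p permutes insert j B}"
    then have "q \<circ> p = q' \<circ> p' \<longleftrightarrow> q' = q \<and> p' = p"
      using hook_factor_unique[of q q' p p'] assms by auto
    then show "(if q \<circ> p = q' \<circ> p' then of_int (sign q') else 0) =
      (if q' = q then (if p' = p then of_int (sign q) else 0) else (0 :: 'b))" by auto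
  qed
  also have "\<dots> = of_int (sign q)"
  proof -
    have "(\<Sum>p' | p' permutes insert j B. if q' = q then if p' = p then of_int (sign q) else 0 else (0 :: 'b)) =
      (if q' = q then of_int (sign q) else 0)" for q'
      using assms(2) finAB by (cases "q' = q") (simp_all add: finite_permutations)
    then show ?thesis using assms(1) finAB by (simp add: finite_permutations)
  qed
  finally show ?thesis .
qed

lemma hook_elem_eq_0:
  assumes "\<not> g ` A \<subseteq> insert j A"
  shows "hook_elem j A B g = 0"
proof -
  have "g \<noteq> q \<circ> p" if "q permutes insert j A" "p permutes insert j B" for q p
  proof
    assume g: "g = q \<circ> p"
    have "g a \<in> insert j A" if "a \<in> A" for a
    proof -
      have "p a = a" using that \<open>p permutes _\<close> disj by (auto simp: permutes_def)
      then show ?thesis using g permutes_in_image[OF \<open>q permutes _\<close>, of a] that by simp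
    qed
    with assms show False by auto
  qed
  then show ?thesis unfolding hook_elem_def by (intro sum.neutral) (auto intro!: sum.neutral)
qed

text \<open>On \<open>A\<close> the factor \<open>q\<close> has to agree with \<open>g\<close>,
  because the row factor fixes \<open>A\<close>; this leaves a single possible value at
  \<open>j\<close>. So the support of a hook symmetrizer consists of the \<open>g\<close> that keep
  \<open>A\<close> inside the column.\<close>

lemma hook_factor:
  assumes g: "g permutes S" and sub: "g ` A \<subseteq> insert j A"
  obtains q p where "q permutes insert j A" "p permutes insert j B" "g = q \<circ> p"
proof -
  have inj: "inj_on g A" using permutes_inj[OF g] by (auto intro: inj_on_subset)
  have "card (insert j A - g ` A) = 1"
    using inj sub finAB disj by (simp add: card_Diff_subset card_image)
  then obtain m where m: "insert j A - g ` A = {m}" by (auto simp: card_1_singleton_iff)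
  define q where "q x = (if x \<in> A then g x else if x = j then m else x)" for x
  have q: "q permutes insert j A"
  proof (rule bij_imp_permutes)
    have "q ` insert j A = insert m (g ` A)" unfolding q_def using disj by auto
    also have "\<dots> = insert j A" using m sub by auto
    finally have im: "q ` insert j A = insert j A" .
    moreover have "inj_on q (insert j A)"
      by (rule eq_card_imp_inj_on) (simp_all only: im, use finAB in simp)
    ultimately show "bij_betw q (insert j A) (insert j A)" by (simp only: bij_betw_def simp_thms)
  qed (auto simp: q_def)
  define p where "p = inv q \<circ> g"
  have "p permutes S" unfolding p_def
    using q g hook_sub permutes_inv permutes_compose by metis
  moreover have "p x = x" if "x \<in> S - insert j B" for x
  proof -
    have "x \<in> A" using that S by auto
    then have "g x = q x" by (simp add: q_def)
    then show ?thesis by (simp only: p_def comp_apply permutes_inverses(2)[OF q])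
  qed
  ultimately have "p permutes insert j B" by (rule permutes_superset)
  moreover have "g = q \<circ> p" unfolding p_def using o_inv_cancel(1)[OF q] by simp
  ultimately show thesis using q that by blast
qed

text \<open>
  This is von Neumann's lemma for hooks. It makes every class function act on a hook symmetrizer by a
  scalar, which replaces Schur's lemma below.
\<close>

lemma hook_elem_unique:
  fixes F :: "('a \<Rightarrow> 'a) \<Rightarrow> 'b::field_char_0"
  assumes left: "\<And>q g. q permutes insert j A \<Longrightarrow> g permutes S \<Longrightarrow> F (q \<circ> g) = of_int (sign q) * F g"
    and right: "\<And>p g. p permutes insert j B \<Longrightarrow> g permutes S \<Longrightarrow> F (g \<circ> p) = F g"
    and g: "g permutes S"
  shows "F g = F id * hook_elem j A B g"
proof (cases "g ` A \<subseteq> insert j A")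
  case True
  with g obtain q p where qp: "q permutes insert j A" "p permutes insert j B" "g = q \<circ> p"
    by (rule hook_factor)
  have 1: "F g = of_int (sign q) * F p"
    unfolding qp(3) by (rule left[OF qp(1) hook_sub(2)[OF qp(2)]])
  have 2: "F p = F id" using right[OF qp(2) permutes_id] by (simp only: id_comp)
  have 3: "hook_elem j A B g = (of_int (sign q) :: 'b)" unfolding qp(3) by (rule hook_elem_comp[OF qp(1,2)])
  show ?thesis unfolding 1 2 3 by (rule mult.commute)
next
  case False
  then obtain a where a: "a \<in> A" "g a \<notin> insert j A" by auto
  have inS: "g x \<in> S \<longleftrightarrow> x \<in> S" for x using permutes_in_image[OF g] .
  have ga: "g a \<in> B" using a inS[of a] S by auto
  \<comment> \<open>Pigeonhole: \<open>g a\<close> already occupies one place of \<open>B\<close>,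
    so \<open>g\<close> can send at most \<open>card B - 1\<close> of the \<open>card B + 1\<close>
    row points into \<open>B\<close>, and two of them land in the column.\<close>
  have "\<exists>k\<in>insert j B. \<exists>l\<in>insert j B. k \<noteq> l \<and> g k \<in> insert j A \<and> g l \<in> insert j A"
  proof (rule ccontr)
    assume no: "\<not> ?thesis"
    let ?C = "{k \<in> insert j B. g k \<in> insert j A}"
    have fC: "finite ?C" using finAB by simp
    have "card ?C \<le> 1"
      unfolding One_nat_def card_le_Suc0_iff_eq[OF fC] using no by blast
    moreover have "g ` (insert j B - ?C) \<subseteq> B - {g a}"
    proof (rule image_subsetI)
      fix k assume k: "k \<in> insert j B - ?C"
      then have "g k \<in> B" using inS[of k] S by auto
      moreover have "g k \<noteq> g a" using injD[OF permutes_inj[OF g], of k a] k a disj by auto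
      ultimately show "g k \<in> B - {g a}" by simp
    qed
    then have "card (insert j B - ?C) \<le> card (B - {g a})"
      using permutes_inj[OF g] finAB by (intro card_inj_on_le[where f = g]) (auto intro: inj_on_subset)
    moreover have "card (insert j B - ?C) = card (insert j B) - card ?C"
      using fC by (intro card_Diff_subset) auto
    moreover have "card (B - {g a}) < card B" using ga finAB by (intro psubset_card_mono) auto
    moreover have "card (insert j B) = Suc (card B)" using disj finAB by simp
    ultimately show False by linarith
  qed
  then obtain k l where kl: "k \<in> insert j B" "l \<in> insert j B" "k \<noteq> l" "g k \<in> insert j A" "g l \<in> insert j A"
    by blast
  have t: "Transposition.transpose k l permutes insert j B" using kl by (intro permutes_swap_id)
  have t': "Transposition.transpose (g k) (g l) permutes insert j A" using kl by (intro permutes_swap_id)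
  \<comment> \<open>The same transposition acts from the right inside the row, where
    \<open>F\<close> is invariant, and from the left inside the column, where \<open>F\<close>
    changes sign.\<close>
  have comm: "Transposition.transpose (g k) (g l) \<circ> g = g \<circ> Transposition.transpose k l"
    using transpose_comp_eq[OF permutes_bij[OF g], of "g k" "g l"]
    by (simp only: permutes_inverses(2)[OF g])
  have "g k \<noteq> g l" using kl(3) injD[OF permutes_inj[OF g], of k l] by blast
  then have s: "sign (Transposition.transpose (g k) (g l)) = -1" by (simp add: sign_swap_id)
  have "F g = F (g \<circ> Transposition.transpose k l)" by (rule right[OF t g, symmetric])
  also have "\<dots> = F (Transposition.transpose (g k) (g l) \<circ> g)" by (simp only: comm)
  also have "\<dots> = - F g" unfolding left[OF t' g] s by simp
  finally have "F g = - F g" .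
  then have "F g = 0" by simp
  then show ?thesis by (simp only: hook_elem_eq_0[OF False] mult_zero_right)
qed

lemma hook_elem_left:
  assumes q: "q permutes insert j A" and g: "g permutes S"
  shows "hook_elem j A B (q \<circ> g) = of_int (sign q) * (hook_elem j A B g :: 'b::comm_ring_1)"
proof (cases "g ` A \<subseteq> insert j A")
  case True
  with g obtain q' p where qp: "q' permutes insert j A" "p permutes insert j B" "g = q' \<circ> p"
    by (rule hook_factor)
  have "permutation q" "permutation q'" using q qp(1) finAB by (auto intro: permutes_imp_permutation)
  then have s: "of_int (sign (q \<circ> q')) = (of_int (sign q) * of_int (sign q') :: 'b)"
    by (simp only: sign_compose of_int_mult)
  show ?thesis
    unfolding qp(3) o_assoc hook_elem_comp[OF qp(1,2)] hook_elem_comp[OF permutes_compose[OF qp(1) q] qp(2)] s ..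
next
  case False
  then have "\<not> (q \<circ> g) ` A \<subseteq> insert j A"
    using permutes_in_image[OF q] by (auto simp: image_subset_iff)
  then show ?thesis using False by (simp add: hook_elem_eq_0)
qed

lemma hook_elem_right:
  assumes p: "p permutes insert j B" and g: "g permutes S"
  shows "hook_elem j A B (g \<circ> p) = hook_elem j A B g"
proof (cases "g ` A \<subseteq> insert j A")
  case True
  with g obtain q p' where qp: "q permutes insert j A" "p' permutes insert j B" "g = q \<circ> p'"
    by (rule hook_factor)
  show ?thesis
    unfolding qp(3) o_assoc[symmetric] hook_elem_comp[OF qp(1,2)] hook_elem_comp[OF qp(1) permutes_compose[OF p qp(2)]] ..
next
  case False
  have "p a = a" if "a \<in> A" for a using that p disj by (auto simp: permutes_def)
  then have "(g \<circ> p) ` A = g ` A" by (auto simp: image_iff)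
  then show ?thesis using False by (simp add: hook_elem_eq_0)
qed

text \<open>A class function commutes with every permutation, so the product transforms under the
  column on the left and the row on the right as \<open>hook_elem j A B\<close> does, and
  \<open>hook_elem_unique\<close> makes it a multiple of it. The factor is its value at
  \<open>id\<close>.\<close>

lemma conv_hook_elem:
  fixes Z :: "('a \<Rightarrow> 'a) \<Rightarrow> 'b::field_char_0"
  assumes Z: "class_fun S Z" and g: "g permutes S"
  shows "conv S (hook_elem j A B) Z g =
    (\<Sum>q | q permutes insert j A. \<Sum>p | p permutes insert j B. of_int (sign q) * Z (q \<circ> p)) * hook_elem j A B g"
proof -
  let ?Y = "hook_elem j A B :: ('a \<Rightarrow> 'a) \<Rightarrow> 'b"
  have Zc: "Z (\<sigma> \<circ> \<rho>) = Z (\<rho> \<circ> \<sigma>)" "Z (inv \<sigma>) = Z \<sigma>" if "\<sigma> permutes S" "\<rho> permutes S" for \<sigma> \<rho>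
    using Z that unfolding class_fun_def by auto
  have "conv S ?Y Z g = conv S ?Y Z id * ?Y g"
  proof (rule hook_elem_unique[OF _ _ g])
    fix q g assume q: "q permutes insert j A" and g: "g permutes S"
    have qS: "q permutes S" using q by (rule hook_sub)
    show "conv S ?Y Z (q \<circ> g) = of_int (sign q) * conv S ?Y Z g"
      unfolding conv_def sum_distrib_left
      by (subst sum_permutes_left[OF qS], intro sum.cong refl)
         (simp add: hook_elem_left[OF q] inv_o_permutes[OF qS] o_inv_cancel[OF qS] o_assoc[symmetric])
  next
    fix p g assume p: "p permutes insert j B" and g: "g permutes S"
    have pS: "p permutes S" using p by (rule hook_sub)
    have "conv S ?Y Z (g \<circ> p) = (\<Sum>\<sigma> | \<sigma> permutes S. ?Y (\<sigma> \<circ> inv p) * Z (inv (\<sigma> \<circ> inv p) \<circ> g))"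
      unfolding conv_def
    proof (intro sum.cong refl)
      fix \<sigma> assume "\<sigma> \<in> {\<sigma>. \<sigma> permutes S}"
      then have \<sigma>: "\<sigma> permutes S" by simp
      have "Z (inv \<sigma> \<circ> (g \<circ> p)) = Z (p \<circ> (inv \<sigma> \<circ> g))"
        using Zc(1)[OF pS, of "inv \<sigma> \<circ> g"] g \<sigma> by (simp add: permutes_inv permutes_compose o_assoc)
      moreover have "inv (\<sigma> \<circ> inv p) = p \<circ> inv \<sigma>"
        using inv_o_permutes[OF \<sigma> permutes_inv[OF pS]] permutes_inv_inv[OF pS] by simp
      ultimately show "?Y \<sigma> * Z (inv \<sigma> \<circ> (g \<circ> p)) = ?Y (\<sigma> \<circ> inv p) * Z (inv (\<sigma> \<circ> inv p) \<circ> g)"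
        using hook_elem_right[OF permutes_inv[OF p] \<sigma>, where ?'b = 'b] by (simp add: o_assoc)
    qed
    also have "\<dots> = conv S ?Y Z g"
      unfolding conv_def
      by (rule sum.reindex_bij_witness[where j = "\<lambda>\<sigma>. \<sigma> \<circ> inv p" and i = "\<lambda>\<sigma>. \<sigma> \<circ> p"])
         (use pS in \<open>auto simp: o_inv_cancel intro!: permutes_compose permutes_inv\<close>)
    finally show "conv S ?Y Z (g \<circ> p) = conv S ?Y Z g" .
  qed
  also have "conv S ?Y Z id = (\<Sum>\<sigma> | \<sigma> permutes S. ?Y \<sigma> * Z \<sigma>)"
    unfolding conv_def using Zc(2)[OF _ permutes_id] by (intro sum.cong) auto
  also have "\<dots> = (\<Sum>q | q permutes insert j A. \<Sum>p | p permutes insert j B.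
      \<Sum>\<sigma> | \<sigma> permutes S. if \<sigma> = q \<circ> p then of_int (sign q) * Z \<sigma> else 0)"
  proof -
    have "(\<Sum>\<sigma> | \<sigma> permutes S. ?Y \<sigma> * Z \<sigma>) =
      (\<Sum>\<sigma> | \<sigma> permutes S. \<Sum>q | q permutes insert j A. \<Sum>p | p permutes insert j B.
        if \<sigma> = q \<circ> p then of_int (sign q) * Z \<sigma> else 0)"
      unfolding hook_elem_def sum_distrib_right if_distribR mult_zero_left
      by (intro sum.cong refl) auto
    also have "\<dots> = (\<Sum>q | q permutes insert j A. \<Sum>\<sigma> | \<sigma> permutes S. \<Sum>p | p permutes insert j B.
        if \<sigma> = q \<circ> p then of_int (sign q) * Z \<sigma> else 0)"
      by (rule sum.swap)
    also have "\<dots> = (\<Sum>q | q permutes insert j A. \<Sum>p | p permutes insert j B.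
        \<Sum>\<sigma> | \<sigma> permutes S. if \<sigma> = q \<circ> p then of_int (sign q) * Z \<sigma> else 0)"
      by (intro sum.cong refl sum.swap)
    finally show ?thesis .
  qed
  also have "\<dots> = (\<Sum>q | q permutes insert j A. \<Sum>p | p permutes insert j B. of_int (sign q) * Z (q \<circ> p))"
    using hook_sub fin by (intro sum.cong refl) (auto simp: finite_permutations sum.delta permutes_compose)
  finally show ?thesis .
qed

end

section \<open>Convolution with the long cycles\<close>

text \<open>Number the cycle as \<open>p 0 = j, p 1, \<dots>, p (n - 1)\<close>. A set that loses
  elements only into \<open>j\<close> is closed under passing to the successor, so it is the image
  of a final segment \<open>{m..<n}\<close> with \<open>1 \<le> m \<le> n\<close>;
  \<open>m = n\<close> gives the empty set.\<close>

lemma card_cyclic_arcs: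
  assumes "finite S" "\<pi> permutes S" and orb: "orbit \<pi> j = S"
  shows "card {A. A \<subseteq> S - {j} \<and> \<pi> ` A \<subseteq> insert j A} = card S"
proof -
  define n where "n = card S"
  define p where "p k = (\<pi> ^^ k) j" for k
  have "permutation \<pi>" using assms permutes_imp_permutation by blast
  then have jj: "j \<in> orbit \<pi> j" by (rule permutation_self_in_orbit)
  define d where "d = funpow_dist1 \<pi> j j"
  have im: "S = p ` {0..<d}" and inj: "inj_on p {0..<d}"
    using orbit_conv_funpow_dist1[OF jj] inj_on_funpow_dist1[OF jj] orb unfolding p_def d_def by auto
  have "d = n" unfolding n_def im using inj by (simp add: card_image)
  then have im: "S = p ` {0..<n}" and inj: "inj_on p {0..<n}" using im inj by auto
  have p0: "p 0 = j" by (simp add: p_def)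
  have pn: "p n = j" using funpow_dist1_prop[OF jj] \<open>d = n\<close> unfolding p_def d_def by simp
  have pS: "\<pi> (p k) = p (Suc k)" for k by (simp add: p_def)
  have n0: "n > 0" using jj orb assms(1) unfolding n_def by (auto simp: card_gt_0_iff)
  have pj: "p k \<noteq> j" if "1 \<le> k" "k < n" for k
    using inj_onD[OF inj, of k 0] that p0 by auto
  have "{A. A \<subseteq> S - {j} \<and> \<pi> ` A \<subseteq> insert j A} = (\<lambda>m. p ` {m..<n}) ` {1..n}"
  proof (intro equalityI subsetI)
    fix A assume "A \<in> {A. A \<subseteq> S - {j} \<and> \<pi> ` A \<subseteq> insert j A}"
    then have A: "A \<subseteq> S - {j}" "\<And>a. a \<in> A \<Longrightarrow> \<pi> a \<in> insert j A" by auto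
    define I where "I = {k \<in> {1..<n}. p k \<in> A}"
    have AI: "A = p ` I"
    proof (intro equalityI subsetI)
      fix a assume a: "a \<in> A"
      then have "a \<in> p ` {0..<n}" using A(1) im by blast
      then obtain k where k: "k < n" "a = p k" by auto
      moreover have "k \<noteq> 0" using a A(1) k p0 by (intro notI) auto
      ultimately show "a \<in> p ` I" using a by (auto simp: I_def)
    qed (auto simp: I_def)
    have step: "Suc k \<in> I" if "k \<in> I" "Suc k < n" for k
      using that A(2)[of "p k"] pS[of k] pj[of "Suc k"] by (auto simp: I_def)
    have up: "l \<in> I" if "k \<in> I" "k \<le> l" "l < n" for k l
      using that(2,3)
    proof (induction l rule: dec_induct)
      case base
      then show ?case using that(1) by simp
    next
      case (step l)
      then show ?case using \<open>\<And>k. k \<in> I \<Longrightarrow> Suc k < n \<Longrightarrow> Suc k \<in> I\<close> by simp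
    qed
    have "\<exists>m\<in>{1..n}. I = {m..<n}"
    proof (cases "I = {}")
      case True
      then show ?thesis using n0 by (intro bexI[of _ n]) auto
    next
      case False
      have fI: "finite I" by (simp add: I_def)
      have m: "Min I \<in> I" using False fI by (rule Min_in[rotated])
      have "I = {Min I..<n}"
      proof (intro equalityI subsetI)
        fix k assume k: "k \<in> I"
        then have "k < n" by (simp add: I_def)
        with Min_le[OF fI k] show "k \<in> {Min I..<n}" by simp
      next
        fix k assume "k \<in> {Min I..<n}"
        then show "k \<in> I" using up[OF m, of k] by simp
      qed
      moreover have "I \<subseteq> {1..n}" by (auto simp: I_def)
      then have "Min I \<in> {1..n}" using m by (rule subsetD)
      ultimately show ?thesis by blast
    qed
    then show "A \<in> (\<lambda>m. p ` {m..<n}) ` {1..n}" using AI by auto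
  next
    fix A assume "A \<in> (\<lambda>m. p ` {m..<n}) ` {1..n}"
    then obtain m where m: "1 \<le> m" "m \<le> n" "A = p ` {m..<n}" by auto
    have "A \<subseteq> S - {j}"
    proof
      fix a assume "a \<in> A"
      then obtain k where k: "m \<le> k" "k < n" "a = p k" using m(3) by auto
      then have "p k \<noteq> j" "p k \<in> S" using pj[of k] m(1) im by auto
      then show "a \<in> S - {j}" using k(3) by simp
    qed
    moreover have "\<pi> ` A \<subseteq> insert j A"
    proof (rule image_subsetI)
      fix a assume "a \<in> A"
      then obtain k where k: "m \<le> k" "k < n" "a = p k" using m(3) by auto
      then show "\<pi> a \<in> insert j A" using pS[of k] pn m(3) by (cases "Suc k = n") auto
    qed
    ultimately show "A \<in> {A. A \<subseteq> S - {j} \<and> \<pi> ` A \<subseteq> insert j A}" by simp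
  qed
  moreover have "inj_on (\<lambda>m. p ` {m..<n}) {1..n}"
  proof (rule inj_onI)
    fix m m' assume m: "m \<in> {1..n}" "m' \<in> {1..n}" "p ` {m..<n} = p ` {m'..<n}"
    have "card (p ` {k..<n}) = n - k" for k
      using inj by (subst card_image) (auto intro: inj_on_subset)
    then have "n - m = n - m'" using m(3) by metis
    then show "m = m'" using m by auto
  qed
  ultimately show ?thesis by (simp add: card_image n_def)
qed

lemma cyc_1_orbit:
  assumes "finite S" "\<pi> permutes S" "j \<in> S" and "cyc \<pi> S = 1"
  shows "orbit \<pi> j = S"
proof -
  obtain X where X: "orbit \<pi> ` S = {X}" using assms(4) unfolding cyc_def by (auto simp: card_1_singleton_iff)
  have "permutation \<pi>" using assms permutes_imp_permutation by blast
  have "S \<subseteq> orbit \<pi> j"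
  proof
    fix x assume "x \<in> S"
    then have "orbit \<pi> x = orbit \<pi> j" using X assms(3) by (metis image_eqI singletonD)
    then show "x \<in> orbit \<pi> j" using permutation_self_in_orbit[OF \<open>permutation \<pi>\<close>, of x] by simp
  qed
  then show ?thesis using permutes_orbit_subset[OF assms(2,3)] by simp
qed

text \<open>
  Only sets \<open>A\<close> with \<open>\<pi> ` A \<subseteq> insert j A\<close> contribute to the sum in \<open>hook_elem_sum\<close>. If some cycle of
  \<open>\<pi>\<close> avoids \<open>j\<close>, then adding it to or removing it from \<open>A\<close> is a sign-reversing involution on these
  sets. If \<open>\<pi>\<close> is an \<open>n\<close>-cycle, then they are the \<open>n\<close> arcs that end just before \<open>j\<close>.
\<close>

lemma hook_elem_toggle:
  assumes fin: "finite B" and j: "j \<notin> B" and \<pi>: "\<pi> permutes insert j B"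
    and z: "z \<in> B" "j \<notin> orbit \<pi> z"
    and A: "A \<subseteq> B" "\<pi> ` A \<subseteq> insert j A" "A \<inter> orbit \<pi> z = {}"
  shows "(-1) ^ card (A \<union> orbit \<pi> z) * hook_elem j (A \<union> orbit \<pi> z) (B - (A \<union> orbit \<pi> z)) \<pi> =
    - ((-1) ^ card A * (hook_elem j A (B - A) \<pi> :: 'b::comm_ring_1))"
proof -
  define Q where "Q = orbit \<pi> z"
  have perm: "permutation \<pi>" using \<pi> fin permutes_imp_permutation by (metis finite_insert)
  have zQ: "z \<in> Q" unfolding Q_def using perm by (rule permutation_self_in_orbit)
  have QB: "Q \<subseteq> B" using permutes_orbit_subset[OF \<pi>, of z] z unfolding Q_def by auto
  have finQ: "finite Q" using QB fin finite_subset by blast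
  have cQ: "cyclic_on \<pi> Q" unfolding Q_def using perm by (rule cyclic_on_orbit')
  have piQ: "\<pi> x \<in> Q" if "x \<in> Q" for x using cyclic_on_inI[OF cQ that] .
  define r where "r = perm_restrict \<pi> Q"
  have r: "r permutes Q"
  proof (rule bij_imp_permutes)
    have "inj_on r Q" using permutes_inj[OF \<pi>] by (auto simp: r_def perm_restrict_def inj_on_def)
    moreover have "r ` Q \<subseteq> Q" using piQ by (auto simp: r_def perm_restrict_def)
    ultimately show "bij_betw r Q Q" using finQ by (simp add: bij_betw_def endo_inj_surj)
  qed (simp add: r_def perm_restrict_def)
  have "cyclic_on r Q" unfolding r_def cyclic_on_perm_restrict by (rule cQ)
  then have "orbit r ` Q = {Q}" using orbit_cyclic_eq3[of r Q] zQ by auto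
  then have "cyc r Q = 1" by (simp add: cyc_def)
  then have sr: "sign r = (-1) ^ Suc (card Q)" using sign_cyc[OF finQ r] by simp
  have S: "insert j B = insert j (A \<union> (B - A))" using A by auto
  have finS: "finite (insert j B)" using fin by simp
  obtain q p where qp: "q permutes insert j A" "p permutes insert j (B - A)" "\<pi> = q \<circ> p"
    by (rule hook_factor[OF finS S _ _ _ \<pi> A(2)]) (use j A in auto)
  have qS: "q permutes insert j B"
    using qp(1) A by (auto elim!: permutes_subset)
  have rS: "r permutes insert j B" using r QB by (auto elim!: permutes_subset)
  \<comment> \<open>The cycle \<open>r\<close> is moved from the row factor to the column factor.
    This multiplies the sign by \<open>(-1) ^ (card Q + 1)\<close> and the power of
    \<open>-1\<close> in front by \<open>(-1) ^ card Q\<close>.\<close>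
  define q' p' where "q' = q \<circ> r" and "p' = inv r \<circ> p"
  have q': "q' permutes insert j (A \<union> Q)"
    unfolding q'_def using permutes_subset[OF qp(1), of "insert j (A \<union> Q)"] permutes_subset[OF r, of "insert j (A \<union> Q)"]
    by (auto intro: permutes_compose)
  have p': "p' permutes insert j (B - (A \<union> Q))"
  proof (rule permutes_superset)
    show "p' permutes insert j (B - A)"
      unfolding p'_def
      using permutes_inv[OF permutes_subset[OF r, of "insert j (B - A)"]] qp(2) QB A(3)
      by (intro permutes_compose) (auto simp: Q_def)
    fix x assume x: "x \<in> insert j (B - A) - insert j (B - (A \<union> Q))"
    then have xQ: "x \<in> Q" by auto
    have "q (\<pi> x) = \<pi> x"
      using piQ[OF xQ] A(3) QB j permutes_not_in[OF qp(1), of "\<pi> x"] by (auto simp: Q_def)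
    moreover have "q (p x) = \<pi> x" using qp(3) by simp
    ultimately have "p x = \<pi> x" using permutes_inj[OF qp(1)] by (metis injD)
    also have "\<dots> = r x" using xQ by (simp add: r_def perm_restrict_def)
    finally show "p' x = x" unfolding p'_def using permutes_inverses(2)[OF r] by simp
  qed
  have eq: "\<pi> = q' \<circ> p'" unfolding q'_def p'_def qp(3)
    using o_inv_cancel(1)[OF r, of p] by (simp add: comp_assoc)
  have "(hook_elem j (A \<union> Q) (B - (A \<union> Q)) (q' \<circ> p') :: 'b) = of_int (sign q')"
    by (rule hook_elem_comp[OF finS _ _ _ _ q' p']) (use A QB j in auto)
  moreover have "(hook_elem j A (B - A) (q \<circ> p) :: 'b) = of_int (sign q)"
    by (rule hook_elem_comp[OF finS _ _ _ _ qp(1,2)]) (use A j in auto)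
  moreover have "sign q' = sign q * sign r"
    unfolding q'_def using qS rS finS by (intro sign_compose) (auto intro: permutes_imp_permutation)
  moreover have "card (A \<union> Q) = card A + card Q"
    using A fin finQ finite_subset by (intro card_Un_disjoint) (auto simp: Q_def)
  ultimately show ?thesis
    unfolding Q_def[symmetric] using eq qp(3) sr
    by (cases "even (card Q)") (simp_all add: power_add)
qed

lemma hook_elem_sum:
  assumes fin: "finite B" and j: "j \<notin> B" and \<pi>: "\<pi> permutes insert j B"
  shows "(\<Sum>A\<in>Pow B. (-1) ^ card A * hook_elem j A (B - A) \<pi>) =
    (of_nat (card (insert j B)) * of_bool (cyc \<pi> (insert j B) = 1) :: 'b::comm_ring_1)"
proof -
  let ?f = "\<lambda>A. (-1) ^ card A * hook_elem j A (B - A) \<pi> :: 'b"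
  let ?S = "insert j B"
  define V where "V = {A. A \<subseteq> B \<and> \<pi> ` A \<subseteq> insert j A}"
  have finS: "finite ?S" using fin by simp
  have finV: "finite V" unfolding V_def using fin by simp
  have perm: "permutation \<pi>" using \<pi> finS permutes_imp_permutation by blast
  have "sum ?f (Pow B) = sum ?f V"
  proof (rule sum.mono_neutral_right)
    show "\<forall>A\<in>Pow B - V. ?f A = 0"
    proof
      fix A assume A: "A \<in> Pow B - V"
      have "hook_elem j A (B - A) \<pi> = (0 :: 'b)"
        by (rule hook_elem_eq_0[OF finS]) (use A j in \<open>auto simp: V_def\<close>)
      then show "?f A = 0" by simp
    qed
  qed (use fin in \<open>auto simp: V_def\<close>)
  also have "\<dots> = of_nat (card ?S) * of_bool (cyc \<pi> ?S = 1)"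
  proof (cases "cyc \<pi> ?S = 1")
    case True
    \<comment> \<open>By \<open>cyc_join\<close> both factors of an n-cycle are single cycles on
      their supports; the sign of \<open>q\<close> is then \<open>(-1) ^ card A\<close> and cancels
      the factor in front.\<close>
    have "?f A = 1" if "A \<in> V" for A
    proof -
      have A: "A \<subseteq> B" "\<pi> ` A \<subseteq> insert j A" using that by (auto simp: V_def)
      then have finA: "finite A" using fin finite_subset by blast
      have S: "insert j B = insert j (A \<union> (B - A))" using A by auto
      obtain q p where qp: "q permutes insert j A" "p permutes insert j (B - A)" "\<pi> = q \<circ> p"
        by (rule hook_factor[OF finS S _ _ _ \<pi> A(2)]) (use j A in auto)
      have "Suc (cyc (q \<circ> p) (insert j (A \<union> (B - A)))) = cyc q (insert j A) + cyc p (insert j (B - A))"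
        by (rule cyc_join[OF _ _ _ _ _ qp(1,2)]) (use finA fin j A in auto)
      then have "cyc q (insert j A) + cyc p (insert j (B - A)) = 2"
        using True S qp(3) by simp
      moreover have "cyc q (insert j A) \<noteq> 0" "cyc p (insert j (B - A)) \<noteq> 0"
        using finA fin by (simp_all add: cyc_def)
      ultimately have "cyc q (insert j A) = 1" by linarith
      moreover have "j \<notin> A" using j A by blast
      ultimately have "sign q = (-1) ^ card A"
        using sign_cyc[OF _ qp(1)] finA by simp
      moreover have "hook_elem j A (B - A) (q \<circ> p) = (of_int (sign q) :: 'b)"
        by (rule hook_elem_comp[OF finS S _ _ _ qp(1,2)]) (use j A in auto)
      ultimately show ?thesis using qp(3) by (simp flip: power_mult_distrib)
    qed
    then have 1: "sum ?f V = of_nat (card V)" by simp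
    have "V = {A. A \<subseteq> ?S - {j} \<and> \<pi> ` A \<subseteq> insert j A}" unfolding V_def using j by auto
    also have "card \<dots> = card ?S"
      by (rule card_cyclic_arcs[OF finS \<pi> cyc_1_orbit[OF finS \<pi> _ True]]) simp
    finally show ?thesis using True 1 by simp
  next
    case False
    have "\<exists>z\<in>B. j \<notin> orbit \<pi> z"
    proof (rule ccontr)
      assume "\<not> ?thesis"
      then have *: "orbit \<pi> z = orbit \<pi> j" if "z \<in> ?S" for z
        using that orbit_eq_of_mem[OF perm, of j z] by auto
      have "orbit \<pi> ` ?S = (\<lambda>_. orbit \<pi> j) ` ?S" by (intro image_cong refl *)
      also have "\<dots> = {orbit \<pi> j}" by auto
      finally have "cyc \<pi> ?S = 1" unfolding cyc_def by (simp only: card.insert card.empty finite.emptyI) simp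
      then show False using False by contradiction
    qed
    then obtain z where z: "z \<in> B" "j \<notin> orbit \<pi> z" by blast
    define Q where "Q = orbit \<pi> z"
    have QB: "Q \<subseteq> B" using permutes_orbit_subset[OF \<pi>, of z] z unfolding Q_def by auto
    have zQ: "z \<in> Q" unfolding Q_def using perm by (rule permutation_self_in_orbit)
    have piQ: "\<pi> x \<in> Q" if "x \<in> Q" for x using that unfolding Q_def by (rule orbit.step)
    have piQ': "x \<in> Q" if "\<pi> x \<in> Q" for x
      using cyclic_on_f_in[OF \<pi> cyclic_on_orbit'[OF perm]] that unfolding Q_def .
    define V0 V1 where "V0 = {A \<in> V. A \<inter> Q = {}}" and "V1 = {A \<in> V. Q \<subseteq> A}"
    \<comment> \<open>\<open>A\<close> is closed under \<open>\<pi>\<close> up to \<open>j\<close>,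
      and the cycle \<open>Q\<close> avoids \<open>j\<close>, so a set \<open>A\<close> that meets
      \<open>Q\<close> contains it.\<close>
    have "V = V0 \<union> V1"
    proof -
      have "Q \<subseteq> A" if A: "A \<in> V" and x: "x \<in> A" "x \<in> Q" for A x
      proof
        fix y assume "y \<in> Q"
        moreover have "Q = orbit \<pi> x" using orbit_eq_of_mem[OF perm] x unfolding Q_def by metis
        ultimately have "y \<in> orbit \<pi> x" by simp
        moreover have *: "\<pi> y \<in> A" if "y \<in> A" "y \<in> Q" for y
          using A that piQ[of y] z(2) unfolding V_def Q_def by auto
        ultimately have "y \<in> A \<and> y \<in> Q"
        proof induction
          case base
          show ?case using *[OF x] piQ[OF x(2)] by simp
        next
          case (step y)
          then show ?case using *[of y] piQ[of y] by simp
        qed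
        then show "y \<in> A" by simp
      qed
      then show ?thesis unfolding V0_def V1_def by auto
    qed
    moreover have "V0 \<inter> V1 = {}" using zQ by (auto simp: V0_def V1_def)
    ultimately have "sum ?f V = sum ?f V0 + sum ?f V1"
      using finV by (simp add: sum.union_disjoint)
    also have "sum ?f V1 = (\<Sum>A\<in>V0. ?f (A \<union> Q))"
    proof (rule sum.reindex_bij_witness[where i = "\<lambda>A. A \<union> Q" and j = "\<lambda>A. A - Q"])
      fix A assume "A \<in> V1"
      then have A: "A \<subseteq> B" "\<pi> ` A \<subseteq> insert j A" "Q \<subseteq> A" by (auto simp: V1_def V_def)
      then show "A - Q \<union> Q = A" by auto
      then show "?f (A - Q \<union> Q) = ?f A" by simp
      have "\<pi> ` (A - Q) \<subseteq> insert j (A - Q)" using A(2) piQ' by blast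
      then show "A - Q \<in> V0" using A by (auto simp: V0_def V_def)
    next
      fix A assume "A \<in> V0"
      then have A: "A \<subseteq> B" "\<pi> ` A \<subseteq> insert j A" "A \<inter> Q = {}" by (auto simp: V0_def V_def)
      then show "A \<union> Q - Q = A" by auto
      have "\<pi> ` (A \<union> Q) \<subseteq> insert j (A \<union> Q)" using A(2) piQ by blast
      then show "A \<union> Q \<in> V1" using A QB by (auto simp: V1_def V_def)
    qed
    also have "\<dots> = (\<Sum>A\<in>V0. - ?f A)"
    proof (rule sum.cong[OF refl])
      fix A assume "A \<in> V0"
      then have A: "A \<subseteq> B" "\<pi> ` A \<subseteq> insert j A" "A \<inter> orbit \<pi> z = {}" by (auto simp: V0_def V_def Q_def)
      show "?f (A \<union> Q) = - ?f A" unfolding Q_def by (rule hook_elem_toggle[OF fin j \<pi> z A])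
    qed
    finally show ?thesis using False by (simp add: sum_negf)
  qed
  finally show ?thesis .
qed

text \<open>The sign replaces \<open>x\<close> by \<open>-x\<close> in the rising factorial, which
  makes it the falling factorial \<open>x (x - 1) \<dots> (x - card A)\<close>.\<close>

lemma column_sum:
  assumes "finite A" "j \<notin> A"
  shows "(\<Sum>q | q permutes insert j A. of_int (sign q) * x ^ cyc q (insert j A)) =
    (pochhammer (x - of_nat (card A)) (Suc (card A)) :: 'b::comm_ring_1)"
proof -
  have "(\<Sum>q | q permutes insert j A. of_int (sign q) * x ^ cyc q (insert j A)) =
     (\<Sum>q | q permutes insert j A. (-1) ^ Suc (card A) * (- x) ^ cyc q (insert j A))"
  proof (rule sum.cong[OF refl])
    fix q assume "q \<in> {q. q permutes insert j A}"
    then have "sign q = (-1) ^ (Suc (card A) + cyc q (insert j A))"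
      using sign_cyc[of "insert j A" q] assms by simp
    then show "of_int (sign q) * x ^ cyc q (insert j A) = (-1) ^ Suc (card A) * (- x) ^ cyc q (insert j A)"
      by (simp add: power_add power_minus[of x] mult.assoc)
  qed
  also have "\<dots> = (-1) ^ Suc (card A) * pochhammer (- x) (Suc (card A))"
    unfolding sum_distrib_left[symmetric] using sum_power_cyc[of "insert j A" "- x"] assms by simp
  also have "\<dots> = pochhammer (x - of_nat (Suc (card A)) + 1) (Suc (card A))"
    by (rule pochhammer_minus'[symmetric])
  finally show ?thesis by (simp add: algebra_simps)
qed

text \<open>By \<open>cyc_join\<close> the double sum splits into a column sum and a row sum, with
  one factor \<open>x\<close> too many because the cycle through \<open>j\<close> is counted twice;
  \<open>x \<ge> 1\<close> permits its cancellation. What remains is the product of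
  \<open>x + c\<close> over the contents \<open>c\<close> of the hook, from \<open>- card A\<close>
  to \<open>card B\<close>.\<close>

lemma hook_eigenvalue:
  fixes x :: nat
  assumes fin: "finite A" "finite B" and disj: "A \<inter> B = {}" "j \<notin> A" "j \<notin> B" and x: "x \<ge> 1"
  shows "(\<Sum>q | q permutes insert j A. \<Sum>p | p permutes insert j B.
      of_int (sign q) * of_nat x ^ cyc (q \<circ> p) (insert j (A \<union> B))) =
    (fact (card A + card B + 1) * of_nat ((x + card B) choose (card A + card B + 1)) :: 'b::field_char_0)"
proof -
  let ?a = "card A" and ?b = "card B"
  let ?x = "of_nat x :: 'b"
  have "?x * (\<Sum>q | q permutes insert j A. \<Sum>p | p permutes insert j B.
      of_int (sign q) * ?x ^ cyc (q \<circ> p) (insert j (A \<union> B))) =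
    (\<Sum>q | q permutes insert j A. \<Sum>p | p permutes insert j B.
      (of_int (sign q) * ?x ^ cyc q (insert j A)) * ?x ^ cyc p (insert j B))"
    unfolding sum_distrib_left
  proof (intro sum.cong[OF refl])
    fix q p assume "q \<in> {q. q permutes insert j A}" "p \<in> {p. p permutes insert j B}"
    then have "Suc (cyc (q \<circ> p) (insert j (A \<union> B))) = cyc q (insert j A) + cyc p (insert j B)"
      by (intro cyc_join fin disj) auto
    then have "?x * ?x ^ cyc (q \<circ> p) (insert j (A \<union> B)) = ?x ^ cyc q (insert j A) * ?x ^ cyc p (insert j B)"
      by (metis power_Suc power_add)
    then show "?x * (of_int (sign q) * ?x ^ cyc (q \<circ> p) (insert j (A \<union> B))) =
      of_int (sign q) * ?x ^ cyc q (insert j A) * ?x ^ cyc p (insert j B)"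
      by (simp add: mult.left_commute mult.assoc)
  qed
  also have "\<dots> = pochhammer (?x - of_nat ?a) (Suc ?a) * pochhammer ?x (Suc ?b)"
    unfolding sum_product[symmetric]
    using column_sum[OF fin(1) disj(2), of ?x] sum_power_cyc[of "insert j B" ?x] fin disj by simp
  also have "\<dots> = ?x * (pochhammer (?x - of_nat ?a) ?a * pochhammer ?x (Suc ?b))"
    by (simp add: pochhammer_Suc)
  also have "pochhammer (?x - of_nat ?a) ?a * pochhammer ?x (Suc ?b) = pochhammer (?x - of_nat ?a) (?a + ?b + 1)"
    using pochhammer_product'[of "?x - of_nat ?a" ?a "Suc ?b"] by simp
  also have "\<dots> = fact (?a + ?b + 1) * (of_nat (x + ?b) gchoose (?a + ?b + 1))"
  proof -
    have "of_nat (x + ?b) - of_nat (?a + ?b + 1) + 1 = ?x - of_nat ?a" by (simp add: algebra_simps)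
    then show ?thesis unfolding gbinomial_pochhammer' by (simp del: fact_Suc)
  qed
  also have "\<dots> = fact (?a + ?b + 1) * of_nat ((x + ?b) choose (?a + ?b + 1))"
    by (simp only: binomial_gbinomial)
  finally have eq: "?x * (\<Sum>q | q permutes insert j A. \<Sum>p | p permutes insert j B.
      of_int (sign q) * ?x ^ cyc (q \<circ> p) (insert j (A \<union> B))) =
    ?x * (fact (?a + ?b + 1) * of_nat ((x + ?b) choose (?a + ?b + 1)))" .
  have "?x \<noteq> 0" using x by simp
  from mult_left_cancel[THEN iffD1, OF this eq] show ?thesis .
qed

text \<open>\<open>q \<circ> p\<close> is an n-cycle exactly if both factors are single cycles. With
  \<open>a = card A\<close> and \<open>n = card A + card B + 1\<close>, the scalar is the number
  \<open>fact (n - 1)\<close> of n-cycles times the hook character \<open>(-1) ^ a\<close> over its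
  degree \<open>(n - 1) choose a\<close>.\<close>

lemma hook_eigenvalue_cycle:
  assumes fin: "finite A" "finite B" and disj: "A \<inter> B = {}" "j \<notin> A" "j \<notin> B"
  shows "(\<Sum>q | q permutes insert j A. \<Sum>p | p permutes insert j B.
      of_int (sign q) * of_bool (cyc (q \<circ> p) (insert j (A \<union> B)) = 1)) =
    ((-1) ^ card A * fact (card A) * fact (card B) :: 'b::field_char_0)"
proof -
  have "(\<Sum>q | q permutes insert j A. \<Sum>p | p permutes insert j B.
      of_int (sign q) * of_bool (cyc (q \<circ> p) (insert j (A \<union> B)) = 1)) =
    (\<Sum>q | q permutes insert j A. \<Sum>p | p permutes insert j B.
      ((-1) ^ card A * of_bool (cyc q (insert j A) = 1)) * (of_bool (cyc p (insert j B) = 1) :: 'b))"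
  proof (intro sum.cong[OF refl])
    fix q p assume "q \<in> {q. q permutes insert j A}" "p \<in> {p. p permutes insert j B}"
    then have qp: "q permutes insert j A" "p permutes insert j B" by auto
    have "Suc (cyc (q \<circ> p) (insert j (A \<union> B))) = cyc q (insert j A) + cyc p (insert j B)"
      by (intro cyc_join fin disj qp)
    moreover have "cyc q (insert j A) \<noteq> 0" "cyc p (insert j B) \<noteq> 0"
      using fin by (simp_all add: cyc_def)
    ultimately have "cyc (q \<circ> p) (insert j (A \<union> B)) = 1 \<longleftrightarrow> cyc q (insert j A) = 1 \<and> cyc p (insert j B) = 1"
      by linarith
    moreover have "sign q = (-1) ^ card A" if "cyc q (insert j A) = 1"
      using sign_cyc[OF _ qp(1)] fin disj that by simp
    ultimately show "of_int (sign q) * of_bool (cyc (q \<circ> p) (insert j (A \<union> B)) = 1) =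
      (-1) ^ card A * of_bool (cyc q (insert j A) = 1) * (of_bool (cyc p (insert j B) = 1) :: 'b)"
      by auto
  qed
  also have "\<dots> = (-1) ^ card A * (\<Sum>q | q permutes insert j A. of_bool (cyc q (insert j A) = 1)) *
      (\<Sum>p | p permutes insert j B. of_bool (cyc p (insert j B) = 1))"
    unfolding sum_product[symmetric] by (simp add: sum_distrib_left)
  also have "(\<Sum>q | q permutes insert j A. of_bool (cyc q (insert j A) = 1)) = (fact (card A) :: 'b)"
    using card_cyc_1[OF fin(1) disj(2)] fin by (simp add: finite_permutations Int_def)
  also have "(\<Sum>p | p permutes insert j B. of_bool (cyc p (insert j B) = 1)) = (fact (card B) :: 'b)"
    using card_cyc_1[OF fin(2) disj(3)] fin by (simp add: finite_permutations Int_def)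
  finally show ?thesis .
qed

lemma conv_cong_left:
  assumes "\<And>\<sigma>. \<sigma> permutes S \<Longrightarrow> F \<sigma> = F' \<sigma>"
  shows "conv S F G = conv S F' G"
  unfolding conv_def using assms by (intro ext sum.cong) auto

lemma conv_scale_left: "conv S (\<lambda>\<sigma>. c * F \<sigma>) G = (\<lambda>\<pi>. c * conv S F G \<pi>)"
  unfolding conv_def by (simp add: sum_distrib_left mult.assoc)

lemma conv_sum_left: "conv S (\<lambda>\<sigma>. \<Sum>a\<in>I. F a \<sigma>) G \<pi> = (\<Sum>a\<in>I. conv S (F a) G \<pi>)"
  unfolding conv_def by (subst sum.swap) (simp add: sum_distrib_right)

lemma conv_class_fun_inv:
  assumes "class_fun S F" "class_fun S G" and \<pi>: "\<pi> permutes S"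
  shows "conv S F G (inv \<pi>) = conv S F G \<pi>"
proof -
  have Fi: "F (inv \<sigma>) = F \<sigma>" and Gi: "G (inv \<sigma>) = G \<sigma>" if "\<sigma> permutes S" for \<sigma>
    using assms that unfolding class_fun_def by auto
  have Gc: "G (\<sigma> \<circ> \<rho>) = G (\<rho> \<circ> \<sigma>)" if "\<sigma> permutes S" "\<rho> permutes S" for \<sigma> \<rho>
    using assms that unfolding class_fun_def by auto
  have "conv S F G (inv \<pi>) = (\<Sum>\<sigma> | \<sigma> permutes S. F (inv \<sigma>) * G (inv (inv \<sigma>) \<circ> inv \<pi>))"
    unfolding conv_def by (rule sum_permutations_inverse)
  also have "\<dots> = conv S F G \<pi>"
    unfolding conv_def
  proof (rule sum.cong[OF refl])
    fix \<sigma> assume "\<sigma> \<in> {\<sigma>. \<sigma> permutes S}"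
    then have \<sigma>: "\<sigma> permutes S" by simp
    have "inv (inv \<sigma>) \<circ> inv \<pi> = inv (\<pi> \<circ> inv \<sigma>)"
      using inv_o_permutes[OF \<pi> permutes_inv[OF \<sigma>]] by simp
    then have "G (inv (inv \<sigma>) \<circ> inv \<pi>) = G (\<pi> \<circ> inv \<sigma>)"
      using Gi[OF permutes_compose[OF permutes_inv[OF \<sigma>] \<pi>]] by (simp only:)
    also have "\<dots> = G (inv \<sigma> \<circ> \<pi>)" by (rule Gc[OF \<pi> permutes_inv[OF \<sigma>]])
    finally show "F (inv \<sigma>) * G (inv (inv \<sigma>) \<circ> inv \<pi>) = F \<sigma> * G (inv \<sigma> \<circ> \<pi>)"
      using Fi[OF \<sigma>] by (simp only:)
  qed
  finally show ?thesis .
qed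

text \<open>Only one of the two sums of n-cycles is expanded into hook symmetrizers; the other acts
  on each of them by a scalar whose sign cancels that of the expansion. Each symmetrizer has
  coefficient 1 at \<open>id\<close>, and the \<open>(n - 1) choose t\<close> hooks with a given
  \<open>t\<close> turn the factorials of that scalar into \<open>fact (n - 1)\<close>.\<close>

theorem cycle_conv_inner:
  fixes x y :: nat
  assumes fin: "finite B" and j: "j \<notin> B" and x: "x \<ge> 1" and y: "y \<ge> 1"
  defines "S \<equiv> insert j B" and "n \<equiv> Suc (card B)"
  shows "(\<Sum>\<pi> | \<pi> permutes S.
      conv S (\<lambda>\<sigma>. of_bool (cyc \<sigma> S = 1)) (\<lambda>\<sigma>. of_nat x ^ cyc \<sigma> S) \<pi> *
      conv S (\<lambda>\<sigma>. of_bool (cyc \<sigma> S = 1)) (\<lambda>\<sigma>. of_nat y ^ cyc \<sigma> S) \<pi>) =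
    ((fact (n - 1))\<^sup>2 * fact n *
      (\<Sum>t<n. of_nat ((x + n - 1 - t) choose n) * of_nat ((y + n - 1 - t) choose n)) :: 'b::field_char_0)"
proof -
  have finS: "finite S" and cS: "card S = n" using fin j by (simp_all add: S_def n_def)
  define \<kappa> :: "('a \<Rightarrow> 'a) \<Rightarrow> 'b" where "\<kappa> = (\<lambda>\<sigma>. of_bool (cyc \<sigma> S = 1))"
  define Z :: "nat \<Rightarrow> ('a \<Rightarrow> 'a) \<Rightarrow> 'b" where "Z x = (\<lambda>\<sigma>. of_nat x ^ cyc \<sigma> S)" for x
  have cl: "class_fun S \<kappa>" "class_fun S (Z x)" for x
    unfolding \<kappa>_def Z_def
    using class_fun_cyc[OF finS, of "\<lambda>c. of_bool (c = 1)"] class_fun_cyc[OF finS, of "\<lambda>c. of_nat x ^ c"] by simp_all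
  define P :: "nat \<Rightarrow> nat \<Rightarrow> 'b" where "P t x = of_nat ((x + n - 1 - t) choose n)" for t x
  let ?Y = "\<lambda>A. hook_elem j A (B - A) :: ('a \<Rightarrow> 'a) \<Rightarrow> 'b"
  let ?W = "\<lambda>F. conv S (conv S F (Z x)) (conv S \<kappa> (Z y)) id"
  \<comment> \<open>At \<open>id\<close> the convolution pairs \<open>\<pi>\<close> with
    \<open>inv \<pi>\<close>, and a convolution of class functions has the same value at
    both.\<close>
  have Q: "(\<Sum>\<pi> | \<pi> permutes S. conv S \<kappa> (Z x) \<pi> * conv S \<kappa> (Z y) \<pi>) = ?W \<kappa>"
    unfolding conv_def[of S "conv S \<kappa> (Z x)" "conv S \<kappa> (Z y)" id]
    using conv_class_fun_inv[OF cl(1) cl(2)] by (intro sum.cong) simp_all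
  have "of_nat n * ?W \<kappa> = (\<Sum>A\<in>Pow B. (-1) ^ card A * ?W (?Y A))"
  proof -
    have "of_nat n * ?W \<kappa> = ?W (\<lambda>\<sigma>. of_nat n * \<kappa> \<sigma>)" by (simp add: conv_scale_left)
    also have "\<dots> = ?W (\<lambda>\<sigma>. \<Sum>A\<in>Pow B. (-1) ^ card A * ?Y A \<sigma>)"
      using hook_elem_sum[OF fin j, where ?'b = 'b] cS unfolding \<kappa>_def S_def
      by (subst conv_cong_left[where F' = "\<lambda>\<sigma>. \<Sum>A\<in>Pow B. (-1) ^ card A * ?Y A \<sigma>"]) simp_all
    also have "conv S (\<lambda>\<sigma>. \<Sum>A\<in>Pow B. (-1) ^ card A * ?Y A \<sigma>) (Z x) =
        (\<lambda>\<pi>. \<Sum>A\<in>Pow B. (-1) ^ card A * conv S (?Y A) (Z x) \<pi>)"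
      by (intro ext) (simp add: conv_sum_left conv_scale_left)
    also have "conv S (\<lambda>\<pi>. \<Sum>A\<in>Pow B. (-1) ^ card A * conv S (?Y A) (Z x) \<pi>) (conv S \<kappa> (Z y)) id =
        (\<Sum>A\<in>Pow B. (-1) ^ card A * ?W (?Y A))"
      by (simp add: conv_sum_left conv_scale_left)
    finally show ?thesis .
  qed
  also have "\<dots> = (\<Sum>A\<in>Pow B. (\<lambda>t. fact (n - 1 - t) * fact t * (fact n)\<^sup>2 * P t x * P t y) (card A))"
  proof (rule sum.cong[OF refl])
    fix A assume "A \<in> Pow B"
    then have A: "A \<subseteq> B" by simp
    have finA: "finite A" and finBA: "finite (B - A)" using A fin finite_subset by auto
    have le: "card A \<le> card B" using A fin by (rule card_mono[rotated])
    have cBA: "card (B - A) = card B - card A" using A finA by (simp add: card_Diff_subset)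
    have S: "S = insert j (A \<union> (B - A))" using A by (auto simp: S_def)
    have dj: "A \<inter> (B - A) = {}" "j \<notin> A" "j \<notin> B - A" using A j by auto
    define e where "e Z = (\<Sum>q | q permutes insert j A. \<Sum>p | p permutes insert j (B - A). of_int (sign q) * Z (q \<circ> p) :: 'b)" for Z
    have cv: "conv S (?Y A) F \<pi> = e F * ?Y A \<pi>" if "class_fun S F" "\<pi> permutes S" for F \<pi>
      unfolding e_def by (rule conv_hook_elem[OF finS S dj that])
    have eZ: "e (Z x) = fact n * P (card A) x" if "x \<ge> 1" for x
      using hook_eigenvalue[OF finA finBA dj that, where ?'b = 'b] S cBA le
      unfolding e_def Z_def P_def n_def by (simp add: add.commute)
    have ek: "e \<kappa> = (-1) ^ card A * fact (card A) * fact (n - 1 - card A)"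
      using hook_eigenvalue_cycle[OF finA finBA dj, where ?'b = 'b] S cBA
      unfolding e_def \<kappa>_def n_def by simp
    have "?W (?Y A) = conv S (\<lambda>\<pi>. e (Z x) * ?Y A \<pi>) (conv S \<kappa> (Z y)) id"
      using cv[OF cl(2)] by (subst conv_cong_left[where F' = "\<lambda>\<pi>. e (Z x) * ?Y A \<pi>"]) simp_all
    also have "\<dots> = e (Z x) * conv S (conv S (?Y A) \<kappa>) (Z y) id"
      by (simp add: conv_scale_left conv_assoc)
    also have "conv S (conv S (?Y A) \<kappa>) (Z y) id = conv S (\<lambda>\<pi>. e \<kappa> * ?Y A \<pi>) (Z y) id"
      using cv[OF cl(1)] by (subst conv_cong_left[where F' = "\<lambda>\<pi>. e \<kappa> * ?Y A \<pi>"]) simp_all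
    also have "\<dots> = e \<kappa> * (e (Z y) * ?Y A id)"
      using cv[OF cl(2) permutes_id] by (simp add: conv_scale_left)
    also have "?Y A id = 1"
      using hook_elem_comp[OF finS S dj permutes_id permutes_id, where ?'b = 'b] by simp
    finally have W: "?W (?Y A) = e (Z x) * (e \<kappa> * e (Z y))" by (simp only: mult_1_right)
    have "(-1) ^ card A * ((-1) ^ card A :: 'b) = 1" by (simp flip: power_mult_distrib)
    then show "(-1) ^ card A * ?W (?Y A) =
        (\<lambda>t. fact (n - 1 - t) * fact t * (fact n)\<^sup>2 * P t x * P t y) (card A)"
      unfolding W eZ[OF x] eZ[OF y] ek by (simp add: power2_eq_square algebra_simps)
  qed
  also have "\<dots> = (\<Sum>t\<le>card B. of_nat (card B choose t) * (fact (n - 1 - t) * fact t * (fact n)\<^sup>2 * P t x * P t y))"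
  proof -
    have "(\<Sum>A\<in>Pow B. g (card A)) = (\<Sum>t\<le>card B. of_nat (card B choose t) * (g t :: 'b))" for g
    proof -
      have "(\<Sum>A\<in>Pow B. g (card A)) = (\<Sum>t\<le>card B. \<Sum>A | A \<in> Pow B \<and> card A = t. g (card A))"
        using fin by (intro sum.group[symmetric]) (auto intro: card_mono)
      also have "\<dots> = (\<Sum>t\<le>card B. of_nat (card B choose t) * g t)"
        using n_subsets[OF fin] by (intro sum.cong refl) (auto simp: Pow_def)
      finally show ?thesis .
    qed
    then show ?thesis .
  qed
  also have "\<dots> = (\<Sum>t<n. fact (n - 1) * (fact n)\<^sup>2 * (P t x * P t y))"
  proof (rule sum.cong)
    show "{..card B} = {..<n}" by (auto simp: n_def)
    fix t assume "t \<in> {..<n}"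
    then have "t \<le> card B" by (simp add: n_def)
    then have "of_nat (fact t * fact (card B - t) * (card B choose t)) = (of_nat (fact (card B)) :: 'b)"
      by (simp only: binomial_fact_lemma)
    then have *: "fact t * fact (n - 1 - t) * of_nat (card B choose t) = (fact (n - 1) :: 'b)"
      unfolding n_def of_nat_mult of_nat_fact diff_Suc_1 .
    show "of_nat (card B choose t) * (fact (n - 1 - t) * fact t * (fact n)\<^sup>2 * P t x * P t y) =
        fact (n - 1) * (fact n)\<^sup>2 * (P t x * P t y)"
      unfolding *[symmetric] by (simp only: mult_ac)
  qed
  also have "\<dots> = of_nat n * ((fact (n - 1))\<^sup>2 * fact n * (\<Sum>t<n. P t x * P t y))"
  proof -
    have fn: "fact n = of_nat n * (fact (n - 1) :: 'b)" unfolding n_def by simp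
    show ?thesis unfolding sum_distrib_left[symmetric] power2_eq_square fn by (simp only: mult_ac)
  qed
  finally have eq: "of_nat n * ?W \<kappa> = of_nat n * ((fact (n - 1))\<^sup>2 * fact n * (\<Sum>t<n. P t x * P t y))" .
  have n0: "of_nat n \<noteq> (0 :: 'b)" unfolding n_def by (simp del: of_nat_Suc)
  have "(\<Sum>\<pi> | \<pi> permutes S. conv S \<kappa> (Z x) \<pi> * conv S \<kappa> (Z y) \<pi>) =
    (fact (n - 1))\<^sup>2 * fact n * (\<Sum>t<n. P t x * P t y)"
    unfolding Q by (rule mult_left_cancel[THEN iffD1, OF n0 eq])
  then show ?thesis unfolding \<kappa>_def Z_def P_def .
qed

section \<open>Chains of subsets\<close>

text \<open>
  An ordered set partition of \<open>{1..n}\<close> is encoded by the partial unions of its blocks: \<open>S\<close> is the set of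
  their cardinalities, and \<open>C s\<close> is the partial union with \<open>s\<close> elements. Outside \<open>S\<close> the chain is set
  to \<open>{}\<close>, so that \<open>C(s := {})\<close> merges the two blocks that meet at \<open>s\<close>.
\<close>

definition chains :: "nat \<Rightarrow> nat set \<Rightarrow> (nat \<Rightarrow> nat set) set" where
  "chains n S = {C. (\<forall>s\<in>S. C s \<subseteq> {1..n} \<and> card (C s) = s) \<and>
     (\<forall>s\<in>S. \<forall>t\<in>S. s < t \<longrightarrow> C s \<subseteq> C t) \<and> (\<forall>s. s \<notin> S \<longrightarrow> C s = {})}"

text \<open>The measure with respect to which the linear systems for functions on chains are
  triangular.\<close>

definition chain_weight :: "nat set \<Rightarrow> (nat \<Rightarrow> nat set) \<Rightarrow> nat" where
  "chain_weight S C = (\<Sum>s\<in>S. \<Sum>(C s))"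

definition chain_descent :: "nat \<Rightarrow> nat set \<Rightarrow> (nat \<Rightarrow> nat set) \<Rightarrow> nat \<Rightarrow> bool" where
  "chain_descent n S C s \<longleftrightarrow> (\<exists>a\<in>C s. \<exists>b\<in>{1..n} - C s. b < a \<and>
     (\<forall>t\<in>S. t < s \<longrightarrow> a \<notin> C t) \<and> (\<forall>t\<in>S. s < t \<longrightarrow> b \<in> C t))"

text \<open>
  Equivalently, some exchange of two elements between the blocks on either side of \<open>s\<close> decreases
  \<open>\<Sum>(C s)\<close>: the largest element of the block before \<open>s\<close> exceeds the smallest one after it.
\<close>

definition descent_chains :: "nat \<Rightarrow> nat set \<Rightarrow> nat set \<Rightarrow> (nat \<Rightarrow> nat set) set" where
  "descent_chains n S U = {C \<in> chains n S. \<forall>u\<in>U. chain_descent n S C u}"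

lemma chainsD:
  assumes "C \<in> chains n S"
  shows "s \<in> S \<Longrightarrow> C s \<subseteq> {1..n}" "s \<in> S \<Longrightarrow> card (C s) = s" "s \<in> S \<Longrightarrow> finite (C s)"
    "s \<in> S \<Longrightarrow> t \<in> S \<Longrightarrow> s < t \<Longrightarrow> C s \<subseteq> C t" "s \<in> S \<Longrightarrow> t \<in> S \<Longrightarrow> s \<le> t \<Longrightarrow> C s \<subseteq> C t"
    "s \<notin> S \<Longrightarrow> C s = {}"
proof -
  show sub: "s \<in> S \<Longrightarrow> C s \<subseteq> {1..n}" and "s \<in> S \<Longrightarrow> card (C s) = s"
     and 1: "s \<in> S \<Longrightarrow> t \<in> S \<Longrightarrow> s < t \<Longrightarrow> C s \<subseteq> C t" and "s \<notin> S \<Longrightarrow> C s = {}"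
    using assms unfolding chains_def by blast+
  show "s \<in> S \<Longrightarrow> finite (C s)"
    using finite_subset[OF sub] by simp
  show "s \<in> S \<Longrightarrow> t \<in> S \<Longrightarrow> s \<le> t \<Longrightarrow> C s \<subseteq> C t"
    using 1 by (cases "s = t") auto
qed

lemma finite_chains: "finite S \<Longrightarrow> finite (chains n S)"
proof -
  assume S: "finite S"
  have "chains n S \<subseteq> {C. \<forall>s. (s \<in> S \<longrightarrow> C s \<in> Pow {1..n}) \<and> (s \<notin> S \<longrightarrow> C s = {})}"
    unfolding chains_def by blast
  then show ?thesis
    by (rule finite_subset) (rule finite_set_of_finite_funs, use S in auto)
qed

lemma finite_descent_chains: "finite S \<Longrightarrow> finite (descent_chains n S U)"
  unfolding descent_chains_def using finite_chains by simp

lemma chains_delete: "C \<in> chains n S \<Longrightarrow> C(s := {}) \<in> chains n (S - {s})"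
  unfolding chains_def by auto

lemma chains_update:
  assumes "D \<in> chains n (S - {s})" "s \<in> S" "A \<subseteq> {1..n}" "card A = s"
    and "\<And>t. t \<in> S \<Longrightarrow> t < s \<Longrightarrow> D t \<subseteq> A" "\<And>t. t \<in> S \<Longrightarrow> s < t \<Longrightarrow> A \<subseteq> D t"
  shows "D(s := A) \<in> chains n S"
  using assms unfolding chains_def by auto

lemma fun_upd_same_iff: "C(s := x) = D(s := x) \<longleftrightarrow> (\<forall>t. t \<noteq> s \<longrightarrow> C t = D t)"
  by (auto simp: fun_eq_iff)

section \<open>Chains of least sum and descents\<close>

lemma sum_less_exchange:
  fixes A B :: "nat set"
  assumes "finite A" "finite B" "card A = card B" "A \<noteq> B"
    and less: "\<And>a b. a \<in> A - B \<Longrightarrow> b \<in> B - A \<Longrightarrow> a < b"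
  shows "\<Sum>A < \<Sum>B"
proof -
  have AB: "card (A - B) = card (B - A)"
    using assms(1-3) by (simp add: card_Diff_subset_Int Int_commute)
  have ne: "A - B \<noteq> {}"
  proof
    assume e: "A - B = {}"
    then have "card (B - A) = 0" using AB by (simp only: card.empty)
    then have "B - A = {}" using assms(2) by (simp only: card_0_eq finite_Diff)
    with e assms(4) show False by blast
  qed
  define M where "M = Max (A - B)"
  have M: "M \<in> A - B" unfolding M_def using ne assms(1) by (intro Max_in) auto
  have c: "card (A - B) > 0" using ne assms(1) by (simp add: card_gt_0_iff)
  have "\<Sum>(A - B) \<le> of_nat (card (A - B)) * M"
    by (rule sum_bounded_above) (use assms(1) in \<open>auto simp: M_def\<close>)
  also have "\<dots> < of_nat (card (B - A)) * Suc M" using c AB by simp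
  also have "\<dots> \<le> \<Sum>(B - A)"
    by (rule sum_bounded_below) (use less[OF M] in \<open>auto simp: Suc_le_eq\<close>)
  finally have lt: "\<Sum>(A - B) < \<Sum>(B - A)" .
  have "\<Sum>A = \<Sum>(A \<inter> B) + \<Sum>(A - B)" using assms(1) by (rule sum.Int_Diff)
  moreover have "\<Sum>B = \<Sum>(B \<inter> A) + \<Sum>(B - A)" using assms(2) by (rule sum.Int_Diff)
  ultimately show ?thesis using lt by (simp add: Int_commute)
qed

text \<open>An element \<open>b\<close> lost and an element \<open>a\<close> gained in passing from
  \<open>C s\<close> to \<open>C' s\<close> lie in the two blocks of \<open>C\<close> that meet at
  \<open>s\<close>, since the chains agree elsewhere. Without a descent this forces
  \<open>b < a\<close>, so every replacement raises the sum.\<close>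

lemma not_descent_less:
  assumes C: "C \<in> chains n S" and s: "s \<in> S" and nd: "\<not> chain_descent n S C s"
    and C': "C' \<in> chains n S" and eq: "C'(s := {}) = C(s := {})" and ne: "C' \<noteq> C"
  shows "\<Sum>(C s) < \<Sum>(C' s)"
proof (rule sum_less_exchange)
  have e: "C' t = C t" if "t \<noteq> s" for t using eq that unfolding fun_upd_same_iff by blast
  show "finite (C s)" "finite (C' s)" "card (C s) = card (C' s)"
    using chainsD[OF C] chainsD[OF C'] s by auto
  show "C s \<noteq> C' s" using ne e by (metis ext)
  fix b a assume b: "b \<in> C s - C' s" and a: "a \<in> C' s - C s"
  show "b < a"
  proof (rule ccontr)
    assume "\<not> b < a"
    then have "a < b" using a b by (cases "a = b") auto
    moreover have "a \<in> {1..n} - C s" using chainsD(1)[OF C' s] a by auto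
    moreover have "\<forall>t\<in>S. t < s \<longrightarrow> b \<notin> C t"
      using chainsD(4)[OF C' _ s] b e by (metis DiffD2 less_irrefl subsetD)
    moreover have "\<forall>t\<in>S. s < t \<longrightarrow> a \<in> C t"
      using chainsD(4)[OF C' s] a e by (metis DiffD1 less_irrefl subsetD)
    ultimately show False using nd b unfolding chain_descent_def by blast
  qed
qed

lemma not_descent_weight_less:
  assumes "finite S" "C \<in> chains n S" and s: "s \<in> S" and "\<not> chain_descent n S C s"
    and "C' \<in> chains n S" and eq: "C'(s := {}) = C(s := {})" and "C' \<noteq> C"
  shows "chain_weight S C < chain_weight S C'"
proof -
  have e: "C' t = C t" if "t \<noteq> s" for t using eq that unfolding fun_upd_same_iff by blast
  have "chain_weight S C = \<Sum>(C s) + (\<Sum>t\<in>S - {s}. \<Sum>(C t))"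
    unfolding chain_weight_def using assms(1) s by (rule sum.remove)
  also have "(\<Sum>t\<in>S - {s}. \<Sum>(C t)) = (\<Sum>t\<in>S - {s}. \<Sum>(C' t))"
    using e by (intro sum.cong) auto
  also have "\<Sum>(C s) + \<dots> < \<Sum>(C' s) + (\<Sum>t\<in>S - {s}. \<Sum>(C' t))"
    using not_descent_less[OF assms(2-7)] by simp
  also have "\<dots> = chain_weight S C'"
    unfolding chain_weight_def using assms(1) s by (rule sum.remove[symmetric])
  finally show ?thesis .
qed

lemma chains_extend:
  assumes D: "D \<in> chains n (S - {s})" and s: "s \<in> S" "s \<le> n" and fin: "finite S" and S: "S \<subseteq> {..n}"
  shows "\<exists>C. C \<in> chains n S \<and> C(s := {}) = D"
proof -
  define L U where "L = (\<Union>t\<in>{t\<in>S. t < s}. D t)" and "U = {1..n} \<inter> (\<Inter>t\<in>{t\<in>S. s < t}. D t)"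
  have LU: "L \<subseteq> U"
    unfolding L_def U_def using chainsD(1)[OF D] chainsD(4)[OF D] by fastforce
  have "card L \<le> s"
  proof (cases "{t\<in>S. t < s} = {}")
    case True
    show ?thesis unfolding L_def True by simp
  next
    case False
    define m where "m = Max {t\<in>S. t < s}"
    have m: "m \<in> {t\<in>S. t < s}" unfolding m_def using False fin by (intro Max_in) auto
    have "D t \<subseteq> D m" if "t \<in> {t\<in>S. t < s}" for t
      using that m fin by (intro chainsD(5)[OF D]) (auto simp: m_def)
    then have "L = D m" unfolding L_def using m by auto
    then show ?thesis using chainsD(2)[OF D, of m] m by simp
  qed
  moreover have "s \<le> card U"
  proof (cases "{t\<in>S. s < t} = {}")
    case True
    show ?thesis unfolding U_def True using s by simp
  next
    case False
    define m where "m = Min {t\<in>S. s < t}"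
    have m: "m \<in> {t\<in>S. s < t}" unfolding m_def using False fin by (intro Min_in) auto
    have "D m \<subseteq> D t" if "t \<in> {t\<in>S. s < t}" for t
      using that m fin by (intro chainsD(5)[OF D]) (auto simp: m_def)
    then have "U = D m" unfolding U_def using m chainsD(1)[OF D, of m] by blast
    then show ?thesis using chainsD(2)[OF D, of m] m by simp
  qed
  moreover have "finite U" by (simp add: U_def)
  ultimately obtain A where A: "L \<subseteq> A" "A \<subseteq> U" "card A = s"
    using exists_subset_between[OF _ _ LU] by blast
  have "D(s := A) \<in> chains n S"
    by (rule chains_update[OF D s(1)]) (use A in \<open>auto simp: L_def U_def\<close>)
  moreover have "D s = {}" using chainsD(6)[OF D] by simp
  ultimately show ?thesis by (intro exI[of _ "D(s := A)"]) (auto simp: fun_eq_iff)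
qed

text \<open>Existence takes an extension of \<open>D\<close> with least sum at \<open>s\<close>: a
  descent would offer an exchange that lowers it. Uniqueness holds because each of two such
  extensions would have the smaller sum.\<close>

lemma ex1_not_descent:
  assumes D: "D \<in> chains n (S - {s})" and s: "s \<in> S" and fin: "finite S" and S: "S \<subseteq> {..n}"
  shows "\<exists>!C. C \<in> chains n S \<and> C(s := {}) = D \<and> \<not> chain_descent n S C s"
proof -
  let ?F = "{C \<in> chains n S. C(s := {}) = D}"
  have "?F \<noteq> {}" using chains_extend[OF D s _ fin S] s S by auto
  moreover have "finite ?F" using finite_chains[OF fin] by simp
  ultimately obtain C where C: "C \<in> ?F" and min: "\<And>C'. C' \<in> ?F \<Longrightarrow> \<Sum>(C s) \<le> \<Sum>(C' s)"
    using ex_min_if_finite[of "(\<lambda>C. \<Sum>(C s)) ` ?F"] by (auto simp: not_less)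
  have Cc: "C \<in> chains n S" using C by simp
  have "\<not> chain_descent n S C s"
  proof
    assume "chain_descent n S C s"
    then obtain a b where ab: "a \<in> C s" "b \<in> {1..n} - C s" "b < a"
      "\<And>t. t \<in> S \<Longrightarrow> t < s \<Longrightarrow> a \<notin> C t" "\<And>t. t \<in> S \<Longrightarrow> s < t \<Longrightarrow> b \<in> C t"
      unfolding chain_descent_def by blast
    define A where "A = insert b (C s - {a})"
    have fC: "finite (C s)" using chainsD(3)[OF Cc s] .
    have "card A = s" unfolding A_def using ab fC chainsD(2)[OF Cc s]
      by (simp add: card_insert_if) (metis Suc_diff_Suc card_gt_0_iff diff_zero empty_iff)
    have "D(s := A) \<in> chains n S"
    proof (rule chains_update[OF D s _ \<open>card A = s\<close>])
      show "A \<subseteq> {1..n}" using ab chainsD(1)[OF Cc s] by (auto simp: A_def)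
      fix t assume t: "t \<in> S"
      have Dt: "D t = C t" if "t \<noteq> s" using C that by auto
      show "D t \<subseteq> A" if "t < s"
        using chainsD(4)[OF Cc t s that] ab(4)[OF t that] Dt that by (auto simp: A_def)
      show "A \<subseteq> D t" if "s < t"
        using chainsD(4)[OF Cc s t that] ab(5)[OF t that] Dt that by (auto simp: A_def)
    qed
    moreover have "(D(s := A))(s := {}) = D" using chainsD(6)[OF D, of s] by (auto simp: fun_eq_iff)
    ultimately have "\<Sum>(C s) \<le> \<Sum>A" using min[of "D(s := A)"] by simp
    also have "\<Sum>A = b + \<Sum>(C s - {a})" unfolding A_def using ab fC by simp
    also have "\<dots> < a + \<Sum>(C s - {a})" using ab by simp
    also have "\<dots> = \<Sum>(C s)" using ab(1) fC by (rule sum.remove[OF _ , symmetric, rotated])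
    finally show False by simp
  qed
  moreover have "C' = C" if "C' \<in> chains n S" "C'(s := {}) = D" "\<not> chain_descent n S C' s" for C'
  proof (rule ccontr)
    assume "C' \<noteq> C"
    then have "\<Sum>(C' s) < \<Sum>(C s)"
      using that C by (intro not_descent_less[of C' n S s C]) (auto simp: s)
    moreover have "\<Sum>(C s) \<le> \<Sum>(C' s)" using min that by simp
    ultimately show False by simp
  qed
  ultimately show ?thesis using C by (intro ex1I[of _ C]) auto
qed

text \<open>Deleting \<open>s\<close> could create a descent at a neighbour \<open>u\<close>, as a
  witness may now come from the far side of \<open>s\<close>. Without a descent at \<open>s\<close>,
  any suitable element of the block between \<open>u\<close> and \<open>s\<close> can replace that
  witness, being smaller than it if \<open>u < s\<close> and larger if \<open>s < u\<close>.\<close>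

lemma chain_descent_delete:
  assumes C: "C \<in> chains n S" and s: "s \<in> S" and u: "u \<in> S" "u \<noteq> s" and nd: "\<not> chain_descent n S C s"
  shows "chain_descent n (S - {s}) (C(s := {})) u \<longleftrightarrow> chain_descent n S C u"
proof
  assume "chain_descent n S C u"
  then show "chain_descent n (S - {s}) (C(s := {})) u"
    unfolding chain_descent_def using u by auto
next
  assume "chain_descent n (S - {s}) (C(s := {})) u"
  then obtain a b where ab: "a \<in> C u" "b \<in> {1..n} - C u" "b < a"
    and lo: "\<And>t. t \<in> S \<Longrightarrow> t \<noteq> s \<Longrightarrow> t < u \<Longrightarrow> a \<notin> C t"
    and hi: "\<And>t. t \<in> S \<Longrightarrow> t \<noteq> s \<Longrightarrow> u < t \<Longrightarrow> b \<in> C t"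
    unfolding chain_descent_def using u by auto
  have sub: "C t \<subseteq> C t'" if "t \<in> S" "t' \<in> S" "t \<le> t'" for t t' using chainsD(5)[OF C that] .
  consider "u < s" | "s < u" using u by linarith
  then show "chain_descent n S C u"
  proof cases
    case 1
    show ?thesis
    proof (cases "b \<in> C s")
      case True
      then show ?thesis using ab lo hi 1 unfolding chain_descent_def by (metis less_asym)
    next
      case b: False
      \<comment> \<open>So \<open>u\<close> and \<open>s\<close> are consecutive in
        \<open>S\<close>: a \<open>t\<close> between them would put \<open>b\<close> into
        \<open>C t\<close> and hence into \<open>C s\<close>.\<close>
      have between: "t \<le> u" if "t \<in> S" "t < s" for t
        using hi[of t] sub[of t s] that s b by (metis leI less_irrefl less_imp_le subsetD)
      have "\<not> C s \<subseteq> C u"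
        using card_mono[OF chainsD(3)[OF C u(1)], of "C s"] chainsD(2)[OF C] s u 1 by fastforce
      then obtain b' where b': "b' \<in> C s" "b' \<notin> C u" by blast
      have "b' < b"
      proof (rule ccontr)
        assume "\<not> b' < b"
        then have "b < b'" using b b' by (cases "b = b'") auto
        moreover have "\<forall>t\<in>S. t < s \<longrightarrow> b' \<notin> C t" using between sub u b' by blast
        moreover have "\<forall>t\<in>S. s < t \<longrightarrow> b \<in> C t" using hi 1 by auto
        ultimately have "chain_descent n S C s"
          unfolding chain_descent_def using b b' ab by blast
        with nd show False by contradiction
      qed
      then have "b' < a" using ab by simp
      moreover have "\<forall>t\<in>S. t < u \<longrightarrow> a \<notin> C t" using lo 1 by auto
      moreover have "\<forall>t\<in>S. u < t \<longrightarrow> b' \<in> C t"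
      proof (intro ballI impI)
        fix t assume "t \<in> S" "u < t"
        then have "s \<le> t" using between[of t] by linarith
        then show "b' \<in> C t" using sub[of s t] s \<open>t \<in> S\<close> b' by blast
      qed
      moreover have "b' \<in> {1..n} - C u" using b' chainsD(1)[OF C s] by auto
      ultimately show ?thesis unfolding chain_descent_def using ab by blast
    qed
  next
    case 2
    show ?thesis
    proof (cases "a \<in> C s")
      case False
      then show ?thesis using ab lo hi 2 unfolding chain_descent_def by (metis less_asym)
    next
      case a: True
      have between: "u \<le> t" if "t \<in> S" "s < t" for t
        using lo[of t] sub[of s t] that s a by (metis leI less_irrefl less_imp_le subsetD)
      have "\<not> C u \<subseteq> C s"
        using card_mono[OF chainsD(3)[OF C s], of "C u"] chainsD(2)[OF C] s u 2 by fastforce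
      then obtain a' where a': "a' \<in> C u" "a' \<notin> C s" by blast
      have "a < a'"
      proof (rule ccontr)
        assume "\<not> a < a'"
        then have "a' < a" using a a' by (cases "a = a'") auto
        moreover have "\<forall>t\<in>S. t < s \<longrightarrow> a \<notin> C t" using lo 2 by auto
        moreover have "\<forall>t\<in>S. s < t \<longrightarrow> a' \<in> C t" using between sub u a' by blast
        moreover have "a' \<in> {1..n} - C s" using a' chainsD(1)[OF C u(1)] by auto
        ultimately have "chain_descent n S C s"
          unfolding chain_descent_def using a by blast
        with nd show False by contradiction
      qed
      then have "b < a'" using ab by simp
      moreover have "\<forall>t\<in>S. u < t \<longrightarrow> b \<in> C t" using hi 2 by auto
      moreover have "\<forall>t\<in>S. t < u \<longrightarrow> a' \<notin> C t"
      proof (intro ballI impI)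
        fix t assume "t \<in> S" "t < u"
        then have "t \<le> s" using between[of t] by linarith
        then show "a' \<notin> C t" using sub[of t s] s \<open>t \<in> S\<close> a' by blast
      qed
      ultimately show ?thesis unfolding chain_descent_def using ab a' by blast
    qed
  qed
qed

section \<open>Kernels of the merging maps\<close>

text \<open>Back substitution from the largest weight downwards: row \<open>i\<close> meets, apart
  from its diagonal entry, only columns of smaller weight, so correcting the columns of weight
  \<open>k\<close> leaves the heavier ones alone.\<close>

lemma triangular_system_solvable:
  fixes m :: "'i \<Rightarrow> 'i \<Rightarrow> 'a::comm_ring_1" and w :: "'i \<Rightarrow> nat"
  assumes fin: "finite I" and diag: "\<And>i. i \<in> I \<Longrightarrow> m i i = 1"
    and tri: "\<And>i j. i \<in> I \<Longrightarrow> j \<in> I \<Longrightarrow> m i j \<noteq> 0 \<Longrightarrow> i = j \<or> w j < w i"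
  shows "\<exists>c. \<forall>j\<in>I. (\<Sum>i\<in>I. c i * m i j) = g j"
proof -
  have main: "\<exists>c. \<forall>j\<in>I. (\<Sum>i\<in>I. c i * m i j) = g j" if "\<And>i. i \<in> I \<Longrightarrow> k \<le> w i \<Longrightarrow> g i = 0" for k g
    using that
  proof (induction k arbitrary: g)
    case 0
    then show ?case by (intro exI[of _ "\<lambda>_. 0"]) simp
  next
    case (Suc k)
    let ?J = "{i \<in> I. w i = k}"
    define g' where "g' j = g j - (\<Sum>i\<in>?J. g i * m i j)" for j
    have "g' j = 0" if j: "j \<in> I" "k \<le> w j" for j
    proof (cases "w j = k")
      case True
      have "(\<Sum>i\<in>?J. g i * m i j) = (\<Sum>i\<in>?J. if i = j then g j else 0)"
        using tri[of _ j] j diag True by (intro sum.cong refl) force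
      then show ?thesis using j True fin by (simp add: g'_def)
    next
      case False
      have "(\<Sum>i\<in>?J. g i * m i j) = 0"
        using tri[of _ j] j False by (intro sum.neutral) force
      moreover have "g j = 0" using Suc.prems[of j] j False by simp
      ultimately show ?thesis by (simp add: g'_def)
    qed
    then obtain c where c: "\<forall>j\<in>I. (\<Sum>i\<in>I. c i * m i j) = g' j" using Suc.IH by blast
    have "(\<Sum>i\<in>I. (c i + (if w i = k then g i else 0)) * m i j) = g j" if j: "j \<in> I" for j
    proof -
      have "(\<Sum>i\<in>I. (c i + (if w i = k then g i else 0)) * m i j) =
          (\<Sum>i\<in>I. c i * m i j) + (\<Sum>i\<in>I. if w i = k then g i * m i j else 0)"
        unfolding sum.distrib[symmetric] by (intro sum.cong refl) (simp add: distrib_right)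
      also have "(\<Sum>i\<in>I. if w i = k then g i * m i j else 0) = (\<Sum>i\<in>?J. g i * m i j)"
        using fin by (simp add: sum.If_cases Int_def)
      finally show ?thesis using c j by (simp add: g'_def)
    qed
    then show ?case by (intro exI[of _ "\<lambda>i. c i + (if w i = k then g i else 0)"]) simp
  qed
  obtain k where "\<forall>i\<in>I. w i < k" using fin finite_nat_set_iff_bounded[of "w ` I"] by auto
  then show ?thesis using main[of k g] by (metis not_le)
qed

section \<open>Linear spaces of functions, coordinate forms and traces\<close>

definition linear_space :: "('a \<Rightarrow> 'b::comm_ring_1) set \<Rightarrow> bool" where
  "linear_space V \<longleftrightarrow> (\<lambda>_. 0) \<in> V \<and> (\<forall>f\<in>V. \<forall>g\<in>V. (\<lambda>x. f x + g x) \<in> V) \<and> (\<forall>c. \<forall>f\<in>V. (\<lambda>x. c * f x) \<in> V)"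

text \<open>Linearity is demanded on \<open>V\<close> only; coordinates such as
  \<open>cfun_representation\<close> are linear only on the span of the basis.\<close>

definition linear_form :: "('a \<Rightarrow> 'b::comm_ring_1) set \<Rightarrow> (('a \<Rightarrow> 'b) \<Rightarrow> 'b) \<Rightarrow> bool" where
  "linear_form V l \<longleftrightarrow> (\<forall>f\<in>V. \<forall>g\<in>V. l (\<lambda>x. f x + g x) = l f + l g) \<and> (\<forall>c. \<forall>f\<in>V. l (\<lambda>x. c * f x) = c * l f)"

lemma linear_spaceD:
  assumes "linear_space V"
  shows "(\<lambda>_. 0) \<in> V" "f \<in> V \<Longrightarrow> g \<in> V \<Longrightarrow> (\<lambda>x. f x + g x) \<in> V" "f \<in> V \<Longrightarrow> (\<lambda>x. c * f x) \<in> V"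
proof -
  note V = assms[unfolded linear_space_def]
  show "(\<lambda>_. 0) \<in> V" by (rule conjunct1[OF V])
  show "f \<in> V \<Longrightarrow> g \<in> V \<Longrightarrow> (\<lambda>x. f x + g x) \<in> V"
    by (rule bspec[OF bspec[OF conjunct1[OF conjunct2[OF V]]]])
  show "f \<in> V \<Longrightarrow> (\<lambda>x. c * f x) \<in> V"
    by (rule bspec[OF spec[OF conjunct2[OF conjunct2[OF V]]]])
qed

lemma linear_formD:
  assumes "linear_form V l"
  shows "f \<in> V \<Longrightarrow> g \<in> V \<Longrightarrow> l (\<lambda>x. f x + g x) = l f + l g" "f \<in> V \<Longrightarrow> l (\<lambda>x. c * f x) = c * l f"
proof -
  note l = assms[unfolded linear_form_def]
  show "f \<in> V \<Longrightarrow> g \<in> V \<Longrightarrow> l (\<lambda>x. f x + g x) = l f + l g"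
    by (rule bspec[OF bspec[OF conjunct1[OF l]]])
  show "f \<in> V \<Longrightarrow> l (\<lambda>x. c * f x) = c * l f"
    by (rule bspec[OF spec[OF conjunct2[OF l]]])
qed

lemma linear_space_sum:
  assumes V: "linear_space V" and "finite J" "\<And>j. j \<in> J \<Longrightarrow> F j \<in> V"
  shows "(\<lambda>x. \<Sum>j\<in>J. c j * F j x) \<in> V"
  using assms(2,3)
proof (induction J rule: finite_induct)
  case empty
  then show ?case using linear_spaceD(1)[OF V] by simp
next
  case (insert j J)
  have "(\<lambda>x. c j * F j x + (\<Sum>j\<in>J. c j * F j x)) \<in> V"
    by (rule linear_spaceD(2)[OF V linear_spaceD(3)[OF V]]) (use insert in auto)
  then show ?case using insert.hyps by simp
qed

lemma linear_form_sum:
  assumes V: "linear_space V" and l: "linear_form V l" and "finite J" "\<And>j. j \<in> J \<Longrightarrow> F j \<in> V"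
  shows "l (\<lambda>x. \<Sum>j\<in>J. c j * F j x) = (\<Sum>j\<in>J. c j * l (F j))"
  using assms(3,4)
proof (induction J rule: finite_induct)
  case empty
  from linear_formD(2)[OF l linear_spaceD(1)[OF V], of 0] show ?case by simp
next
  case (insert j J)
  have 1: "(\<lambda>x. \<Sum>j\<in>J. c j * F j x) \<in> V" using insert by (intro linear_space_sum[OF V]) auto
  have 2: "(\<lambda>x. c j * F j x) \<in> V" using insert.prems by (intro linear_spaceD(3)[OF V]) auto
  have "l (\<lambda>x. \<Sum>j\<in>insert j J. c j * F j x) = l (\<lambda>x. (\<lambda>x. c j * F j x) x + (\<lambda>x. \<Sum>j\<in>J. c j * F j x) x)"
    using insert.hyps by simp
  also have "\<dots> = l (\<lambda>x. c j * F j x) + l (\<lambda>x. \<Sum>j\<in>J. c j * F j x)"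
    by (rule linear_formD(1)[OF l 2 1])
  also have "l (\<lambda>x. c j * F j x) = c j * l (F j)"
    using insert.prems by (intro linear_formD(2)[OF l]) auto
  finally show ?case using insert by simp
qed

text \<open>Both sides are the trace of \<open>L\<close> on \<open>V\<close>.\<close>

lemma trace_unique:
  fixes V :: "('a \<Rightarrow> 'b::comm_ring_1) set"
  assumes V: "linear_space V" and fin: "finite I" "finite J"
    and L: "\<And>f. f \<in> V \<Longrightarrow> L f \<in> V" "\<And>x. linear_form V (\<lambda>f. L f x)"
    and b: "\<And>i. i \<in> I \<Longrightarrow> b i \<in> V" "\<And>i. i \<in> I \<Longrightarrow> linear_form V (l i)"
    and d: "\<And>j. j \<in> J \<Longrightarrow> d j \<in> V" "\<And>j. j \<in> J \<Longrightarrow> linear_form V (m j)"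
    and bV: "\<And>f. f \<in> V \<Longrightarrow> f = (\<lambda>x. \<Sum>i\<in>I. l i f * b i x)"
    and dV: "\<And>f. f \<in> V \<Longrightarrow> f = (\<lambda>x. \<Sum>j\<in>J. m j f * d j x)"
  shows "(\<Sum>i\<in>I. l i (L (b i))) = (\<Sum>j\<in>J. m j (L (d j)))"
proof -
  \<comment> \<open>Both sides become the sum of all \<open>m j (b i) * l i (L (d j))\<close>: here
    by expanding \<open>b i\<close> in the family \<open>d\<close>, below by expanding
    \<open>L (d j)\<close> in the family \<open>b\<close>.\<close>
  have 1: "l i (L (b i)) = (\<Sum>j\<in>J. m j (b i) * l i (L (d j)))" if i: "i \<in> I" for i
  proof -
    have "L (b i) = (\<lambda>x. \<Sum>j\<in>J. m j (b i) * L (d j) x)"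
    proof
      fix x
      have "L (b i) x = L (\<lambda>x. \<Sum>j\<in>J. m j (b i) * d j x) x" using dV[OF b(1)[OF i]] by simp
      also have "\<dots> = (\<Sum>j\<in>J. m j (b i) * L (d j) x)"
        by (rule linear_form_sum[OF V L(2) fin(2) d(1)])
      finally show "L (b i) x = (\<Sum>j\<in>J. m j (b i) * L (d j) x)" .
    qed
    then have "l i (L (b i)) = l i (\<lambda>x. \<Sum>j\<in>J. m j (b i) * L (d j) x)" by simp
    also have "\<dots> = (\<Sum>j\<in>J. m j (b i) * l i (L (d j)))"
      by (rule linear_form_sum[OF V b(2)[OF i] fin(2) L(1)[OF d(1)]])
    finally show ?thesis .
  qed
  have 2: "m j (L (d j)) = (\<Sum>i\<in>I. l i (L (d j)) * m j (b i))" if j: "j \<in> J" for j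
  proof -
    have "m j (L (d j)) = m j (\<lambda>x. \<Sum>i\<in>I. l i (L (d j)) * b i x)"
      using bV[OF L(1)[OF d(1)[OF j]]] by simp
    also have "\<dots> = (\<Sum>i\<in>I. l i (L (d j)) * m j (b i))"
      by (rule linear_form_sum[OF V d(2)[OF j] fin(1) b(1)])
    finally show ?thesis .
  qed
  have "(\<Sum>i\<in>I. l i (L (b i))) = (\<Sum>i\<in>I. \<Sum>j\<in>J. m j (b i) * l i (L (d j)))"
    using 1 by simp
  also have "\<dots> = (\<Sum>j\<in>J. \<Sum>i\<in>I. l i (L (d j)) * m j (b i))"
    by (subst sum.swap) (simp add: mult.commute)
  also have "\<dots> = (\<Sum>j\<in>J. m j (L (d j)))" using 2 by simp
  finally show ?thesis .
qed

section \<open>Merging maps, their kernels and dual bases\<close>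

definition merge :: "nat \<Rightarrow> nat set \<Rightarrow> nat \<Rightarrow> ((nat \<Rightarrow> nat set) \<Rightarrow> complex) \<Rightarrow> (nat \<Rightarrow> nat set) \<Rightarrow> complex" where
  "merge n S s f D = (\<Sum>C | C \<in> chains n S \<and> C(s := {}) = D. f C)"

text \<open>\<open>U = {}\<close> gives all functions on chains, the permutation module of the
  tabloids, and \<open>U = S\<close> turns out to be the Specht module of a ribbon; the sets in
  between carry the induction.\<close>

definition kernel :: "nat \<Rightarrow> nat set \<Rightarrow> nat set \<Rightarrow> ((nat \<Rightarrow> nat set) \<Rightarrow> complex) set" where
  "kernel n S U = {f. (\<forall>C. C \<notin> chains n S \<longrightarrow> f C = 0) \<and> (\<forall>u\<in>U. \<forall>D. merge n S u f D = 0)}"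

lemma merge_linear:
  "merge n S s (\<lambda>C. f C + g C) D = merge n S s f D + merge n S s g D"
  "merge n S s (\<lambda>C. c * f C) D = c * merge n S s f D"
  unfolding merge_def by (simp_all add: sum.distrib sum_distrib_left)

lemma linear_space_kernel: "linear_space (kernel n S U)"
  unfolding linear_space_def kernel_def by (auto simp: merge_linear) (simp add: merge_def)

lemma linear_form_merge: "linear_form V (\<lambda>f. merge n S s f D)"
  unfolding linear_form_def by (simp add: merge_linear)

lemma linear_form_apply: "linear_form V (\<lambda>f. f x)"
  unfolding linear_form_def by simp

lemma kernelD:
  assumes "f \<in> kernel n S U"
  shows "C \<notin> chains n S \<Longrightarrow> f C = 0" "u \<in> U \<Longrightarrow> merge n S u f D = 0"
  using assms unfolding kernel_def by auto

lemma kernel_insert_iff: "f \<in> kernel n S (insert s U) \<longleftrightarrow> f \<in> kernel n S U \<and> (\<forall>D. merge n S s f D = 0)"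
  unfolding kernel_def by auto

lemma merge_merge:
  assumes "finite S"
  shows "merge n (S - {s}) u (merge n S s f) D = (\<Sum>C | C \<in> chains n S \<and> C(s := {}, u := {}) = D. f C)"
proof -
  let ?A = "{C \<in> chains n S. C(s := {}, u := {}) = D}" and ?B = "{C \<in> chains n (S - {s}). C(u := {}) = D}"
  have "(\<Sum>C\<in>?A. f C) = (\<Sum>C'\<in>?B. \<Sum>C | C \<in> ?A \<and> C(s := {}) = C'. f C)"
    using assms finite_chains[of S n] finite_chains[of "S - {s}" n] chains_delete
    by (intro sum.group[symmetric]) auto
  also have "\<dots> = (\<Sum>C'\<in>?B. merge n S s f C')"
    unfolding merge_def by (intro sum.cong refl) auto
  finally show ?thesis unfolding merge_def by simp
qed

text \<open>Merging at \<open>s\<close> and merging at \<open>u\<close> commute, because two members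
  of a chain may be deleted in either order.\<close>

lemma merge_kernel:
  assumes "finite S" "s \<notin> U" and f: "f \<in> kernel n S U"
  shows "merge n S s f \<in> kernel n (S - {s}) U"
proof -
  have "merge n S s f D = 0" if "D \<notin> chains n (S - {s})" for D
    unfolding merge_def using that chains_delete[of _ n S s] by (intro sum.neutral) auto
  moreover have "merge n (S - {s}) u (merge n S s f) D = 0" if u: "u \<in> U" for u D
  proof -
    have "merge n (S - {s}) u (merge n S s f) D = merge n (S - {u}) s (merge n S u f) D"
    proof -
      have "u \<noteq> s" using u assms(2) by blast
      then have "C(s := {}, u := {}) = C(u := {}, s := {})" for C :: "nat \<Rightarrow> nat set"
        by (metis fun_upd_twist)
      then show ?thesis unfolding merge_merge[OF assms(1)] by (simp only:)
    qed
    also have "merge n S u f = (\<lambda>_. 0)" using kernelD(2)[OF f u] by auto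
    finally show ?thesis by (simp add: merge_def)
  qed
  ultimately show ?thesis unfolding kernel_def by simp
qed

text \<open>
  Where \<open>C\<close> has no descent, \<open>C u\<close> has the smallest sum among its alternatives, so the merging relation
  at \<open>u\<close> expresses \<open>f C\<close> by values of \<open>f\<close> on chains of larger weight. Hence an element of the kernel is
  determined by its values on the descent chains.
\<close>

lemma kernel_step:
  assumes S: "finite S" and f: "f \<in> kernel n S U" and u: "u \<in> U" "u \<in> S"
    and C: "C \<in> chains n S" "\<not> chain_descent n S C u"
    and zero: "\<And>C'. C' \<in> chains n S \<Longrightarrow> chain_weight S C < chain_weight S C' \<Longrightarrow> f C' = 0"
  shows "f C = 0"
proof -
  let ?F = "{C' \<in> chains n S. C'(u := {}) = C(u := {})}"
  have "0 = (\<Sum>C'\<in>?F. f C')" using kernelD(2)[OF f u(1), of "C(u := {})"] by (simp add: merge_def)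
  also have "\<dots> = f C + (\<Sum>C'\<in>?F - {C}. f C')"
    using finite_chains[OF S] C by (intro sum.remove) auto
  also have "(\<Sum>C'\<in>?F - {C}. f C') = 0"
    using not_descent_weight_less[OF S C(1) u(2) C(2)] zero by (intro sum.neutral) auto
  finally show ?thesis by simp
qed

lemma chain_weight_le:
  assumes "C \<in> chains n S"
  shows "chain_weight S C \<le> card S * \<Sum>{1..n}"
  unfolding chain_weight_def
proof -
  have "(\<Sum>s\<in>S. \<Sum>(C s)) \<le> of_nat (card S) * \<Sum>{1..n}"
    by (rule sum_bounded_above) (use chainsD(1)[OF assms] in \<open>auto intro!: sum_mono2\<close>)
  then show "(\<Sum>s\<in>S. \<Sum>(C s)) \<le> card S * \<Sum>{1..n}" by simp
qed

text \<open>Induction from the heaviest chains downwards. The threshold \<open>w\<close> serves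
  functions that vanish only at descent chains above a given weight.\<close>

lemma kernel_vanish:
  assumes S: "finite S" and U: "U \<subseteq> S" and f: "f \<in> kernel n S U"
    and zero: "\<And>C. C \<in> descent_chains n S U \<Longrightarrow> w \<le> chain_weight S C \<Longrightarrow> f C = 0"
    and C: "C \<in> chains n S" "w \<le> chain_weight S C"
  shows "f C = 0"
  using C
proof (induction "card S * \<Sum>{1..n} - chain_weight S C" arbitrary: C rule: less_induct)
  case less
  show ?case
  proof (cases "C \<in> descent_chains n S U")
    case True
    then show ?thesis by (rule zero[OF _ less.prems(2)])
  next
    case False
    then obtain u where u: "u \<in> U" "\<not> chain_descent n S C u"
      using less.prems unfolding descent_chains_def by auto
    show ?thesis
    proof (rule kernel_step[OF S f u(1) _ less.prems(1) u(2)])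
      show "u \<in> S" using u U by auto
      fix C' assume C': "C' \<in> chains n S" "chain_weight S C < chain_weight S C'"
      have "chain_weight S C < card S * \<Sum>{1..n}"
        using C'(2) chain_weight_le[OF C'(1)] by (rule less_le_trans)
      from less.hyps[OF diff_less_mono2[OF C'(2) this] C'(1)] show "f C' = 0"
        using C'(2) less.prems(2) by linarith
    qed
  qed
qed

corollary kernel_eqI:
  assumes S: "finite S" and U: "U \<subseteq> S" and f: "f \<in> kernel n S U" and g: "g \<in> kernel n S U"
    and eq: "\<And>C. C \<in> descent_chains n S U \<Longrightarrow> f C = g C"
  shows "f = g"
proof
  fix C
  have fg: "(\<lambda>C. f C - g C) \<in> kernel n S U"
  proof -
    have "(\<lambda>C. f C + (\<lambda>C. (-1) * g C) C) \<in> kernel n S U"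
      by (rule linear_spaceD(2)[OF linear_space_kernel f linear_spaceD(3)[OF linear_space_kernel g]])
    then show ?thesis by simp
  qed
  show "f C = g C"
  proof (cases "C \<in> chains n S")
    case True
    have "f C - g C = 0"
    proof (rule kernel_vanish[where w = 0, OF S U fg _ True])
      fix C assume "C \<in> descent_chains n S U"
      from eq[OF this] show "f C - g C = 0" by simp
    qed simp
    then show ?thesis by simp
  next
    case False
    then show ?thesis using kernelD(1)[OF f] kernelD(1)[OF g] by simp
  qed
qed

text \<open>A basis of the kernel whose coordinates are the evaluations at descent chains; for
  \<open>U = S\<close> these chains play the part of standard tableaux.\<close>

definition dual_family :: "nat \<Rightarrow> nat set \<Rightarrow> nat set \<Rightarrow> ((nat \<Rightarrow> nat set) \<Rightarrow> (nat \<Rightarrow> nat set) \<Rightarrow> complex) \<Rightarrow> bool" where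
  "dual_family n S U b \<longleftrightarrow> (\<forall>C\<in>descent_chains n S U. b C \<in> kernel n S U \<and>
     (\<forall>C'\<in>descent_chains n S U. b C C' = of_bool (C' = C)))"

lemma dual_family_expand:
  assumes S: "finite S" and U: "U \<subseteq> S" and b: "dual_family n S U b" and f: "f \<in> kernel n S U"
  shows "f = (\<lambda>x. \<Sum>C\<in>descent_chains n S U. f C * b C x)"
proof (rule kernel_eqI[OF S U f])
  show "(\<lambda>x. \<Sum>C\<in>descent_chains n S U. f C * b C x) \<in> kernel n S U"
    using b by (intro linear_space_sum[OF linear_space_kernel] finite_descent_chains S) (simp add: dual_family_def)
  fix C assume C: "C \<in> descent_chains n S U"
  have "(\<Sum>C'\<in>descent_chains n S U. f C' * b C' C) = (\<Sum>C'\<in>descent_chains n S U. if C' = C then f C else 0)"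
    using b C by (intro sum.cong refl) (auto simp: dual_family_def)
  then show "f C = (\<Sum>C'\<in>descent_chains n S U. f C' * b C' C)"
    using C finite_descent_chains[OF S] by simp
qed

text \<open>Above the weight of \<open>C\<close> all prescribed values are 0, so
  \<open>kernel_vanish\<close> applies. A chain of the same weight either carries a prescribed value
  or lacks a descent, and then \<open>kernel_step\<close> reduces it to heavier chains.\<close>

lemma dual_family_triangular:
  assumes S: "finite S" and U: "U \<subseteq> S" and b: "dual_family n S U b"
    and C: "C \<in> descent_chains n S U" and C': "C' \<in> chains n S" "C' \<noteq> C" "chain_weight S C \<le> chain_weight S C'"
  shows "b C C' = 0"
proof -
  have bK: "b C \<in> kernel n S U" and bC: "\<And>C'. C' \<in> descent_chains n S U \<Longrightarrow> b C C' = of_bool (C' = C)"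
    using b C unfolding dual_family_def by auto
  have above: "b C C' = 0" if "C' \<in> chains n S" "chain_weight S C < chain_weight S C'" for C'
  proof (rule kernel_vanish[where w = "Suc (chain_weight S C)", OF S U bK _ that(1)])
    fix C' assume C': "C' \<in> descent_chains n S U" "Suc (chain_weight S C) \<le> chain_weight S C'"
    then have "C' \<noteq> C" by auto
    then show "b C C' = 0" using bC[OF C'(1)] by simp
  qed (use that in simp)
  show ?thesis
  proof (cases "C' \<in> descent_chains n S U")
    case True
    then show ?thesis using bC C' by simp
  next
    case False
    then obtain u where u: "u \<in> U" "\<not> chain_descent n S C' u"
      using C' unfolding descent_chains_def by auto
    show ?thesis
      by (rule kernel_step[OF S bK u(1) _ C'(1) u(2)]) (use u U above C' in auto)
  qed
qed

text \<open>Merging at \<open>s\<close> maps onto the kernel for \<open>S - {s}\<close>. A chain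
  \<open>D\<close> is refined to the chain \<open>ins D\<close> without a descent at
  \<open>s\<close>, which is the lightest refinement and keeps the descents at \<open>U\<close>. The
  matrix of the merged functions \<open>b (ins D)\<close> is therefore unitriangular and can be
  inverted. The lifts vanish at descent chains with a descent at \<open>s\<close>, since these
  differ from every \<open>ins D\<close>.\<close>

lemma dual_family_lift:
  assumes S: "finite S" "S \<subseteq> {..n}" and U: "U \<subseteq> S" and s: "s \<in> S" "s \<notin> U" and b: "dual_family n S U b"
  shows "\<exists>g. \<forall>D\<in>descent_chains n (S - {s}) U. g D \<in> kernel n S U \<and>
    (\<forall>C\<in>descent_chains n S (insert s U). g D C = 0) \<and>
    (\<forall>D'\<in>descent_chains n (S - {s}) U. merge n S s (g D) D' = of_bool (D' = D))"
proof -
  let ?I = "descent_chains n (S - {s}) U"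
  define ins where "ins D = (THE C. C \<in> chains n S \<and> C(s := {}) = D \<and> \<not> chain_descent n S C s)" for D
  have ins: "ins D \<in> chains n S" "(ins D)(s := {}) = D" "\<not> chain_descent n S (ins D) s" if "D \<in> ?I" for D
    using theI'[OF ex1_not_descent[of D n S s]] that S s unfolding ins_def descent_chains_def by auto
  have insD: "ins D \<in> descent_chains n S U" if D: "D \<in> ?I" for D
  proof -
    have "chain_descent n S (ins D) u" if u: "u \<in> U" for u
      using chain_descent_delete[OF ins(1)[OF D] s(1) _ _ ins(3)[OF D], of u] u U s D ins(2)[OF D]
      unfolding descent_chains_def by auto
    then show ?thesis using ins[OF D] by (simp add: descent_chains_def)
  qed
  define m where "m D D' = merge n S s (b (ins D)) D'" for D D'
  have bK: "b (ins D) \<in> kernel n S U" if "D \<in> ?I" for D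
    using b insD[OF that] unfolding dual_family_def by auto
  have term0: "b (ins D) C = 0"
    if D: "D \<in> ?I" "D' \<in> ?I" and C: "C \<in> chains n S" "C(s := {}) = D'" "C \<noteq> ins D"
      and w: "chain_weight S (ins D) \<le> chain_weight S (ins D')" for D D' C
  proof -
    have "chain_weight S (ins D') \<le> chain_weight S C"
    proof (cases "C = ins D'")
      case False
      then show ?thesis
        using not_descent_weight_less[OF S(1) ins(1)[OF D(2)] s(1) ins(3)[OF D(2)] C(1)] C(2) ins(2)[OF D(2)]
        by simp
    qed simp
    with w show ?thesis
      by (intro dual_family_triangular[OF S(1) U b insD[OF D(1)] C(1) C(3)]) simp
  qed
  have diag: "m D D = 1" if D: "D \<in> ?I" for D
  proof -
    let ?F = "{C \<in> chains n S. C(s := {}) = D}"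
    have "m D D = (\<Sum>C\<in>?F. b (ins D) C)" by (simp add: m_def merge_def)
    also have "\<dots> = b (ins D) (ins D) + (\<Sum>C\<in>?F - {ins D}. b (ins D) C)"
      using finite_chains[OF S(1)] ins[OF D] by (intro sum.remove) auto
    also have "(\<Sum>C\<in>?F - {ins D}. b (ins D) C) = 0"
      using term0[OF D D] by (intro sum.neutral) auto
    also have "b (ins D) (ins D) = 1" using b insD[OF D] unfolding dual_family_def by auto
    finally show ?thesis by simp
  qed
  have tri: "D = D' \<or> chain_weight S (ins D') < chain_weight S (ins D)"
    if D: "D \<in> ?I" "D' \<in> ?I" and ne: "m D D' \<noteq> 0" for D D'
  proof (rule ccontr)
    assume no: "\<not> ?thesis"
    have "m D D' = 0" unfolding m_def merge_def
    proof (rule sum.neutral, clarify)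
      fix C assume C: "C \<in> chains n S" "D' = C(s := {})"
      have "C \<noteq> ins D" using no C(2) ins(2)[OF D(1)] by auto
      then show "b (ins D) C = 0" using term0[OF D C(1)] C(2) no by auto
    qed
    with ne show False by contradiction
  qed
  have "\<exists>c. \<forall>D'\<in>?I. (\<Sum>D1\<in>?I. c D1 * m D1 D') = of_bool (D' = D)" for D
    using finite_descent_chains[of "S - {s}"] S(1) diag tri
    by (intro triangular_system_solvable[where w = "\<lambda>D. chain_weight S (ins D)"]) auto
  then obtain c where c: "\<And>D D'. D' \<in> ?I \<Longrightarrow> (\<Sum>D1\<in>?I. c D D1 * m D1 D') = of_bool (D' = D)"
    by metis
  define g where "g D = (\<lambda>C. \<Sum>D1\<in>?I. c D D1 * b (ins D1) C)" for D
  have finI: "finite ?I" using finite_descent_chains[of "S - {s}"] S(1) by simp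
  have "g D \<in> kernel n S U" for D
    unfolding g_def by (rule linear_space_sum[OF linear_space_kernel finI bK])
  moreover have "g D C = 0" if C: "C \<in> descent_chains n S (insert s U)" for D C
  proof -
    have "b (ins D1) C = 0" if "D1 \<in> ?I" for D1
    proof -
      have "C \<in> descent_chains n S U" "C \<noteq> ins D1"
        using C ins(3)[OF that] by (auto simp: descent_chains_def)
      then show ?thesis using b insD[OF that] unfolding dual_family_def by auto
    qed
    then show ?thesis unfolding g_def by (intro sum.neutral) auto
  qed
  moreover have "merge n S s (g D) D' = of_bool (D' = D)" if "D' \<in> ?I" for D D'
  proof -
    have "merge n S s (g D) D' = (\<Sum>D1\<in>?I. c D D1 * merge n S s (b (ins D1)) D')"
      unfolding g_def by (rule linear_form_sum[OF linear_space_kernel linear_form_merge finI bK])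
    then show ?thesis using c[OF that] by (simp add: m_def)
  qed
  ultimately show ?thesis by (intro exI[of _ g] ballI conjI)
qed

lemma descent_chains_insert_subset: "descent_chains n S (insert s U) \<subseteq> descent_chains n S U"
  unfolding descent_chains_def by auto

text \<open>Subtracting the lifts of the merged values leaves a function whose merge at
  \<open>s\<close> vanishes at all descent chains and hence, being in a kernel itself,
  everywhere.\<close>

lemma kernel_split:
  assumes S: "finite S" and U: "U \<subseteq> S" and s: "s \<in> S" "s \<notin> U"
    and b2: "dual_family n (S - {s}) U b2"
    and g: "\<And>D. D \<in> descent_chains n (S - {s}) U \<Longrightarrow> g D \<in> kernel n S U"
      "\<And>D D'. D \<in> descent_chains n (S - {s}) U \<Longrightarrow> D' \<in> descent_chains n (S - {s}) U \<Longrightarrow>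
        merge n S s (g D) D' = of_bool (D' = D)"
    and f: "f \<in> kernel n S U"
  shows "(\<lambda>C. f C - (\<Sum>D\<in>descent_chains n (S - {s}) U. merge n S s f D * g D C)) \<in> kernel n S (insert s U)"
    (is "?h \<in> _")
proof -
  let ?I = "descent_chains n (S - {s}) U"
  have finI: "finite ?I" using S by (intro finite_descent_chains) simp
  have U': "U \<subseteq> S - {s}" using U s by auto
  have eq: "?h = (\<lambda>C. f C + (\<lambda>C. (-1) * (\<lambda>C. \<Sum>D\<in>?I. merge n S s f D * g D C) C) C)" by simp
  have G: "(\<lambda>C. \<Sum>D\<in>?I. merge n S s f D * g D C) \<in> kernel n S U"
    by (rule linear_space_sum[OF linear_space_kernel finI g(1)])
  then have h: "?h \<in> kernel n S U"
    unfolding eq by (rule linear_spaceD(2)[OF linear_space_kernel f linear_spaceD(3)[OF linear_space_kernel]])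
  have "merge n S s ?h = (\<lambda>_. 0)"
  proof (rule kernel_eqI[OF _ U' merge_kernel[OF S s(2) h]])
    show "finite (S - {s})" using S by simp
    show "(\<lambda>_. 0) \<in> kernel n (S - {s}) U" by (rule linear_spaceD(1)[OF linear_space_kernel])
    fix D' assume D': "D' \<in> ?I"
    have "merge n S s ?h D' = merge n S s f D' - (\<Sum>D\<in>?I. merge n S s f D * merge n S s (g D) D')"
      unfolding eq merge_linear
      using linear_form_sum[OF linear_space_kernel linear_form_merge finI g(1), where c = "merge n S s f"]
      by simp
    also have "(\<Sum>D\<in>?I. merge n S s f D * merge n S s (g D) D') = (\<Sum>D\<in>?I. if D = D' then merge n S s f D' else 0)"
      using g(2) D' by (intro sum.cong refl) auto
    finally show "merge n S s ?h D' = 0" using D' finI by simp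
  qed
  then show ?thesis using h unfolding kernel_insert_iff by metis
qed

text \<open>The functions for \<open>U\<close> are projected to the smaller kernel by subtracting
  lifts; as these vanish at the descent chains for \<open>insert s U\<close>, the prescribed values
  survive.\<close>

lemma dual_family_exists:
  assumes "finite U" "finite S" "S \<subseteq> {..n}" "U \<subseteq> S"
  shows "\<exists>b. dual_family n S U b"
  using assms
proof (induction U arbitrary: S rule: finite_induct)
  case empty
  have "dual_family n S {} (\<lambda>C C'. of_bool (C' = C))"
    unfolding dual_family_def kernel_def descent_chains_def by auto
  then show ?case by blast
next
  case (insert s U)
  obtain b where b: "dual_family n S U b" using insert by blast
  have "S - {s} \<subseteq> {..n}" "U \<subseteq> S - {s}" "finite (S - {s})" using insert by auto
  then obtain b2 where b2: "dual_family n (S - {s}) U b2" using insert.IH by blast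
  let ?I = "descent_chains n (S - {s}) U"
  have US: "U \<subseteq> S" "s \<in> S" using insert by auto
  obtain g where g: "\<And>D. D \<in> ?I \<Longrightarrow> g D \<in> kernel n S U"
    "\<And>D C. D \<in> ?I \<Longrightarrow> C \<in> descent_chains n S (insert s U) \<Longrightarrow> g D C = 0"
    "\<And>D D'. D \<in> ?I \<Longrightarrow> D' \<in> ?I \<Longrightarrow> merge n S s (g D) D' = of_bool (D' = D)"
    using dual_family_lift[OF insert.prems(1,2) US insert.hyps(2) b] by blast
  define b1 where "b1 C = (\<lambda>C'. b C C' - (\<Sum>D\<in>?I. merge n S s (b C) D * g D C'))" for C
  have "dual_family n S (insert s U) b1"
    unfolding dual_family_def
  proof (intro ballI conjI)
    fix C assume C: "C \<in> descent_chains n S (insert s U)"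
    then have CU: "C \<in> descent_chains n S U" using descent_chains_insert_subset by blast
    then have bC: "b C \<in> kernel n S U" using b unfolding dual_family_def by blast
    show "b1 C \<in> kernel n S (insert s U)"
      unfolding b1_def by (rule kernel_split[OF insert.prems(1) US insert.hyps(2) b2 g(1,3) bC])
    fix C' assume C': "C' \<in> descent_chains n S (insert s U)"
    then have "C' \<in> descent_chains n S U" using descent_chains_insert_subset by blast
    then have "b C C' = of_bool (C' = C)" using b CU unfolding dual_family_def by blast
    moreover have "(\<Sum>D\<in>?I. merge n S s (b C) D * g D C') = 0" using g(2) C' by (intro sum.neutral) auto
    ultimately show "b1 C C' = of_bool (C' = C)" by (simp add: b1_def)
  qed
  then show ?case by blast
qed

lemma dual_family_some:
  assumes "finite S" "S \<subseteq> {..n}" "U \<subseteq> S"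
  shows "dual_family n S U (SOME b. dual_family n S U b)"
  by (rule someI_ex[of "dual_family n S U"], rule dual_family_exists) (use assms finite_subset in auto)

section \<open>The action of permutations on functions of chains\<close>

definition chain_act :: "(nat \<Rightarrow> nat) \<Rightarrow> ((nat \<Rightarrow> nat set) \<Rightarrow> complex) \<Rightarrow> (nat \<Rightarrow> nat set) \<Rightarrow> complex" where
  "chain_act \<pi> f = (\<lambda>C. f (\<lambda>s. inv \<pi> ` C s))"

lemma chains_image:
  assumes \<pi>: "\<pi> permutes {1..n}" and C: "C \<in> chains n S"
  shows "(\<lambda>s. \<pi> ` C s) \<in> chains n S"
proof -
  have "card (\<pi> ` C s) = card (C s)" for s
    using permutes_inj[OF \<pi>] by (intro card_image) (auto intro: inj_on_subset)
  moreover have "\<pi> ` C s \<subseteq> {1..n}" if "s \<in> S" for s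
    using chainsD(1)[OF C that] permutes_image[OF \<pi>] by blast
  ultimately show ?thesis
    using chainsD(2,4,6)[OF C] unfolding chains_def by (auto simp: image_mono)
qed

lemma chains_image_iff:
  assumes \<pi>: "\<pi> permutes {1..n}"
  shows "(\<lambda>s. \<pi> ` C s) \<in> chains n S \<longleftrightarrow> C \<in> chains n S"
proof
  assume "(\<lambda>s. \<pi> ` C s) \<in> chains n S"
  from chains_image[OF permutes_inv[OF \<pi>] this] show "C \<in> chains n S"
    by (simp add: image_image permutes_inverses[OF \<pi>])
qed (rule chains_image[OF \<pi>])

lemma merge_chain_act:
  assumes \<pi>: "\<pi> permutes {1..n}"
  shows "merge n S s (chain_act \<pi> f) = chain_act \<pi> (merge n S s f)"
proof
  fix D
  have inv1: "\<pi> ` inv \<pi> ` A = A" and inv2: "inv \<pi> ` \<pi> ` A = A" for A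
    using permutes_inverses[OF \<pi>] by (simp_all add: image_image)
  show "merge n S s (chain_act \<pi> f) D = chain_act \<pi> (merge n S s f) D"
    unfolding merge_def chain_act_def
  proof (rule sum.reindex_bij_witness[where i = "\<lambda>C s. \<pi> ` C s" and j = "\<lambda>C s. inv \<pi> ` C s"])
    fix C assume "C \<in> {C. C \<in> chains n S \<and> C(s := {}) = D}"
    then have C: "C \<in> chains n S" and D: "D = C(s := {})" by auto
    show "(\<lambda>s. inv \<pi> ` C s) \<in> {C. C \<in> chains n S \<and> C(s := {}) = (\<lambda>s. inv \<pi> ` D s)}"
      using chains_image[OF permutes_inv[OF \<pi>] C] unfolding D by (simp add: fun_eq_iff)
  next
    fix C assume C: "C \<in> {C. C \<in> chains n S \<and> C(s := {}) = (\<lambda>s. inv \<pi> ` D s)}"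
    have "D t = (if t = s then {} else \<pi> ` C t)" for t
    proof -
      have "(C(s := {})) t = inv \<pi> ` D t" using C by simp
      then have "\<pi> ` (C(s := {})) t = D t" using inv1 by simp
      then show ?thesis by (auto split: if_splits)
    qed
    then show "(\<lambda>s. \<pi> ` C s) \<in> {C. C \<in> chains n S \<and> C(s := {}) = D}"
      using C chains_image[OF \<pi>] by (auto simp: fun_eq_iff)
  qed (simp_all add: inv1 inv2)
qed

lemma chain_act_kernel:
  assumes \<pi>: "\<pi> permutes {1..n}" and f: "f \<in> kernel n S U"
  shows "chain_act \<pi> f \<in> kernel n S U"
proof -
  have "chain_act \<pi> f C = 0" if "C \<notin> chains n S" for C
    using that chains_image_iff[OF permutes_inv[OF \<pi>], of C S] kernelD(1)[OF f] by (simp add: chain_act_def)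
  moreover have "merge n S u (chain_act \<pi> f) D = 0" if "u \<in> U" for u D
    unfolding merge_chain_act[OF \<pi>] using kernelD(2)[OF f that] by (simp add: chain_act_def)
  ultimately show ?thesis unfolding kernel_def by simp
qed

lemma linear_form_chain_act: "linear_form V (\<lambda>f. chain_act \<pi> f x)"
  unfolding linear_form_def chain_act_def by simp

text \<open>The coordinate at \<open>C\<close> is the value at \<open>C\<close>, so this is the
  trace of \<open>\<pi>\<close> on the kernel; by \<open>trace_unique\<close> it does not depend on
  the chosen family.\<close>

definition kernel_trace :: "nat \<Rightarrow> nat set \<Rightarrow> nat set \<Rightarrow> (nat \<Rightarrow> nat) \<Rightarrow> complex" where
  "kernel_trace n S U \<pi> =
     (\<Sum>C\<in>descent_chains n S U. chain_act \<pi> ((SOME b. dual_family n S U b) C) C)"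

text \<open>The kernel for \<open>insert s U\<close> is annihilated by merging at \<open>s\<close>,
  and merging maps the kernel for \<open>U\<close> onto the one for \<open>S - {s}\<close>: traces
  add along this exact sequence. The second basis consists of \<open>b1\<close> and the lifts
  \<open>g\<close>, with evaluations and merged values as coordinates.\<close>

lemma kernel_trace_split:
  assumes S: "finite S" "S \<subseteq> {..n}" and U: "U \<subseteq> S" and s: "s \<in> S" "s \<notin> U" and \<pi>: "\<pi> permutes {1..n}"
  shows "kernel_trace n S U \<pi> = kernel_trace n S (insert s U) \<pi> + kernel_trace n (S - {s}) U \<pi>"
proof -
  let ?I = "descent_chains n (S - {s}) U" and ?J = "descent_chains n S (insert s U)"
  define b b1 b2 where "b = (SOME b. dual_family n S U b)" and "b1 = (SOME b. dual_family n S (insert s U) b)"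
    and "b2 = (SOME b. dual_family n (S - {s}) U b)"
  have finU: "finite U" using U S finite_subset by blast
  have b: "dual_family n S U b"
    unfolding b_def by (rule dual_family_some) (use S U finU in auto)
  have b1: "dual_family n S (insert s U) b1"
    unfolding b1_def by (rule dual_family_some) (use S U finU s in auto)
  have b2: "dual_family n (S - {s}) U b2"
    unfolding b2_def by (rule dual_family_some) (use S U finU s in auto)
  obtain g where g: "\<And>D. D \<in> ?I \<Longrightarrow> g D \<in> kernel n S U"
    "\<And>D C. D \<in> ?I \<Longrightarrow> C \<in> ?J \<Longrightarrow> g D C = 0"
    "\<And>D D'. D \<in> ?I \<Longrightarrow> D' \<in> ?I \<Longrightarrow> merge n S s (g D) D' = of_bool (D' = D)"
    using dual_family_lift[OF S U s b] by blast
  have finI: "finite ?I" and finJ: "finite ?J"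
    using S by (auto intro: finite_descent_chains)
  have sub: "kernel n S (insert s U) \<subseteq> kernel n S U" by (auto simp: kernel_insert_iff)
  have b1J: "b1 C \<in> kernel n S (insert s U)" if "C \<in> ?J" for C
    using b1 that unfolding dual_family_def by blast
  have b2I: "b2 D \<in> kernel n (S - {s}) U" if "D \<in> ?I" for D
    using b2 that unfolding dual_family_def by blast
  have U': "U \<subseteq> S - {s}" using U s by auto
  have mg: "merge n S s (g D) = b2 D" if "D \<in> ?I" for D
    using b2 that g(3) S(1) U'
    by (intro kernel_eqI[OF _ U' merge_kernel[OF S(1) s(2) g(1)] b2I]) (auto simp: dual_family_def)
  have expand: "f = (\<lambda>x. \<Sum>i\<in>?J <+> ?I. case_sum (\<lambda>C f. f C) (\<lambda>D f. merge n S s f D) i f * case_sum b1 g i x)"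
    if f: "f \<in> kernel n S U" for f
  proof
    fix x
    let ?h = "\<lambda>C. f C - (\<Sum>D\<in>?I. merge n S s f D * g D C)"
    have h: "?h \<in> kernel n S (insert s U)"
      by (rule kernel_split[OF S(1) U s b2 g(1,3) f])
    have "?h x = (\<Sum>C\<in>?J. ?h C * b1 C x)"
      using fun_cong[OF dual_family_expand[OF S(1) _ b1 h], of x] U s by blast
    also have "\<dots> = (\<Sum>C\<in>?J. f C * b1 C x)"
    proof (rule sum.cong[OF refl])
      fix C assume "C \<in> ?J"
      then have "(\<Sum>D\<in>?I. merge n S s f D * g D C) = 0" using g(2) by (intro sum.neutral) auto
      then show "?h C * b1 C x = f C * b1 C x" by simp
    qed
    finally show "f x = (\<Sum>i\<in>?J <+> ?I. case_sum (\<lambda>C f. f C) (\<lambda>D f. merge n S s f D) i f * case_sum b1 g i x)"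
      using finI finJ by (simp add: sum.Plus algebra_simps)
  qed
  have "(\<Sum>i\<in>?J <+> ?I. case_sum (\<lambda>C f. f C) (\<lambda>D f. merge n S s f D) i (chain_act \<pi> (case_sum b1 g i))) =
    (\<Sum>C\<in>descent_chains n S U. (\<lambda>f. f C) (chain_act \<pi> (b C)))"
  proof (rule trace_unique[OF linear_space_kernel[of n S U], where L = "chain_act \<pi>" and l = "case_sum (\<lambda>C f. f C) (\<lambda>D f. merge n S s f D)" and m = "\<lambda>C f. f C"])
    show "finite (?J <+> ?I)" using finI finJ by simp
    show "finite (descent_chains n S U)" using S by (intro finite_descent_chains)
    show "chain_act \<pi> f \<in> kernel n S U" if "f \<in> kernel n S U" for f
      using that by (rule chain_act_kernel[OF \<pi>])
    show "linear_form (kernel n S U) (\<lambda>f. chain_act \<pi> f x)" for x by (rule linear_form_chain_act)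
    show "case_sum b1 g i \<in> kernel n S U" if "i \<in> ?J <+> ?I" for i
      using that b1J g(1) sub by auto
    show "linear_form (kernel n S U) (case_sum (\<lambda>C f. f C) (\<lambda>D f. merge n S s f D) i)" for i
      by (cases i) (simp_all add: linear_form_apply linear_form_merge)
    show "b C \<in> kernel n S U" if "C \<in> descent_chains n S U" for C
      using b that unfolding dual_family_def by blast
    show "linear_form (kernel n S U) (\<lambda>f. f C)" for C by (rule linear_form_apply)
    show "f = (\<lambda>x. \<Sum>i\<in>?J <+> ?I. case_sum (\<lambda>C f. f C) (\<lambda>D f. merge n S s f D) i f * case_sum b1 g i x)"
      if "f \<in> kernel n S U" for f by (rule expand[OF that])
    show "f = (\<lambda>x. \<Sum>C\<in>descent_chains n S U. f C * b C x)" if "f \<in> kernel n S U" for f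
      by (rule dual_family_expand[OF S(1) U b that])
  qed
  moreover have "(\<Sum>i\<in>?J <+> ?I. case_sum (\<lambda>C f. f C) (\<lambda>D f. merge n S s f D) i (chain_act \<pi> (case_sum b1 g i))) =
     (\<Sum>C\<in>?J. chain_act \<pi> (b1 C) C) + (\<Sum>D\<in>?I. chain_act \<pi> (b2 D) D)"
    using finI finJ mg by (simp add: sum.Plus merge_chain_act[OF \<pi>])
  ultimately show ?thesis unfolding kernel_trace_def b_def[symmetric] b1_def[symmetric] b2_def[symmetric] by simp
qed

lemma kernel_trace_empty:
  assumes S: "finite S" "S \<subseteq> {..n}" and \<pi>: "\<pi> permutes {1..n}"
  shows "kernel_trace n S {} \<pi> = of_nat (card {C \<in> chains n S. (\<lambda>s. \<pi> ` C s) = C})"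
proof -
  define b where "b = (SOME b. dual_family n S {} b)"
  have b: "dual_family n S {} b"
    unfolding b_def by (rule dual_family_some) (use S in auto)
  have d: "descent_chains n S {} = chains n S" by (simp add: descent_chains_def)
  have inv1: "\<pi> ` inv \<pi> ` A = A" and inv2: "inv \<pi> ` \<pi> ` A = A" for A
    using permutes_inverses[OF \<pi>] by (simp_all add: image_image)
  have "chain_act \<pi> (b C) C = of_bool ((\<lambda>s. \<pi> ` C s) = C)" if C: "C \<in> chains n S" for C
  proof -
    have "chain_act \<pi> (b C) C = of_bool ((\<lambda>s. inv \<pi> ` C s) = C)"
      using b C chains_image[OF permutes_inv[OF \<pi>] C] unfolding dual_family_def d chain_act_def by blast
    also have "(\<lambda>s. inv \<pi> ` C s) = C \<longleftrightarrow> (\<lambda>s. \<pi> ` C s) = C"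
      unfolding fun_eq_iff by (metis inv1 inv2)
    finally show ?thesis .
  qed
  then have "kernel_trace n S {} \<pi> = (\<Sum>C\<in>chains n S. of_bool ((\<lambda>s. \<pi> ` C s) = C))"
    unfolding kernel_trace_def b_def[symmetric] d by (intro sum.cong) auto
  then show ?thesis using finite_chains[OF S(1)] by (simp add: Int_def)
qed

text \<open>Each split either adds \<open>s\<close> to \<open>U\<close> or removes it from
  \<open>S\<close>, until \<open>S = U\<close>; every \<open>T\<close> between \<open>U\<close> and
  \<open>S\<close> is reached exactly once. At \<open>U = {}\<close> the trace counts the fixed
  points of a permutation representation.\<close>

theorem card_fixed_chains:
  assumes S: "finite S" "S \<subseteq> {..n}" and \<pi>: "\<pi> permutes {1..n}"
  shows "of_nat (card {C \<in> chains n S. (\<lambda>s. \<pi> ` C s) = C}) = (\<Sum>T\<in>Pow S. kernel_trace n T T \<pi>)"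
proof -
  have "kernel_trace n S U \<pi> = (\<Sum>T | U \<subseteq> T \<and> T \<subseteq> S. kernel_trace n T T \<pi>)"
    if "U \<subseteq> S" "finite S" "S \<subseteq> {..n}" for U S
    using that
  proof (induction "card (S - U)" arbitrary: S U)
    case 0
    then have "S = U" by auto
    moreover have "{T. U \<subseteq> T \<and> T \<subseteq> U} = {U}" by auto
    ultimately show ?case by simp
  next
    case (Suc k)
    then obtain s where s: "s \<in> S" "s \<notin> U" by (metis DiffD1 DiffD2 card.empty ex_in_conv nat.distinct(1))
    have c: "card (S - insert s U) = k" "card ((S - {s}) - U) = k"
    proof -
      have "S - insert s U = (S - U) - {s}" "(S - {s}) - U = (S - U) - {s}" by auto
      moreover have "card ((S - U) - {s}) = k" using Suc.hyps(2) s Suc.prems by (simp add: card_Diff_singleton)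
      ultimately show "card (S - insert s U) = k" "card ((S - {s}) - U) = k" by simp_all
    qed
    have "kernel_trace n S U \<pi> = kernel_trace n S (insert s U) \<pi> + kernel_trace n (S - {s}) U \<pi>"
      by (rule kernel_trace_split) (use Suc.prems s \<pi> in auto)
    also have "kernel_trace n S (insert s U) \<pi> = (\<Sum>T | insert s U \<subseteq> T \<and> T \<subseteq> S. kernel_trace n T T \<pi>)"
      using Suc.hyps(1)[OF c(1)[symmetric]] Suc.prems s by blast
    also have "kernel_trace n (S - {s}) U \<pi> = (\<Sum>T | U \<subseteq> T \<and> T \<subseteq> S - {s}. kernel_trace n T T \<pi>)"
      by (rule Suc.hyps(1)[OF c(2)[symmetric]]) (use Suc.prems s in auto)
    also have "(\<Sum>T | insert s U \<subseteq> T \<and> T \<subseteq> S. kernel_trace n T T \<pi>) + (\<Sum>T | U \<subseteq> T \<and> T \<subseteq> S - {s}. kernel_trace n T T \<pi>)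
      = (\<Sum>T\<in>{T. insert s U \<subseteq> T \<and> T \<subseteq> S} \<union> {T. U \<subseteq> T \<and> T \<subseteq> S - {s}}. kernel_trace n T T \<pi>)"
      using Suc.prems by (intro sum.union_disjoint[symmetric]) (auto intro: finite_subset[of _ "Pow S"])
    also have "{T. insert s U \<subseteq> T \<and> T \<subseteq> S} \<union> {T. U \<subseteq> T \<and> T \<subseteq> S - {s}} = {T. U \<subseteq> T \<and> T \<subseteq> S}"
      using s by auto
    finally show ?case .
  qed
  from this[of "{}" S] have "kernel_trace n S {} \<pi> = (\<Sum>T\<in>Pow S. kernel_trace n T T \<pi>)"
    using S by (simp add: Pow_def)
  then show ?thesis using kernel_trace_empty[OF S \<pi>] by simp
qed

section \<open>Specht modules of ribbons\<close>

text \<open>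
  A border shape is a lattice path from its lowest to its highest row. The boxes are numbered along
  this path from \<open>0\<close> to \<open>n - 1\<close>; the path goes up between the boxes \<open>s - 1\<close> and \<open>s\<close> if \<open>s \<in> S\<close>, and to the
  right otherwise.
\<close>

definition steps :: "nat set \<Rightarrow> nat \<Rightarrow> nat" where
  "steps S p = card {s \<in> S. s \<le> p}"

definition box_at :: "nat set \<Rightarrow> nat \<Rightarrow> box" where
  "box_at S p = (card S - steps S p, p - steps S p)"

definition ribbon :: "nat \<Rightarrow> nat set \<Rightarrow> box set" where
  "ribbon n S = box_at S ` {..<n}"

lemma steps_le_card: "finite S \<Longrightarrow> steps S p \<le> card S"
  unfolding steps_def by (intro card_mono) auto

lemma steps_Suc: "finite S \<Longrightarrow> steps S (Suc p) = steps S p + of_bool (Suc p \<in> S)"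
proof -
  assume S: "finite S"
  have "{s \<in> S. s \<le> Suc p} = {s \<in> S. s \<le> p} \<union> (if Suc p \<in> S then {Suc p} else {})"
    by (auto simp: le_Suc_eq)
  then show ?thesis using S by (auto simp: steps_def card_insert_if)
qed

lemma steps_mono: "finite S \<Longrightarrow> p \<le> q \<Longrightarrow> steps S p \<le> steps S q"
  unfolding steps_def by (intro card_mono) auto

lemma steps_less_iff:
  assumes "finite S" "s \<in> S"
  shows "steps S p < steps S s \<longleftrightarrow> p < s"
proof
  assume "p < s"
  then have "s \<notin> {t \<in> S. t \<le> p}" "s \<in> {t \<in> S. t \<le> s}" "{t \<in> S. t \<le> p} \<subseteq> {t \<in> S. t \<le> s}"
    using assms by auto
  then have "{t \<in> S. t \<le> p} \<subset> {t \<in> S. t \<le> s}" by blast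
  then show "steps S p < steps S s" unfolding steps_def using assms by (intro psubset_card_mono) auto
qed (use steps_mono[OF assms(1)] in \<open>metis not_le\<close>)

lemma steps_le: "S \<subseteq> {1..} \<Longrightarrow> steps S p \<le> p"
proof -
  assume "S \<subseteq> {1..}"
  then have "steps S p \<le> card {1..p}" unfolding steps_def by (intro card_mono) auto
  then show ?thesis by simp
qed

definition column :: "nat set \<Rightarrow> nat \<Rightarrow> nat" where
  "column S p = p - steps S p"

lemma column_Suc:
  assumes "finite S" "S \<subseteq> {1..}"
  shows "column S (Suc p) = column S p + of_bool (Suc p \<notin> S)"
  using steps_Suc[OF assms(1), of p] steps_le[OF assms(2), of p] by (auto simp: column_def)

lemma column_mono:
  assumes "finite S" "S \<subseteq> {1..}" "p \<le> q"
  shows "column S p \<le> column S q"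
  using assms(3) by (induction rule: dec_induct) (auto simp: column_Suc[OF assms(1,2)])

text \<open>The column never decreases along the path, so two boxes in one column are joined by
  upward steps only.\<close>

lemma column_eqD:
  assumes S: "finite S" "S \<subseteq> {1..}" and "column S p = column S q" and r: "p < r" "r \<le> q"
  shows "r \<in> S" "column S r = column S q"
proof -
  obtain r' where r': "r = Suc r'" using r by (cases r) auto
  have "column S p \<le> column S r'" "column S r' \<le> column S r" "column S r \<le> column S q"
    using r r' by (auto intro!: column_mono[OF S])
  then have "column S r' = column S r" and q: "column S r = column S q" using assms(3) by auto
  then show "r \<in> S" using column_Suc[OF S, of r'] r' by (auto split: if_splits)
  show "column S r = column S q" by (rule q)
qed

lemma box_at_inj:
  assumes "finite S" "S \<subseteq> {1..}"
  shows "inj (box_at S)"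
proof (rule injI)
  fix p q assume "box_at S p = box_at S q"
  then show "p = q"
    using steps_le_card[OF assms(1)] steps_le[OF assms(2)] unfolding box_at_def
    by (metis diff_diff_cancel fst_conv le_add_diff_inverse snd_conv)
qed

section \<open>Chains as tabloids of a ribbon\<close>

definition word_chain :: "nat set \<Rightarrow> (nat \<Rightarrow> nat) \<Rightarrow> nat \<Rightarrow> nat set" where
  "word_chain S w s = (if s \<in> S then w ` {..<s} else {})"

text \<open>The number of \<open>s\<close> with \<open>a \<notin> C s\<close> is the index of the
  block of \<open>a\<close>. The path starts in the lowest row, so blocks are counted against the
  row numbers.\<close>

definition chain_tabloid :: "nat \<Rightarrow> nat set \<Rightarrow> (nat \<Rightarrow> nat set) \<Rightarrow> nat \<Rightarrow> nat set" where
  "chain_tabloid n S C r = {a \<in> {1..n}. card S - card {s \<in> S. a \<notin> C s} = r}"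

lemma word_chain_chains:
  assumes w: "bij_betw w {..<n} {1..n}" and S: "S \<subseteq> {..n}"
  shows "word_chain S w \<in> chains n S"
proof -
  have "card (w ` {..<s}) = s" "w ` {..<s} \<subseteq> {1..n}" if "s \<in> S" for s
  proof -
    have sub: "{..<s} \<subseteq> {..<n}" using that S by auto
    then have "inj_on w {..<s}" using w inj_on_subset unfolding bij_betw_def by blast
    then show "card (w ` {..<s}) = s" by (simp add: card_image)
    show "w ` {..<s} \<subseteq> {1..n}" using image_mono[OF sub, of w] w by (simp only: bij_betw_def)
  qed
  then show ?thesis unfolding chains_def word_chain_def by auto
qed

lemma tabloid_ribbon:
  assumes w: "bij_betw (\<lambda>p. T (box_at S p)) {..<n} {1..n}" and S: "S \<subseteq> {1..<n}"
  shows "tabloid (ribbon n S) T = chain_tabloid n S (word_chain S (\<lambda>p. T (box_at S p)))"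
proof
  fix r
  let ?w = "\<lambda>p. T (box_at S p)"
  have rank: "card {s \<in> S. ?w p \<notin> word_chain S ?w s} = steps S p" if p: "p < n" for p
  proof -
    have "?w p \<in> ?w ` {..<s} \<longleftrightarrow> p < s" if "s \<in> S" for s
      using inj_on_image_mem_iff[of ?w "{..<n}" p "{..<s}"] w p S that unfolding bij_betw_def by auto
    then have "{s \<in> S. ?w p \<notin> word_chain S ?w s} = {s \<in> S. s \<le> p}"
      by (auto simp: word_chain_def not_less)
    then show ?thesis by (simp add: steps_def)
  qed
  have "tabloid (ribbon n S) T r = ?w ` {p \<in> {..<n}. card S - steps S p = r}"
    unfolding tabloid_def ribbon_def by (auto simp: box_at_def)
  also have "\<dots> = {a \<in> ?w ` {..<n}. card S - card {s \<in> S. a \<notin> word_chain S ?w s} = r}"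
    using rank by auto
  also have "?w ` {..<n} = {1..n}" using w by (simp add: bij_betw_def)
  finally show "tabloid (ribbon n S) T r = chain_tabloid n S (word_chain S ?w) r"
    by (simp add: chain_tabloid_def)
qed

text \<open>The members grow with \<open>s\<close>, so those that miss \<open>a\<close> come from an
  initial segment of \<open>S\<close>, and their number tells which.\<close>

lemma chain_mem_iff:
  assumes C: "C \<in> chains n S" and S: "finite S" and s: "s \<in> S"
  shows "a \<in> C s \<longleftrightarrow> card {t \<in> S. a \<notin> C t} < steps S s"
proof
  assume a: "a \<in> C s"
  have "{t \<in> S. a \<notin> C t} \<subseteq> {t \<in> S. t < s}"
    using a chainsD(5)[OF C s] by (auto simp: not_less) (metis not_less subsetD)
  then have "card {t \<in> S. a \<notin> C t} \<le> card {t \<in> S. t < s}" using S by (intro card_mono) auto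
  also have "\<dots> < steps S s" unfolding steps_def using S s by (intro psubset_card_mono) auto
  finally show "card {t \<in> S. a \<notin> C t} < steps S s" .
next
  assume less: "card {t \<in> S. a \<notin> C t} < steps S s"
  show "a \<in> C s"
  proof (rule ccontr)
    assume a: "a \<notin> C s"
    have "{t \<in> S. t \<le> s} \<subseteq> {t \<in> S. a \<notin> C t}"
      using a chainsD(5)[OF C _ s] by blast
    then have "steps S s \<le> card {t \<in> S. a \<notin> C t}" unfolding steps_def using S by (intro card_mono) auto
    with less show False by simp
  qed
qed

lemma chain_tabloid_inj:
  assumes S: "finite S" and C: "C \<in> chains n S" and C': "C' \<in> chains n S"
    and eq: "chain_tabloid n S C = chain_tabloid n S C'"
  shows "C = C'"
proof
  fix s
  show "C s = C' s"
  proof (cases "s \<in> S")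
    case True
    have rank: "card {t \<in> S. a \<notin> C t} = card {t \<in> S. a \<notin> C' t}" if a: "a \<in> {1..n}" for a
    proof -
      have "a \<in> chain_tabloid n S C (card S - card {t \<in> S. a \<notin> C t})" using a by (simp add: chain_tabloid_def)
      then have "a \<in> chain_tabloid n S C' (card S - card {t \<in> S. a \<notin> C t})" using eq by simp
      then have "card S - card {t \<in> S. a \<notin> C' t} = card S - card {t \<in> S. a \<notin> C t}" by (simp add: chain_tabloid_def)
      moreover have "card {t \<in> S. a \<notin> C t} \<le> card S" "card {t \<in> S. a \<notin> C' t} \<le> card S"
        using S by (auto intro: card_mono)
      ultimately show ?thesis by simp
    qed
    have "a \<in> C s \<longleftrightarrow> a \<in> C' s" if "a \<in> {1..n}" for a
      using chain_mem_iff[OF C S True] chain_mem_iff[OF C' S True] rank[OF that] by simp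
    then show ?thesis using chainsD(1)[OF C True] chainsD(1)[OF C' True] by blast
  next
    case False
    then show ?thesis using chainsD(6)[OF C] chainsD(6)[OF C'] by simp
  qed
qed

lemma chain_tabloid_image:
  assumes \<pi>: "\<pi> permutes {1..n}"
  shows "chain_tabloid n S (\<lambda>s. \<pi> ` C s) = (\<lambda>r. \<pi> ` chain_tabloid n S C r)"
proof
  fix r
  have mem: "\<pi> a \<in> \<pi> ` A \<longleftrightarrow> a \<in> A" for a A using permutes_inj[OF \<pi>] by (simp add: inj_image_mem_iff)
  have "\<pi> ` chain_tabloid n S C r = {b \<in> \<pi> ` {1..n}. card S - card {s \<in> S. b \<notin> \<pi> ` C s} = r}"
    unfolding chain_tabloid_def by (auto simp: mem)
  also have "\<pi> ` {1..n} = {1..n}" by (rule permutes_image[OF \<pi>])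
  finally show "chain_tabloid n S (\<lambda>s. \<pi> ` C s) r = \<pi> ` chain_tabloid n S C r"
    by (simp add: chain_tabloid_def)
qed

text \<open>Transport along the injection \<open>chain_tabloid\<close>, extended by 0 to everything
  that is not the tabloid of a chain.\<close>

definition tabloid_fun :: "nat \<Rightarrow> nat set \<Rightarrow> ((nat \<Rightarrow> nat set) \<Rightarrow> complex) \<Rightarrow> (nat \<Rightarrow> nat set) \<Rightarrow> complex" where
  "tabloid_fun n S g X = (\<Sum>C\<in>chains n S. g C * of_bool (chain_tabloid n S C = X))"

lemma tabloid_fun_tabloid:
  assumes S: "finite S" and C: "C \<in> chains n S"
  shows "tabloid_fun n S g (chain_tabloid n S C) = g C"
proof -
  have "tabloid_fun n S g (chain_tabloid n S C) = (\<Sum>C'\<in>chains n S. if C' = C then g C else 0)"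
    unfolding tabloid_fun_def using chain_tabloid_inj[OF S _ C] by (intro sum.cong refl) auto
  then show ?thesis using C finite_chains[OF S] by simp
qed

lemma tabloid_fun_eq_0:
  assumes "X \<notin> chain_tabloid n S ` chains n S"
  shows "tabloid_fun n S g X = 0"
  unfolding tabloid_fun_def using assms by (intro sum.neutral) auto

lemma tabloid_fun_linear:
  "tabloid_fun n S (\<lambda>C. f C + g C) X = tabloid_fun n S f X + tabloid_fun n S g X"
  "tabloid_fun n S (\<lambda>C. c * f C) X = c * tabloid_fun n S f X"
  unfolding tabloid_fun_def by (simp_all add: sum.distrib sum_distrib_left algebra_simps)

lemma tabloid_action_fun:
  assumes S: "finite S" and \<pi>: "\<pi> permutes {1..n}"
  shows "tabloid_action \<pi> (tabloid_fun n S g) = tabloid_fun n S (chain_act \<pi> g)"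
proof
  fix X
  have inv1: "\<pi> ` inv \<pi> ` A = A" for A
    using permutes_inverses[OF \<pi>] by (simp add: image_image)
  show "tabloid_action \<pi> (tabloid_fun n S g) X = tabloid_fun n S (chain_act \<pi> g) X"
  proof (cases "X \<in> chain_tabloid n S ` chains n S")
    case True
    then obtain C where C: "C \<in> chains n S" "X = chain_tabloid n S C" by blast
    have "tabloid_action \<pi> (tabloid_fun n S g) X = tabloid_fun n S g (chain_tabloid n S (\<lambda>s. inv \<pi> ` C s))"
      unfolding tabloid_action_def C(2) chain_tabloid_image[OF permutes_inv[OF \<pi>]] ..
    also have "\<dots> = g (\<lambda>s. inv \<pi> ` C s)"
      by (rule tabloid_fun_tabloid[OF S chains_image[OF permutes_inv[OF \<pi>] C(1)]])
    also have "\<dots> = tabloid_fun n S (chain_act \<pi> g) X"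
      unfolding C(2) tabloid_fun_tabloid[OF S C(1)] chain_act_def ..
    finally show ?thesis .
  next
    case False
    have "(\<lambda>r. inv \<pi> ` X r) \<notin> chain_tabloid n S ` chains n S"
    proof
      assume "(\<lambda>r. inv \<pi> ` X r) \<in> chain_tabloid n S ` chains n S"
      then obtain C where C: "C \<in> chains n S" "(\<lambda>r. inv \<pi> ` X r) = chain_tabloid n S C" by blast
      have "X = (\<lambda>r. \<pi> ` chain_tabloid n S C r)" unfolding C(2)[symmetric] inv1 ..
      then have "X = chain_tabloid n S (\<lambda>s. \<pi> ` C s)" unfolding chain_tabloid_image[OF \<pi>] .
      then show False using False chains_image[OF \<pi> C(1)] by blast
    qed
    then show ?thesis using False by (simp add: tabloid_action_def tabloid_fun_eq_0)
  qed
qed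

section \<open>Polytabloids in terms of chains\<close>

definition chain_polytabloid :: "nat \<Rightarrow> nat set \<Rightarrow> (box \<Rightarrow> nat) \<Rightarrow> (nat \<Rightarrow> nat set) \<Rightarrow> complex" where
  "chain_polytabloid n S T C = (\<Sum>\<kappa>\<in>column_stabilizer n (ribbon n S) T.
     of_int (sign \<kappa>) * of_bool (word_chain S (\<lambda>p. \<kappa> (T (box_at S p))) = C))"

lemma finite_column_stabilizer: "finite (column_stabilizer n D T)"
  unfolding column_stabilizer_def Sym_def by (simp add: finite_permutations)

lemma tableaux_word:
  assumes "S \<subseteq> {1..<n}"
  shows "T \<in> tableaux n (ribbon n S) \<longleftrightarrow> bij_betw (\<lambda>p. T (box_at S p)) {..<n} {1..n}"
proof -
  have "finite S" "S \<subseteq> {1..}" using assms finite_subset by auto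
  then have "inj_on (box_at S) {..<n}" using box_at_inj by (metis inj_on_subset subset_UNIV)
  then have b: "bij_betw (box_at S) {..<n} (ribbon n S)" by (simp add: ribbon_def bij_betw_def)
  show ?thesis unfolding tableaux_def mem_Collect_eq
    using bij_betw_comp_iff[OF b, of T "{1..n}"] by (simp add: comp_def)
qed

lemma word_permute:
  assumes "bij_betw w {..<n} {1..n}" "\<kappa> permutes {1..n}"
  shows "bij_betw (\<lambda>p. \<kappa> (w p)) {..<n} {1..n}"
  using bij_betw_trans[OF assms(1) permutes_imp_bij[OF assms(2)]] by (simp add: comp_def)

lemma polytabloid_eq:
  assumes S: "S \<subseteq> {1..<n}" and T: "T \<in> tableaux n (ribbon n S)"
  shows "polytabloid n (ribbon n S) T = tabloid_fun n S (chain_polytabloid n S T)"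
proof
  fix X
  have fin: "finite S" using S finite_subset by blast
  let ?W = "\<lambda>\<kappa>. word_chain S (\<lambda>p. \<kappa> (T (box_at S p)))"
  have w: "bij_betw (\<lambda>p. T (box_at S p)) {..<n} {1..n}" using T tableaux_word[OF S] by simp
  have k: "?W \<kappa> \<in> chains n S" "tabloid (ribbon n S) (\<kappa> \<circ> T) = chain_tabloid n S (?W \<kappa>)"
    if "\<kappa> \<in> column_stabilizer n (ribbon n S) T" for \<kappa>
  proof -
    have b: "bij_betw (\<lambda>p. \<kappa> (T (box_at S p))) {..<n} {1..n}"
      using that by (intro word_permute[OF w]) (simp add: column_stabilizer_def Sym_def)
    show "?W \<kappa> \<in> chains n S" by (rule word_chain_chains[OF b]) (use S in auto)
    show "tabloid (ribbon n S) (\<kappa> \<circ> T) = chain_tabloid n S (?W \<kappa>)"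
      using tabloid_ribbon[of "\<kappa> \<circ> T" S n] b S by (simp add: comp_def)
  qed
  have "tabloid_fun n S (chain_polytabloid n S T) X =
    (\<Sum>\<kappa>\<in>column_stabilizer n (ribbon n S) T. \<Sum>C\<in>chains n S.
       of_int (sign \<kappa>) * of_bool (?W \<kappa> = C) * of_bool (chain_tabloid n S C = X))"
    unfolding tabloid_fun_def chain_polytabloid_def sum_distrib_right by (rule sum.swap)
  also have "\<dots> = (\<Sum>\<kappa>\<in>column_stabilizer n (ribbon n S) T. of_int (sign \<kappa>) * of_bool (tabloid (ribbon n S) (\<kappa> \<circ> T) = X))"
  proof (rule sum.cong[OF refl])
    fix \<kappa> assume \<kappa>: "\<kappa> \<in> column_stabilizer n (ribbon n S) T"
    have "(\<Sum>C\<in>chains n S. of_int (sign \<kappa>) * of_bool (?W \<kappa> = C) * of_bool (chain_tabloid n S C = X)) =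
      (\<Sum>C\<in>chains n S. if C = ?W \<kappa> then of_int (sign \<kappa>) * of_bool (chain_tabloid n S (?W \<kappa>) = X) else (0 :: complex))"
      by (intro sum.cong refl) auto
    then show "(\<Sum>C\<in>chains n S. of_int (sign \<kappa>) * of_bool (?W \<kappa> = C) * of_bool (chain_tabloid n S C = X)) =
      (of_int (sign \<kappa>) * of_bool (tabloid (ribbon n S) (\<kappa> \<circ> T) = X) :: complex)"
      using k[OF \<kappa>] finite_chains[OF fin] by simp
  qed
  finally show "polytabloid n (ribbon n S) T X = tabloid_fun n S (chain_polytabloid n S T) X"
    unfolding polytabloid_def of_bool_def by (rule sym)
qed

text \<open>For \<open>u \<in> S\<close> the boxes \<open>u - 1\<close> and \<open>u\<close> lie in
  one column, so the transposition of their entries is in the column stabilizer. Composing with it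
  flips the sign and affects the chain at \<open>u\<close> only, so after merging at
  \<open>u\<close> the terms cancel in pairs.\<close>

lemma chain_polytabloid_kernel:
  assumes S: "S \<subseteq> {1..<n}" and T: "T \<in> tableaux n (ribbon n S)"
  shows "chain_polytabloid n S T \<in> kernel n S S"
proof -
  have fin: "finite S" "S \<subseteq> {1..}" using S finite_subset by auto
  define w where "w p = T (box_at S p)" for p
  have w: "bij_betw w {..<n} {1..n}" unfolding w_def using T tableaux_word[OF S] by simp
  let ?CS = "column_stabilizer n (ribbon n S) T"
  have e: "chain_polytabloid n S T C = (\<Sum>\<kappa>\<in>?CS. of_int (sign \<kappa>) * of_bool (word_chain S (\<lambda>p. \<kappa> (w p)) = C))" for C
    unfolding chain_polytabloid_def w_def ..
  have Sym: "\<kappa> permutes {1..n}" if "\<kappa> \<in> ?CS" for \<kappa> using that by (simp add: column_stabilizer_def Sym_def)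
  have Wc: "word_chain S (\<lambda>p. \<kappa> (w p)) \<in> chains n S" if "\<kappa> \<in> ?CS" for \<kappa>
    by (rule word_chain_chains[OF word_permute[OF w Sym[OF that]]]) (use S in auto)
  have "chain_polytabloid n S T C = 0" if "C \<notin> chains n S" for C
    unfolding e using that Wc by (intro sum.neutral) auto
  moreover have "merge n S u (chain_polytabloid n S T) D = 0" if u: "u \<in> S" for u D
  proof -
    obtain v where v: "u = Suc v" using u fin(2) by (cases u) auto
    have vn: "v < n" "u < n" using u S v by auto
    let ?\<tau> = "Transposition.transpose (w v) (w u)"
    have ne: "w v \<noteq> w u" using inj_onD[of w "{..<n}" v u] w vn v by (auto simp: bij_betw_def)
    have \<tau>: "?\<tau> permutes {1..n}"
      using w vn unfolding bij_betw_def by (intro permutes_swap_id) auto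
    define F where "F \<kappa> = (of_int (sign \<kappa>) * of_bool ((word_chain S (\<lambda>p. \<kappa> (w p)))(u := {}) = D) :: complex)" for \<kappa>
    have merge: "merge n S u (chain_polytabloid n S T) D = (\<Sum>\<kappa>\<in>?CS. F \<kappa>)"
    proof -
      have "merge n S u (chain_polytabloid n S T) D =
        (\<Sum>\<kappa>\<in>?CS. \<Sum>C | C \<in> chains n S \<and> C(u := {}) = D. of_int (sign \<kappa>) * of_bool (word_chain S (\<lambda>p. \<kappa> (w p)) = C))"
        unfolding merge_def e by (rule sum.swap)
      also have "\<dots> = (\<Sum>\<kappa>\<in>?CS. F \<kappa>)"
      proof (rule sum.cong[OF refl])
        fix \<kappa> assume \<kappa>: "\<kappa> \<in> ?CS"
        let ?W = "word_chain S (\<lambda>p. \<kappa> (w p))"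
        have "(\<Sum>C | C \<in> chains n S \<and> C(u := {}) = D. of_int (sign \<kappa>) * of_bool (?W = C)) =
          (\<Sum>C | C \<in> chains n S \<and> C(u := {}) = D. if C = ?W then of_int (sign \<kappa>) else (0 :: complex))"
          by (intro sum.cong refl) auto
        also have "\<dots> = F \<kappa>" unfolding F_def using finite_chains[OF fin(1), of n] Wc[OF \<kappa>] by simp
        finally show "(\<Sum>C | C \<in> chains n S \<and> C(u := {}) = D. of_int (sign \<kappa>) * of_bool (?W = C)) = F \<kappa>" .
      qed
      finally show ?thesis .
    qed
    have col: "snd (box_at S v) = snd (box_at S u)"
      using column_Suc[OF fin, of v] u v by (simp add: box_at_def column_def)
    have closed: "\<kappa> \<circ> ?\<tau> \<in> ?CS" if \<kappa>: "\<kappa> \<in> ?CS" for \<kappa>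
    proof -
      have "\<exists>y\<in>ribbon n S. snd y = snd x \<and> (\<kappa> \<circ> ?\<tau>) (T x) = T y" if x: "x \<in> ribbon n S" for x
      proof -
        have "\<exists>z\<in>ribbon n S. snd z = snd x \<and> ?\<tau> (T x) = T z"
        proof -
          consider "T x = w v" | "T x = w u" | "T x \<noteq> w v" "T x \<noteq> w u" by blast
          then show ?thesis
          proof cases
            case 1
            then have "x = box_at S v"
              using x T vn unfolding w_def tableaux_def ribbon_def bij_betw_def inj_on_def by blast
            then show ?thesis using 1 col vn by (intro bexI[of _ "box_at S u"]) (auto simp: w_def ribbon_def)
          next
            case 2
            then have "x = box_at S u"
              using x T vn unfolding w_def tableaux_def ribbon_def bij_betw_def inj_on_def by blast
            then show ?thesis using 2 col vn by (intro bexI[of _ "box_at S v"]) (auto simp: w_def ribbon_def)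
          next
            case 3
            then show ?thesis using x by (intro bexI[of _ x]) auto
          qed
        qed
        then obtain z where z: "z \<in> ribbon n S" "snd z = snd x" "?\<tau> (T x) = T z" by blast
        then obtain y where "y \<in> ribbon n S" "snd y = snd z" "\<kappa> (T z) = T y"
          using \<kappa> unfolding column_stabilizer_def by blast
        then show ?thesis using z by (intro bexI[of _ y]) auto
      qed
      then show ?thesis
        using permutes_compose[OF \<tau> Sym[OF \<kappa>]] unfolding column_stabilizer_def Sym_def by blast
    qed
    have flip: "F (\<kappa> \<circ> ?\<tau>) = - F \<kappa>" if \<kappa>: "\<kappa> \<in> ?CS" for \<kappa>
    proof -
      have "sign (\<kappa> \<circ> ?\<tau>) = - sign \<kappa>"
        using Sym[OF \<kappa>] \<tau> ne by (subst sign_compose) (auto simp: sign_swap_id intro: permutes_imp_permutation)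
      moreover have "(word_chain S (\<lambda>p. (\<kappa> \<circ> ?\<tau>) (w p)))(u := {}) = (word_chain S (\<lambda>p. \<kappa> (w p)))(u := {})"
      proof
        fix s
        have "(\<lambda>p. ?\<tau> (w p)) ` {..<s} = w ` {..<s}" if "s \<noteq> u" "s \<in> S"
        proof -
          have sub: "{..<s} \<subseteq> {..<n}" using S that by auto
          have "w x \<in> w ` {..<s} \<longleftrightarrow> x < s" if "x < n" for x
            using inj_on_image_mem_iff[OF _ _ sub, of w x] w that by (simp add: bij_betw_def)
          then have "w v \<in> w ` {..<s} \<longleftrightarrow> v < s" "w u \<in> w ` {..<s} \<longleftrightarrow> u < s" using vn by blast+
          then have "w v \<in> w ` {..<s} \<longleftrightarrow> w u \<in> w ` {..<s}" using that v by auto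
          then have "?\<tau> ` w ` {..<s} = w ` {..<s}" by (rule transpose_image_eq)
          then show ?thesis by (simp add: image_image)
        qed
        then have "(\<lambda>p. \<kappa> (?\<tau> (w p))) ` {..<s} = (\<lambda>p. \<kappa> (w p)) ` {..<s}" if "s \<noteq> u" "s \<in> S"
          using that by (metis image_image)
        then show "((word_chain S (\<lambda>p. (\<kappa> \<circ> ?\<tau>) (w p)))(u := {})) s = ((word_chain S (\<lambda>p. \<kappa> (w p)))(u := {})) s"
          by (simp add: word_chain_def)
      qed
      ultimately show ?thesis unfolding F_def by simp
    qed
    have "(\<Sum>\<kappa>\<in>?CS. F \<kappa>) = (\<Sum>\<kappa>\<in>?CS. F (\<kappa> \<circ> ?\<tau>))"
      by (rule sum.reindex_bij_witness[where i = "\<lambda>\<kappa>. \<kappa> \<circ> ?\<tau>" and j = "\<lambda>\<kappa>. \<kappa> \<circ> ?\<tau>"])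
         (simp_all only: closed comp_assoc transpose_comp_involutory comp_id)
    also have "\<dots> = - (\<Sum>\<kappa>\<in>?CS. F \<kappa>)" using flip by (simp add: sum_negf)
    finally have "(\<Sum>\<kappa>\<in>?CS. F \<kappa>) = 0" by simp
    then show ?thesis unfolding merge .
  qed
  ultimately show ?thesis unfolding kernel_def by blast
qed

text \<open>The word of \<open>C\<close> lists the blocks of \<open>C\<close> one after the other, each in increasing order.\<close>

lemma chain_word_exists:
  assumes S: "S \<subseteq> {1..<n}" and C: "C \<in> descent_chains n S S"
  obtains w where "bij_betw w {..<n} {1..n}" "word_chain S w = C" "\<And>s. s \<in> S \<Longrightarrow> w s < w (s - 1)"
proof -
  have fin: "finite S" using S finite_subset by blast
  have Cc: "C \<in> chains n S" and desc: "\<And>s. s \<in> S \<Longrightarrow> chain_descent n S C s"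
    using C by (auto simp: descent_chains_def)
  define rk where "rk a = card {t \<in> S. a \<notin> C t}" for a
  \<comment> \<open>A key for the lexicographic order by block and then by value: the factor
    \<open>n + 1\<close> exceeds every entry. The position in the word is the number of smaller
    keys.\<close>
  define k where "k a = rk a * (n + 1) + a" for a
  define pos where "pos a = card {a' \<in> {1..n}. k a' < k a}" for a
  have mem: "a \<in> C s \<longleftrightarrow> rk a < steps S s" if "s \<in> S" for a s
    unfolding rk_def by (rule chain_mem_iff[OF Cc fin that])
  have k_less: "k a < k b" if "rk a < rk b" "a \<le> n" for a b
  proof -
    have "k a < Suc (rk a) * (n + 1)" using that(2) by (simp add: k_def)
    also have "\<dots> \<le> rk b * (n + 1)" using that(1) by (intro mult_le_mono1) simp
    finally show ?thesis by (simp add: k_def)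
  qed
  have k_inj: "a = b" if "k a = k b" "a \<in> {1..n}" "b \<in> {1..n}" for a b
  proof -
    have "\<not> rk a < rk b" "\<not> rk b < rk a" using k_less[of a b] k_less[of b a] that by auto
    then show ?thesis using that(1) by (simp add: k_def)
  qed
  have pos_mono: "pos a < pos b" if "k a < k b" "a \<in> {1..n}" for a b
  proof -
    have "a \<notin> {a' \<in> {1..n}. k a' < k a}" "a \<in> {a' \<in> {1..n}. k a' < k b}"
      "{a' \<in> {1..n}. k a' < k a} \<subseteq> {a' \<in> {1..n}. k a' < k b}" using that by auto
    then show ?thesis unfolding pos_def by (intro psubset_card_mono) auto
  qed
  have inj: "inj_on pos {1..n}"
  proof (rule inj_onI)
    fix a b assume ab: "a \<in> {1..n}" "b \<in> {1..n}" "pos a = pos b"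
    then have "k a = k b" using pos_mono[of a b] pos_mono[of b a] by (metis less_irrefl linorder_neqE_nat)
    then show "a = b" using k_inj ab by blast
  qed
  have pos_less: "pos a < n" if "a \<in> {1..n}" for a
  proof -
    have "{a' \<in> {1..n}. k a' < k a} \<subseteq> {1..n} - {a}" by auto
    then have "pos a \<le> card ({1..n} - {a})" unfolding pos_def by (intro card_mono) auto
    then show ?thesis using that by (cases n) auto
  qed
  have bij: "bij_betw pos {1..n} {..<n}"
  proof -
    have "pos ` {1..n} \<subseteq> {..<n}" using pos_less by auto
    moreover have "card (pos ` {1..n}) = card {..<n}" using inj by (simp add: card_image)
    ultimately have "pos ` {1..n} = {..<n}" by (intro card_subset_eq) auto
    then show ?thesis using inj by (simp add: bij_betw_def)
  qed
  have pos_mem: "a \<in> C s \<longleftrightarrow> pos a < s" if s: "s \<in> S" and a: "a \<in> {1..n}" for a s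
  proof
    assume aC: "a \<in> C s"
    have "{a' \<in> {1..n}. k a' < k a} \<subseteq> C s - {a}"
    proof
      fix a' assume a': "a' \<in> {a' \<in> {1..n}. k a' < k a}"
      then have "\<not> rk a < rk a'" using k_less[of a a'] a by auto
      then show "a' \<in> C s - {a}" using aC mem[OF s] a' by auto
    qed
    then have "pos a \<le> card (C s - {a})" unfolding pos_def using chainsD(3)[OF Cc s] by (intro card_mono) auto
    also have "\<dots> < card (C s)" using aC chainsD(3)[OF Cc s] by (intro psubset_card_mono) auto
    finally show "pos a < s" using chainsD(2)[OF Cc s] by simp
  next
    assume less: "pos a < s"
    show "a \<in> C s"
    proof (rule ccontr)
      assume aC: "a \<notin> C s"
      have "C s \<subseteq> {a' \<in> {1..n}. k a' < k a}"
      proof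
        fix a' assume a': "a' \<in> C s"
        then have "rk a' < rk a" using aC mem[OF s] by (meson le_less_trans not_le order.strict_trans2)
        moreover have "a' \<in> {1..n}" using a' chainsD(1)[OF Cc s] by blast
        ultimately show "a' \<in> {a' \<in> {1..n}. k a' < k a}" using k_less[of a' a] by auto
      qed
      then have "card (C s) \<le> pos a" unfolding pos_def by (intro card_mono) auto
      then show False using less chainsD(2)[OF Cc s] by simp
    qed
  qed
  define w where "w = inv_into {1..n} pos"
  have w: "bij_betw w {..<n} {1..n}" unfolding w_def by (rule bij_betw_inv_into[OF bij])
  have wn: "w p \<in> {1..n}" "pos (w p) = p" if "p < n" for p
    using that bij bij_betw_inv_into_right[OF bij, of p] bij_betwE[OF w] unfolding w_def by auto
  have "word_chain S w s = C s" for s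
  proof (cases "s \<in> S")
    case True
    have "w ` {..<s} = C s"
    proof (intro equalityI subsetI)
      fix a assume "a \<in> w ` {..<s}"
      then obtain p where p: "p < s" "a = w p" by auto
      then have "p < n" using True S by auto
      then show "a \<in> C s" using pos_mem[OF True wn(1)] wn(2) p by simp
    next
      fix a assume a: "a \<in> C s"
      then have a': "a \<in> {1..n}" using chainsD(1)[OF Cc True] by blast
      then have "w (pos a) = a" unfolding w_def by (rule bij_betw_inv_into_left[OF bij])
      moreover have "pos a < s" using pos_mem[OF True a'] a by simp
      ultimately show "a \<in> w ` {..<s}" by (metis image_eqI lessThan_iff)
    qed
    then show ?thesis using True by (simp add: word_chain_def)
  next
    case False
    then show ?thesis using chainsD(6)[OF Cc] by (simp add: word_chain_def)
  qed
  then have wC: "word_chain S w = C" by (rule ext)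
  have wd: "w s < w (s - 1)" if s: "s \<in> S" for s
  proof -
    have "s \<in> {1..<n}" using s S by blast
    then have sn: "s < n" "s - 1 < n" "0 < s" by auto
    obtain a b where ab: "a \<in> C s" "b \<in> {1..n} - C s" "b < a"
      "\<And>t. t \<in> S \<Longrightarrow> t < s \<Longrightarrow> a \<notin> C t" "\<And>t. t \<in> S \<Longrightarrow> s < t \<Longrightarrow> b \<in> C t"
      using desc[OF s] unfolding chain_descent_def by blast
    have an: "a \<in> {1..n}" using ab(1) chainsD(1)[OF Cc s] by blast
    have rka: "rk a = card {t \<in> S. t < s}"
    proof -
      have "{t \<in> S. a \<notin> C t} = {t \<in> S. t < s}"
        using ab(1,4) chainsD(5)[OF Cc s] by (auto simp: not_less) (metis not_less subsetD)
      then show ?thesis by (simp add: rk_def)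
    qed
    have rkb: "rk b = steps S s"
    proof -
      have "{t \<in> S. b \<notin> C t} = {t \<in> S. t \<le> s}"
        using ab(2,5) chainsD(5)[OF Cc _ s] by (auto simp: not_le) (metis not_le)
      then show ?thesis by (simp add: rk_def steps_def)
    qed
    have st: "steps S s = Suc (card {t \<in> S. t < s})"
    proof -
      have "{t \<in> S. t \<le> s} = insert s {t \<in> S. t < s}" using s by auto
      then show ?thesis using fin by (simp add: steps_def)
    qed
    \<comment> \<open>\<open>w (s - 1)\<close> is the largest element of the block before
      \<open>s\<close> and \<open>w s\<close> the smallest of the block after it, so the witnesses
      of the descent give \<open>w s \<le> b < a \<le> w (s - 1)\<close>.\<close>
    have "a \<le> w (s - 1)"
    proof -
      have "w (s - 1) \<in> C s" using pos_mem[OF s wn(1)[OF sn(2)]] wn(2)[OF sn(2)] sn by simp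
      then have "rk (w (s - 1)) \<le> rk a" using mem[OF s] rka st by simp
      moreover have "pos a \<le> pos (w (s - 1))" using pos_mem[OF s an] ab(1) wn(2)[OF sn(2)] by simp
      then have "\<not> k (w (s - 1)) < k a" using pos_mono[OF _ wn(1)[OF sn(2)], of a] by auto
      then have "k a \<le> k (w (s - 1))" by simp
      moreover have "\<not> rk (w (s - 1)) < rk a"
        using k_less[of "w (s - 1)" a] calculation(2) wn(1)[OF sn(2)] by auto
      ultimately show ?thesis by (simp add: k_def)
    qed
    moreover have "w s \<le> b"
    proof -
      have "w s \<notin> C s" using pos_mem[OF s wn(1)[OF sn(1)]] wn(2)[OF sn(1)] by simp
      then have "rk b \<le> rk (w s)" using mem[OF s] rkb by simp
      moreover have "pos (w s) \<le> pos b" using pos_mem[OF s, of b] ab(2) wn(2)[OF sn(1)] by simp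
      then have "\<not> k b < k (w s)" using pos_mono[of b "w s"] ab(2) by auto
      then have "k (w s) \<le> k b" by simp
      moreover have "\<not> rk b < rk (w s)" using k_less[of b "w s"] calculation(2) ab(2) by auto
      ultimately show ?thesis by (simp add: k_def)
    qed
    ultimately show ?thesis using ab(3) by simp
  qed
  show thesis by (rule that[OF w wC wd])
qed

lemma column_decreasing:
  assumes S: "finite S" "S \<subseteq> {1..}" and w: "\<And>s. s \<in> S \<Longrightarrow> w s < (w (s - 1) :: nat)"
    and pq: "p < q" "column S p = column S q"
  shows "w q < w p"
proof -
  have "Suc p \<le> q" using pq by simp
  then show ?thesis using pq(2)
  proof (induction q rule: dec_induct)
    case base
    then have "Suc p \<in> S" using column_eqD(1)[OF S, of p "Suc p" "Suc p"] by simp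
    then show ?case using w[of "Suc p"] by simp
  next
    case (step q)
    have c: "column S q = column S (Suc q)"
      by (rule column_eqD(2)[OF S step.prems]) (use step.hyps in auto)
    have "Suc q \<in> S"
      by (rule column_eqD(1)[OF S step.prems]) (use step.hyps in auto)
    then have "w (Suc q) < w q" using w[of "Suc q"] by simp
    also have "w q < w p" by (rule step.IH) (simp only: step.prems c)
    finally show ?case .
  qed
qed

text \<open>The tableau is filled with the word of \<open>C\<close>, so its entries decrease along
  each column in the order of the path. A column permutation that changes the set of the first
  \<open>s\<close> entries brings in smaller ones from beyond and lowers the sum. Hence
  \<open>C\<close> is the heaviest chain in its polytabloid.\<close>

lemma polytabloid_leading_term:
  assumes S: "S \<subseteq> {1..<n}" and C: "C \<in> descent_chains n S S"
  obtains T where "T \<in> tableaux n (ribbon n S)" "chain_polytabloid n S T C = 1"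
    "\<And>C'. chain_polytabloid n S T C' \<noteq> 0 \<Longrightarrow> C' = C \<or> chain_weight S C' < chain_weight S C"
proof -
  have fin: "finite S" "S \<subseteq> {1..}" using S finite_subset by auto
  obtain w where w: "bij_betw w {..<n} {1..n}" "word_chain S w = C" "\<And>s. s \<in> S \<Longrightarrow> w s < w (s - 1)"
    using chain_word_exists[OF S C] by blast
  have injw: "inj_on w {..<n}" and imw: "w ` {..<n} = {1..n}" using w(1) by (auto simp: bij_betw_def)
  define T where "T x = w (inv_into UNIV (box_at S) x)" for x
  have Tb: "T (box_at S p) = w p" for p
    unfolding T_def using box_at_inj[OF fin] by simp
  have T: "T \<in> tableaux n (ribbon n S)" unfolding tableaux_word[OF S] Tb by (rule w(1))
  let ?CS = "column_stabilizer n (ribbon n S) T"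
  let ?W = "\<lambda>\<kappa>. word_chain S (\<lambda>p. \<kappa> (w p))"
  have e: "chain_polytabloid n S T C' = (\<Sum>\<kappa>\<in>?CS. of_int (sign \<kappa>) * of_bool (?W \<kappa> = C'))" for C'
    unfolding chain_polytabloid_def Tb ..
  have Sym: "\<kappa> permutes {1..n}" if "\<kappa> \<in> ?CS" for \<kappa> using that by (simp add: column_stabilizer_def Sym_def)
  have move: "\<exists>q<n. column S q = column S p \<and> \<kappa> (w p) = w q" if \<kappa>: "\<kappa> \<in> ?CS" and p: "p < n" for \<kappa> p
  proof -
    have "box_at S p \<in> ribbon n S" using p by (simp add: ribbon_def)
    then obtain y where y: "y \<in> ribbon n S" "snd y = snd (box_at S p)" "\<kappa> (T (box_at S p)) = T y"
      using \<kappa> unfolding column_stabilizer_def by blast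
    then obtain q where q: "q < n" "y = box_at S q" unfolding ribbon_def by auto
    have "\<kappa> (w p) = w q" using y(3) unfolding q(2) Tb .
    moreover have "column S q = column S p" using y(2) unfolding q(2) by (simp add: box_at_def column_def)
    ultimately show ?thesis using q(1) by blast
  qed
  have memw: "w q \<in> w ` {..<s} \<longleftrightarrow> q < s" if "q < n" "s \<le> n" for q s
  proof -
    have sub: "{..<s} \<subseteq> {..<n}" using that by auto
    show ?thesis using inj_on_image_mem_iff[OF injw _ sub, of q] that by simp
  qed
  have Cs: "C s = w ` {..<s}" if "s \<in> S" for s using w(2) that by (auto simp: word_chain_def)
  have less: "\<Sum>(?W \<kappa> s) < \<Sum>(C s)" if \<kappa>: "\<kappa> \<in> ?CS" and s: "s \<in> S" and ne: "?W \<kappa> s \<noteq> C s" for \<kappa> s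
  proof (rule sum_less_exchange)
    have sn: "s \<le> n" using s S by auto
    have Ws: "?W \<kappa> s = \<kappa> ` w ` {..<s}" using s by (simp add: word_chain_def image_image)
    show "finite (?W \<kappa> s)" "finite (C s)" unfolding Ws Cs[OF s] by simp_all
    show "card (?W \<kappa> s) = card (C s)"
      unfolding Ws Cs[OF s] using permutes_inj[OF Sym[OF \<kappa>]] by (intro card_image) (auto intro: inj_on_subset)
    show "?W \<kappa> s \<noteq> C s" by (rule ne)
    fix a b assume a: "a \<in> ?W \<kappa> s - C s" and b: "b \<in> C s - ?W \<kappa> s"
    obtain p where p: "p < s" "a = \<kappa> (w p)" using a unfolding Ws by auto
    obtain q where q: "q < n" "column S q = column S p" "a = w q" using move[OF \<kappa>, of p] p sn by auto
    have sq: "s \<le> q" using a memw[OF q(1) sn] q(3) unfolding Cs[OF s] by auto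
    obtain p' where p': "p' < s" "b = w p'" using b unfolding Cs[OF s] by auto
    have "w p' \<in> {1..n}" using imw p' sn by auto
    then have "inv \<kappa> (w p') \<in> w ` {..<n}"
      using permutes_in_image[OF permutes_inv[OF Sym[OF \<kappa>]], of "w p'"] imw by simp
    then obtain q' where q': "q' < n" "inv \<kappa> (w p') = w q'" by auto
    then have kq': "\<kappa> (w q') = w p'" using permutes_inverses(1)[OF Sym[OF \<kappa>], of "w p'"] by simp
    have sq': "s \<le> q'"
    proof (rule ccontr)
      assume "\<not> s \<le> q'"
      then have "\<kappa> (w q') \<in> ?W \<kappa> s" unfolding Ws by auto
      then show False using b kq' p' by simp
    qed
    obtain r where r: "r < n" "column S r = column S q'" "\<kappa> (w q') = w r" using move[OF \<kappa> q'(1)] by auto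
    have "r = p'" using inj_onD[OF injw, of r p'] r kq' p' sn by auto
    then have cp': "column S p' = column S q'" using r by simp
    have "column S p = column S s" using column_eqD(2)[OF fin, of p q s] q p sq by simp
    moreover have "column S s = column S q" using column_eqD(2)[OF fin, of p q s] q p sq by simp
    moreover have "column S s = column S p'" using column_eqD(2)[OF fin cp', of s] cp' p' sq' by simp
    ultimately have "column S p' = column S q" by simp
    then have "w q < w p'" using p' sq by (intro column_decreasing[where w = w, OF fin w(3)]) auto
    then show "a < b" using q p' by simp
  qed
  \<comment> \<open>A \<open>\<kappa>\<close> that keeps all partial unions preserves the rows as
    well as the columns; a row and a column of a ribbon share at most one box.\<close>
  have id: "\<kappa> = id" if \<kappa>: "\<kappa> \<in> ?CS" and eq: "?W \<kappa> = C" for \<kappa>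
  proof -
    have fixw: "\<kappa> (w p) = w p" if p: "p < n" for p
    proof -
      obtain q where q: "q < n" "column S q = column S p" "\<kappa> (w p) = w q" using move[OF \<kappa> p] by auto
      have eqs: "\<kappa> (w p') \<in> w ` {..<s} \<longleftrightarrow> p' < s" if s: "s \<in> S" and "p' < n" for s p'
      proof -
        have "w ` {..<s} = \<kappa> ` w ` {..<s}"
          using fun_cong[OF eq, of s] s Cs[OF s] by (simp add: word_chain_def image_image)
        then have "\<kappa> (w p') \<in> w ` {..<s} \<longleftrightarrow> w p' \<in> w ` {..<s}"
          using inj_image_mem_iff[OF permutes_inj[OF Sym[OF \<kappa>]], of "w p'" "w ` {..<s}"] by simp
        then show ?thesis using memw[OF that(2), of s] s S by auto
      qed
      consider "p < q" | "q < p" | "p = q" by linarith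
      then show ?thesis
      proof cases
        case 1
        then have s: "Suc p \<in> S" using column_eqD(1)[OF fin, of p q "Suc p"] q by simp
        then have "w q \<in> w ` {..<Suc p}" using eqs[OF s p] q by simp
        then show ?thesis using memw[OF q(1), of "Suc p"] p 1 by simp
      next
        case 2
        then have s: "Suc q \<in> S" using column_eqD(1)[OF fin, of q p "Suc q"] q by simp
        have "w q \<in> w ` {..<Suc q}" by simp
        then have "\<kappa> (w p) \<in> w ` {..<Suc q}" using q by simp
        then show ?thesis using eqs[OF s p] 2 by simp
      next
        case 3
        then show ?thesis using q by simp
      qed
    qed
    have "\<kappa> a = a" for a
    proof (cases "a \<in> {1..n}")
      case True
      then show ?thesis using imw fixw by (metis imageE lessThan_iff)
    next
      case False
      then show ?thesis using permutes_not_in[OF Sym[OF \<kappa>]] by blast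
    qed
    then show ?thesis by auto
  qed
  have idCS: "id \<in> ?CS" unfolding column_stabilizer_def Sym_def by auto
  have "chain_polytabloid n S T C = (\<Sum>\<kappa>\<in>?CS. if \<kappa> = id then 1 else 0)"
    unfolding e
  proof (rule sum.cong[OF refl])
    fix \<kappa> assume \<kappa>: "\<kappa> \<in> ?CS"
    show "of_int (sign \<kappa>) * of_bool (?W \<kappa> = C) = (if \<kappa> = id then 1 else (0 :: complex))"
      using id[OF \<kappa>] w(2) by (cases "\<kappa> = id") (auto simp: sign_id)
  qed
  also have "\<dots> = 1" using idCS finite_column_stabilizer by simp
  finally have 1: "chain_polytabloid n S T C = 1" .
  have 2: "C' = C \<or> chain_weight S C' < chain_weight S C" if nz: "chain_polytabloid n S T C' \<noteq> 0" for C'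
  proof -
    have "\<exists>\<kappa>\<in>?CS. ?W \<kappa> = C'"
    proof (rule ccontr)
      assume no: "\<not> ?thesis"
      have "chain_polytabloid n S T C' = 0"
        unfolding e by (rule sum.neutral) (use no in simp)
      with nz show False by contradiction
    qed
    then obtain \<kappa> where \<kappa>: "\<kappa> \<in> ?CS" "?W \<kappa> = C'" by blast
    show ?thesis
    proof (cases "C' = C")
      case False
      then obtain s where s: "C' s \<noteq> C s" by blast
      then have sS: "s \<in> S" using \<kappa>(2) w(2) by (auto simp: word_chain_def)
      have "\<Sum>(C' t) \<le> \<Sum>(C t)" if "t \<in> S" for t
        using less[OF \<kappa>(1) that] \<kappa>(2) by (cases "C' t = C t") auto
      moreover have "\<Sum>(C' s) < \<Sum>(C s)" using less[OF \<kappa>(1) sS] \<kappa>(2) s by simp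
      ultimately have "chain_weight S C' < chain_weight S C"
        unfolding chain_weight_def using fin(1) sS by (intro sum_strict_mono_ex1) auto
      then show ?thesis by simp
    qed simp
  qed
  show thesis by (rule that[OF T 1 2])
qed

text \<open>By their leading terms the polytabloids can be combined to match any values at the
  descent chains, and these values determine an element of the kernel.\<close>

lemma kernel_polytabloid_span:
  assumes S: "S \<subseteq> {1..<n}" and f: "f \<in> kernel n S S"
  shows "\<exists>c T. (\<forall>C\<in>descent_chains n S S. T C \<in> tableaux n (ribbon n S)) \<and>
    f = (\<lambda>x. \<Sum>C\<in>descent_chains n S S. c C * chain_polytabloid n S (T C) x)"
proof -
  have fin: "finite S" using S finite_subset by blast
  let ?I = "descent_chains n S S"
  have finI: "finite ?I" by (rule finite_descent_chains[OF fin])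
  have "\<exists>T. T \<in> tableaux n (ribbon n S) \<and> chain_polytabloid n S T C = 1 \<and>
    (\<forall>C'. chain_polytabloid n S T C' \<noteq> 0 \<longrightarrow> C' = C \<or> chain_weight S C' < chain_weight S C)" if "C \<in> ?I" for C
    using polytabloid_leading_term[OF S that] by metis
  then obtain T where T: "\<And>C. C \<in> ?I \<Longrightarrow> T C \<in> tableaux n (ribbon n S)"
    "\<And>C. C \<in> ?I \<Longrightarrow> chain_polytabloid n S (T C) C = 1"
    "\<And>C C'. C \<in> ?I \<Longrightarrow> chain_polytabloid n S (T C) C' \<noteq> 0 \<Longrightarrow> C' = C \<or> chain_weight S C' < chain_weight S C"
    by metis
  have "\<exists>c. \<forall>C'\<in>?I. (\<Sum>C\<in>?I. c C * chain_polytabloid n S (T C) C') = f C'"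
  proof (rule triangular_system_solvable[where w = "chain_weight S", OF finI T(2)])
    fix C C' assume "C \<in> ?I" "chain_polytabloid n S (T C) C' \<noteq> 0"
    from T(3)[OF this] show "C = C' \<or> chain_weight S C' < chain_weight S C" by auto
  qed
  then obtain c where c: "\<And>C'. C' \<in> ?I \<Longrightarrow> (\<Sum>C\<in>?I. c C * chain_polytabloid n S (T C) C') = f C'" by blast
  have "f = (\<lambda>x. \<Sum>C\<in>?I. c C * chain_polytabloid n S (T C) x)"
  proof (rule kernel_eqI[OF fin subset_refl f])
    show "(\<lambda>x. \<Sum>C\<in>?I. c C * chain_polytabloid n S (T C) x) \<in> kernel n S S"
      by (rule linear_space_sum[OF linear_space_kernel finI chain_polytabloid_kernel[OF S T(1)]])
    show "f C = (\<Sum>C'\<in>?I. c C' * chain_polytabloid n S (T C') C)" if "C \<in> ?I" for C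
      using c[OF that] by (rule sym)
  qed
  with T(1) show ?thesis by (intro exI[of _ c] exI[of _ T] conjI ballI)
qed

section \<open>The Specht module of a ribbon and its character\<close>

lemma sum_fun_eq: "(\<Sum>i\<in>I. F i) = (\<lambda>x. \<Sum>i\<in>I. F i x :: 'b::comm_monoid_add)"
  by (induction I rule: infinite_finite_induct) (simp_all add: zero_fun_def plus_fun_def)

lemma subspace_tabloid_fun: "cfun.subspace (tabloid_fun n S ` kernel n S S)"
proof (rule cfun.subspaceI)
  have "(\<lambda>_. 0) = tabloid_fun n S (\<lambda>_. 0)" by (simp add: tabloid_fun_def fun_eq_iff)
  then show "0 \<in> tabloid_fun n S ` kernel n S S"
    unfolding zero_fun_def using linear_spaceD(1)[OF linear_space_kernel] by blast
next
  fix f g assume "f \<in> tabloid_fun n S ` kernel n S S" "g \<in> tabloid_fun n S ` kernel n S S"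
  then obtain f' g' where fg: "f' \<in> kernel n S S" "g' \<in> kernel n S S" "f = tabloid_fun n S f'" "g = tabloid_fun n S g'"
    by blast
  have "f + g = tabloid_fun n S (\<lambda>C. f' C + g' C)"
    unfolding fg plus_fun_def by (simp add: fun_eq_iff tabloid_fun_linear)
  then show "f + g \<in> tabloid_fun n S ` kernel n S S"
    using linear_spaceD(2)[OF linear_space_kernel fg(1,2)] by blast
next
  fix c f assume "f \<in> tabloid_fun n S ` kernel n S S"
  then obtain f' where f: "f' \<in> kernel n S S" "f = tabloid_fun n S f'" by blast
  have "(\<lambda>x. c * f x) = tabloid_fun n S (\<lambda>C. c * f' C)"
    unfolding f by (simp add: fun_eq_iff tabloid_fun_linear)
  then show "(\<lambda>x. c * f x) \<in> tabloid_fun n S ` kernel n S S"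
    using linear_spaceD(3)[OF linear_space_kernel f(1)] by blast
qed

lemma tabloid_fun_sum:
  "tabloid_fun n S (\<lambda>x. \<Sum>i\<in>I. c i * F i x) = (\<Sum>i\<in>I. (\<lambda>x. c i * tabloid_fun n S (F i) x))"
  unfolding sum_fun_eq tabloid_fun_def sum_distrib_right sum_distrib_left
  by (rule ext, rule trans[OF sum.swap]) (simp only: mult.assoc)

theorem specht_module_eq:
  assumes S: "S \<subseteq> {1..<n}"
  shows "specht_module n (ribbon n S) = tabloid_fun n S ` kernel n S S"
proof
  show "specht_module n (ribbon n S) \<subseteq> tabloid_fun n S ` kernel n S S"
    unfolding specht_module_def
  proof (rule cfun.span_minimal[OF _ subspace_tabloid_fun], rule image_subsetI)
    fix T assume T: "T \<in> tableaux n (ribbon n S)"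
    show "polytabloid n (ribbon n S) T \<in> tabloid_fun n S ` kernel n S S"
      unfolding polytabloid_eq[OF S T] using chain_polytabloid_kernel[OF S T] by (rule imageI)
  qed
next
  show "tabloid_fun n S ` kernel n S S \<subseteq> specht_module n (ribbon n S)"
  proof (rule image_subsetI)
    fix f assume f: "f \<in> kernel n S S"
    obtain c T where T: "\<And>C. C \<in> descent_chains n S S \<Longrightarrow> T C \<in> tableaux n (ribbon n S)"
      and feq: "f = (\<lambda>x. \<Sum>C\<in>descent_chains n S S. c C * chain_polytabloid n S (T C) x)"
      using kernel_polytabloid_span[OF S f] by blast
    show "tabloid_fun n S f \<in> specht_module n (ribbon n S)"
      unfolding feq tabloid_fun_sum specht_module_def
    proof (intro cfun.span_sum cfun.span_scale cfun.span_base)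
      fix C assume C: "C \<in> descent_chains n S S"
      show "tabloid_fun n S (chain_polytabloid n S (T C)) \<in> polytabloid n (ribbon n S) ` tableaux n (ribbon n S)"
        unfolding polytabloid_eq[OF S T[OF C], symmetric] using T[OF C] by (rule imageI)
    qed
  qed
qed

text \<open>\<open>subspace_trace\<close> uses a basis chosen by \<open>SOME\<close>, of which only
  independence and span are known. \<open>trace_unique\<close> compares it with the transported dual
  family, whose coordinates are the values at the tabloids of descent chains.\<close>

theorem specht_character_ribbon:
  assumes S: "S \<subseteq> {1..<n}" and \<pi>: "\<pi> permutes {1..n}"
  shows "specht_character n (ribbon n S) \<pi> = kernel_trace n S S \<pi>"
proof -
  have fin: "finite S" "S \<subseteq> {..n}" using S finite_subset by auto
  let ?V = "tabloid_fun n S ` kernel n S S"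
  let ?I = "descent_chains n S S"
  have finI: "finite ?I" by (rule finite_descent_chains[OF fin(1)])
  define b where "b = (SOME b. dual_family n S S b)"
  have b: "dual_family n S S b" unfolding b_def by (rule dual_family_some[OF fin subset_refl])
  have bK: "b C \<in> kernel n S S" if "C \<in> ?I" for C using b that unfolding dual_family_def by blast
  have IC: "C \<in> chains n S" if "C \<in> ?I" for C using that by (simp add: descent_chains_def)
  have sub: "cfun.subspace ?V" by (rule subspace_tabloid_fun)
  have V: "linear_space ?V"
    using cfun.subspace_0[OF sub] cfun.subspace_add[OF sub] cfun.subspace_scale[OF sub]
    unfolding linear_space_def zero_fun_def plus_fun_def by blast
  have dV: "f = (\<lambda>x. \<Sum>C\<in>?I. f (chain_tabloid n S C) * tabloid_fun n S (b C) x)" if fV: "f \<in> ?V" for f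
  proof -
    obtain g where g: "g \<in> kernel n S S" "f = tabloid_fun n S g" using fV by blast
    have "f = tabloid_fun n S (\<lambda>x. \<Sum>C\<in>?I. g C * b C x)"
      using g(2) dual_family_expand[OF fin(1) subset_refl b g(1)] by simp
    also have "\<dots> = (\<lambda>x. \<Sum>C\<in>?I. g C * tabloid_fun n S (b C) x)"
      unfolding tabloid_fun_sum sum_fun_eq ..
    also have "\<dots> = (\<lambda>x. \<Sum>C\<in>?I. f (chain_tabloid n S C) * tabloid_fun n S (b C) x)"
      using tabloid_fun_tabloid[OF fin(1) IC, of _ g] unfolding g(2) by (intro ext sum.cong refl) simp
    finally show ?thesis .
  qed
  define B where "B = (SOME B. B \<subseteq> ?V \<and> \<not> cfun_dependent B \<and> cfun_span B = ?V)"
  have "\<exists>B. B \<subseteq> ?V \<and> \<not> cfun_dependent B \<and> cfun_span B = ?V"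
  proof -
    obtain B where "B \<subseteq> ?V" "\<not> cfun_dependent B" "?V \<subseteq> cfun_span B"
      using cfun.maximal_independent_subset[of ?V] by blast
    moreover have "cfun_span B \<subseteq> ?V" using calculation(1) sub by (rule cfun.span_minimal)
    ultimately show ?thesis by blast
  qed
  then have B: "B \<subseteq> ?V" "\<not> cfun_dependent B" "cfun_span B = ?V"
    unfolding B_def by (metis (mono_tags, lifting) someI_ex)+
  have "?V \<subseteq> cfun_span ((\<lambda>C. tabloid_fun n S (b C)) ` ?I)"
  proof
    fix f assume "f \<in> ?V"
    from dV[OF this] have f: "f = (\<Sum>C\<in>?I. (\<lambda>x. f (chain_tabloid n S C) * tabloid_fun n S (b C) x))"
      unfolding sum_fun_eq .
    show "f \<in> cfun_span ((\<lambda>C. tabloid_fun n S (b C)) ` ?I)"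
      by (subst f) (intro cfun.span_sum cfun.span_scale cfun.span_base imageI)
  qed
  \<comment> \<open>This has to precede the comparison: over an infinite \<open>B\<close> the
    \<open>sum\<close> in \<open>subspace_trace\<close> would be 0.\<close>
  then have finB: "finite B"
    using cfun.independent_span_bound[of "(\<lambda>C. tabloid_fun n S (b C)) ` ?I" B] B finI by blast
  have LV: "tabloid_action \<pi> f \<in> ?V" if "f \<in> ?V" for f
    using that tabloid_action_fun[OF fin(1) \<pi>] chain_act_kernel[OF \<pi>] by auto
  have "(\<Sum>v\<in>B. cfun_representation B (tabloid_action \<pi> v) v) =
    (\<Sum>C\<in>?I. (\<lambda>f. f (chain_tabloid n S C)) (tabloid_action \<pi> (tabloid_fun n S (b C))))"
  proof (rule trace_unique[OF V finB finI, where L = "tabloid_action \<pi>" and b = "\<lambda>v. v"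
        and l = "\<lambda>v f. cfun_representation B f v" and d = "\<lambda>C. tabloid_fun n S (b C)" and m = "\<lambda>C f. f (chain_tabloid n S C)"])
    show "tabloid_action \<pi> f \<in> ?V" if "f \<in> ?V" for f by (rule LV[OF that])
    show "linear_form ?V (\<lambda>f. tabloid_action \<pi> f x)" for x
      unfolding linear_form_def tabloid_action_def by simp
    show "v \<in> ?V" if "v \<in> B" for v using B(1) that by (rule subsetD)
    show "linear_form ?V (\<lambda>f. cfun_representation B f v)" for v
      unfolding linear_form_def
      using cfun.representation_add[OF B(2), unfolded B(3) plus_fun_def] cfun.representation_scale[OF B(2), unfolded B(3)]
      by simp
    show "tabloid_fun n S (b C) \<in> ?V" if "C \<in> ?I" for C using bK[OF that] by (rule imageI)
    show "linear_form ?V (\<lambda>f. f (chain_tabloid n S C))" for C by (rule linear_form_apply)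
    show "f = (\<lambda>x. \<Sum>v\<in>B. cfun_representation B f v * v x)" if "f \<in> ?V" for f
      using cfun.sum_representation_eq[OF B(2) _ finB subset_refl, of f] that B(3) by (simp add: sum_fun_eq)
    show "f = (\<lambda>x. \<Sum>C\<in>?I. f (chain_tabloid n S C) * tabloid_fun n S (b C) x)" if "f \<in> ?V" for f
      by (rule dV[OF that])
  qed
  also have "\<dots> = (\<Sum>C\<in>?I. chain_act \<pi> (b C) C)"
    unfolding tabloid_action_fun[OF fin(1) \<pi>] using tabloid_fun_tabloid[OF fin(1) IC] by (intro sum.cong refl) simp
  finally show ?thesis
    unfolding specht_character_def subspace_trace_def Let_def specht_module_eq[OF S] kernel_trace_def
      B_def[symmetric] b_def[symmetric] .
qed

section \<open>Border shapes\<close>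

lemma steps_surj:
  assumes "finite S" "k \<le> steps S p" "0 \<notin> S"
  shows "\<exists>q\<le>p. steps S q = k"
  using assms(2)
proof (induction p)
  case 0
  have "{s \<in> S. s \<le> 0} = {}" using assms(3) by auto
  then have "steps S 0 = 0" unfolding steps_def by (simp only: card.empty)
  then show ?case using 0 by auto
next
  case (Suc p)
  show ?case
  proof (cases "k \<le> steps S p")
    case True
    then show ?thesis using Suc.IH le_SucI by blast
  next
    case False
    then have "k = steps S (Suc p)"
      using Suc.prems steps_Suc[OF assms(1), of p] by (cases "Suc p \<in> S") auto
    then show ?thesis by blast
  qed
qed

section \<open>Ribbons are border shapes\<close>

context
  fixes n :: nat and S :: "nat set"
  assumes S: "S \<subseteq> {1..<n}" and n: "n \<ge> 1"
begin

lemma S_fin: "finite S" "S \<subseteq> {1..}" "0 \<notin> S"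
  using S finite_subset by auto

lemma steps_0: "steps S 0 = 0"
  using steps_le[OF S_fin(2), of 0] by simp

lemma steps_last: "steps S (n - 1) = card S"
proof -
  have "s \<le> n - 1" if "s \<in> S" for s
  proof -
    have "s \<in> {1..<n}" using S that by blast
    then show ?thesis by auto
  qed
  then have "{s \<in> S. s \<le> n - 1} = S" by blast
  then show ?thesis unfolding steps_def by (simp only:)
qed

lemma fst_ribbon: "fst ` ribbon n S = {..card S}"
proof
  show "fst ` ribbon n S \<subseteq> {..card S}" by (auto simp: ribbon_def box_at_def)
  show "{..card S} \<subseteq> fst ` ribbon n S"
  proof
    fix r assume r: "r \<in> {..card S}"
    have "card S - r \<le> steps S (n - 1)" unfolding steps_last by simp
    then obtain q where q: "q \<le> n - 1" "steps S q = card S - r"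
      using steps_surj[OF S_fin(1) _ S_fin(3)] by blast
    have "box_at S q \<in> ribbon n S" unfolding ribbon_def using q n by (intro imageI) auto
    moreover have "fst (box_at S q) = r" using q r by (simp add: box_at_def)
    ultimately show "r \<in> fst ` ribbon n S" by force
  qed
qed

lemma card_ribbon: "card (ribbon n S) = n"
  unfolding ribbon_def using box_at_inj[OF S_fin(1,2)] by (simp add: card_image inj_on_subset)

lemma box_at_between:
  assumes "p \<le> q" "q < n"
    and "fst (box_at S q) \<le> r" "r \<le> fst (box_at S p)" "snd (box_at S p) \<le> c" "c \<le> snd (box_at S q)"
    and line: "snd (box_at S p) = snd (box_at S q) \<or> fst (box_at S p) = fst (box_at S q)"
  shows "(r, c) \<in> ribbon n S"
proof -
  note le = steps_le[OF S_fin(2)] and lec = steps_le_card[OF S_fin(1)]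
  have colp: "p = steps S p + column S p" "q = steps S q + column S q"
    using le[of p] le[of q] by (auto simp: column_def)
  have bounds: "card S - steps S q \<le> r" "r \<le> card S - steps S p" "column S p \<le> c" "c \<le> column S q"
    using assms by (simp_all add: box_at_def column_def)
  \<comment> \<open>A box determines its number on the path: row \<open>r\<close> is reached after
    \<open>card S - r\<close> upward steps, and column \<open>c\<close> after \<open>c\<close> steps
    to the right.\<close>
  define x where "x = (card S - r) + c"
  have r: "r \<le> card S" using bounds by simp
  have s1: "steps S p \<le> card S - r" "card S - r \<le> steps S q"
    using bounds lec[of p] lec[of q] by auto
  have px: "p \<le> x" using colp(1) s1(1) bounds(3) unfolding x_def by linarith
  have xq: "x \<le> q" using colp(2) s1(2) bounds(4) unfolding x_def by linarith
  have mono: "steps S p \<le> steps S x" "steps S x \<le> steps S q" "column S p \<le> column S x" "column S x \<le> column S q"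
    using px xq by (auto intro!: steps_mono column_mono S_fin)
  have xx: "x = steps S x + column S x" using le[of x] by (auto simp: column_def)
  have "steps S x = card S - r \<and> column S x = c"
    using line
  proof
    assume "snd (box_at S p) = snd (box_at S q)"
    then have "column S p = column S q" by (simp add: box_at_def column_def)
    then have "column S x = c" using mono bounds by linarith
    then show ?thesis using xx unfolding x_def by linarith
  next
    assume "fst (box_at S p) = fst (box_at S q)"
    then have "steps S p = steps S q" using lec[of p] lec[of q] by (simp add: box_at_def)
    then have "steps S x = card S - r" using mono s1 by linarith
    then show ?thesis using xx unfolding x_def by linarith
  qed
  then have sx: "steps S x = card S - r" and cx: "column S x = c" by auto
  have "box_at S x = (card S - steps S x, column S x)" by (simp add: box_at_def column_def)
  also have "\<dots> = (r, c)" unfolding sx cx using r by simp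
  finally have "box_at S x = (r, c)" .
  moreover have "x < n" using xq assms(2) by simp
  ultimately show ?thesis unfolding ribbon_def by (metis imageI lessThan_iff)
qed

lemma box_at_mono:
  assumes "p \<le> q"
  shows "fst (box_at S q) \<le> fst (box_at S p)" "snd (box_at S p) \<le> snd (box_at S q)"
  using steps_mono[OF S_fin(1) assms] column_mono[OF S_fin(1,2) assms] by (simp_all add: box_at_def column_def)

text \<open>\<open>\<Lambda>\<close> consists of all boxes weakly north-west of a box of the ribbon.
  The path runs up and to the right, so two of its boxes that are weakly ordered in both coordinates
  share a row or a column, and everything between them is on the path. Hence removing the ribbon
  leaves a diagram.\<close>

lemma skew_shape_ribbon: "skew_shape (ribbon n S)"
proof -
  define \<Lambda> where "\<Lambda> = {x. \<exists>p<n. fst x \<le> fst (box_at S p) \<and> snd x \<le> snd (box_at S p)}"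
  have "\<Lambda> \<subseteq> {..card S} \<times> {..n}"
    unfolding \<Lambda>_def by (auto simp: box_at_def)
  then have fin: "finite \<Lambda>" by (rule finite_subset) simp
  have yL: "young_diagram \<Lambda>"
    unfolding young_diagram_def using fin by (auto simp: \<Lambda>_def intro: le_trans)
  have sub: "ribbon n S \<subseteq> \<Lambda>" unfolding ribbon_def \<Lambda>_def by auto
  have key: "(r, c) \<in> ribbon n S"
    if L: "(r, c) \<in> \<Lambda>" and q: "(r', c') \<in> ribbon n S" and le: "r' \<le> r" "c' \<le> c" for r c r' c'
  proof -
    obtain p where p: "p < n" "r \<le> fst (box_at S p)" "c \<le> snd (box_at S p)"
      using L unfolding \<Lambda>_def by auto
    obtain q where q: "q < n" "(r', c') = box_at S q" using q unfolding ribbon_def by auto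
    have rc: "r' = fst (box_at S q)" "c' = snd (box_at S q)" using q(2) by (metis fst_conv, metis snd_conv)
    consider "p \<le> q" | "q \<le> p" by linarith
    then show ?thesis
    proof cases
      case 1
      show ?thesis
        by (rule box_at_between[OF 1 q(1)]) (use box_at_mono[OF 1] p rc le in auto)
    next
      case 2
      show ?thesis
        by (rule box_at_between[OF 2 p(1)]) (use box_at_mono[OF 2] p rc le in auto)
    qed
  qed
  have "young_diagram (\<Lambda> - ribbon n S)"
    unfolding young_diagram_def
  proof (intro conjI allI impI)
    show "finite (\<Lambda> - ribbon n S)" using fin by simp
    fix r c r' c' assume a: "(r, c) \<in> \<Lambda> - ribbon n S" "r' \<le> r" "c' \<le> c"
    then have "(r', c') \<in> \<Lambda>" using yL unfolding young_diagram_def by blast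
    moreover have "(r', c') \<notin> ribbon n S" using key a by blast
    ultimately show "(r', c') \<in> \<Lambda> - ribbon n S" by simp
  qed
  moreover have "ribbon n S = \<Lambda> - (\<Lambda> - ribbon n S)" using sub by auto
  ultimately show ?thesis unfolding skew_shape_def using yL by (metis Diff_subset)
qed

lemma connected_ribbon: "connected_shape (ribbon n S)"
proof -
  let ?R = "{(u, v). u \<in> ribbon n S \<and> v \<in> ribbon n S \<and> adjacent u v}"
  have sym: "sym ?R" unfolding sym_def adjacent_def by auto
  have adj: "adjacent (box_at S p) (box_at S (Suc p))" for p
    using steps_Suc[OF S_fin(1), of p] steps_le[OF S_fin(2), of p] steps_le_card[OF S_fin(1), of "Suc p"]
    unfolding adjacent_def box_at_def by (cases "Suc p \<in> S") auto
  have base: "(box_at S 0, box_at S p) \<in> ?R\<^sup>*" if "p < n" for p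
    using that
  proof (induction p)
    case (Suc p)
    then have "(box_at S p, box_at S (Suc p)) \<in> ?R" using adj by (auto simp: ribbon_def)
    then show ?case using Suc by (meson Suc_lessD rtrancl.rtrancl_into_rtrancl)
  qed simp
  have "(x, y) \<in> ?R\<^sup>*" if xy: "x \<in> ribbon n S" "y \<in> ribbon n S" for x y
  proof -
    obtain p q where pq: "p < n" "q < n" "x = box_at S p" "y = box_at S q" using xy unfolding ribbon_def by auto
    have "(x, box_at S 0) \<in> ?R\<^sup>*" using base[OF pq(1)] symD[OF sym_rtrancl[OF sym]] pq(3) by blast
    also have "(box_at S 0, y) \<in> ?R\<^sup>*" using base[OF pq(2)] pq(4) by simp
    finally show ?thesis .
  qed
  then show ?thesis unfolding connected_shape_def by blast
qed

lemma ribbon_border: "ribbon n S \<in> border_shapes n (card S + 1)"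
proof -
  have "\<not> {(r, c), (r, Suc c), (Suc r, c), (Suc r, Suc c)} \<subseteq> ribbon n S" for r c
  proof
    assume "{(r, c), (r, Suc c), (Suc r, c), (Suc r, Suc c)} \<subseteq> ribbon n S"
    then obtain p q where pq: "box_at S p = (r, c)" "box_at S q = (Suc r, Suc c)"
      unfolding ribbon_def by (metis (no_types, lifting) imageE insert_subset)
    have "p \<le> q \<or> q \<le> p" by linarith
    then show False using box_at_mono[of p q] box_at_mono[of q p] pq by auto
  qed
  then have "border_shape (ribbon n S)"
    unfolding border_shape_def using skew_shape_ribbon connected_ribbon by blast
  moreover have "0 \<in> fst ` ribbon n S" by (simp add: fst_ribbon)
  moreover have "0 \<in> snd ` ribbon n S"
  proof -
    have "box_at S 0 \<in> ribbon n S" using n by (auto simp: ribbon_def)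
    moreover have "snd (box_at S 0) = 0" by (simp add: box_at_def)
    ultimately show ?thesis by force
  qed
  ultimately show ?thesis
    unfolding border_shapes_def by (simp add: card_ribbon fst_ribbon)
qed

lemma mem_iff_steps: "s \<in> {1..<n} \<Longrightarrow> s \<in> S \<longleftrightarrow> steps S (s - 1) < steps S s"
  using steps_Suc[OF S_fin(1), of "s - 1"] by auto

end

lemma ribbon_inj:
  assumes n: "n \<ge> 1" and S: "S \<subseteq> {1..<n}" and S': "S' \<subseteq> {1..<n}" and eq: "ribbon n S = ribbon n S'"
  shows "S = S'"
proof -
  have c: "card S = card S'"
    using fst_ribbon[OF S n] fst_ribbon[OF S' n] eq by simp
  have steps: "steps S p = steps S' p" if p: "p < n" for p
  proof -
    have "box_at S p \<in> ribbon n S" unfolding ribbon_def using p by blast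
    then have "box_at S p \<in> ribbon n S'" by (simp only: eq)
    then obtain q where q: "box_at S p = box_at S' q" unfolding ribbon_def by blast
    then have "card S - steps S p = card S - steps S' q" "p - steps S p = q - steps S' q"
      using c by (simp_all add: box_at_def)
    then have "p = q" "steps S p = steps S' q"
      using steps_le_card[of S p] steps_le_card[of S' q] steps_le[of S p] steps_le[of S' q]
        S_fin[OF S n] S_fin[OF S' n] c by auto
    then show ?thesis by simp
  qed
  have "s \<in> S \<longleftrightarrow> s \<in> S'" if "s \<in> {1..<n}" for s
  proof -
    have "s - 1 < n" "s < n" using that by (cases s; auto)+
    then show ?thesis
      unfolding mem_iff_steps[OF S n that] mem_iff_steps[OF S' n that] by (simp only: steps)
  qed
  then show ?thesis using S S' by blast
qed

section \<open>Border shapes are ribbons\<close>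

lemma skew_convex:
  assumes D: "skew_shape D" and "(r, c) \<in> D" "(r', c') \<in> D" "r \<le> r''" "r'' \<le> r'" "c \<le> c''" "c'' \<le> c'"
  shows "(r'', c'') \<in> D"
proof -
  obtain \<Lambda> M where LM: "young_diagram \<Lambda>" "young_diagram M" "D = \<Lambda> - M"
    using D unfolding skew_shape_def by blast
  have "(r'', c'') \<in> \<Lambda>" using LM assms unfolding young_diagram_def by blast
  moreover have "(r'', c'') \<notin> M" using LM assms unfolding young_diagram_def by blast
  ultimately show ?thesis using LM by simp
qed

text \<open>The number of the diagonal. A step to an adjacent box changes it by one, which makes it
  the parameter of the path.\<close>

definition content :: "box \<Rightarrow> int" where
  "content x = int (snd x) - int (fst x)"

text \<open>Two distinct boxes on one diagonal of a skew shape span a rectangle inside the shape,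
  and this contains a 2 by 2 square.\<close>

lemma border_content_inj:
  assumes D: "border_shape D" and "x \<in> D" "y \<in> D" "content x = content y"
  shows "x = y"
proof -
  have main: False if xy: "x \<in> D" "y \<in> D" "content x = content y" and less: "fst x < fst y" for x y
  proof -
    obtain r c r' c' where rc: "x = (r, c)" "y = (r', c')" by (cases x, cases y)
    have le: "r < r'" "c < c'" using less xy(3) unfolding rc content_def by auto
    have "(r1, c1) \<in> D" if "r \<le> r1" "r1 \<le> r'" "c \<le> c1" "c1 \<le> c'" for r1 c1
    proof -
      have "skew_shape D" using D by (simp add: border_shape_def)
      moreover have "(r, c) \<in> D" "(r', c') \<in> D" using xy(1,2) unfolding rc .
      ultimately show ?thesis using that by (rule skew_convex)
    qed
    then have "{(r, c), (r, Suc c), (Suc r, c), (Suc r, Suc c)} \<subseteq> D" using le by simp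
    then show False using D unfolding border_shape_def by blast
  qed
  have "fst x = fst y"
    using main[of x y] main[of y x] assms(2-4) by (cases "fst x" "fst y" rule: linorder_cases) auto
  then show ?thesis using assms(4) by (simp add: content_def prod_eq_iff)
qed

lemma connected_content_step:
  assumes D: "connected_shape D" and x: "x \<in> D" and y: "y \<in> D" and m: "content x \<le> m" "m < content y"
  shows "\<exists>u\<in>D. \<exists>v\<in>D. adjacent u v \<and> content u = m \<and> content v = m + 1"
proof -
  have "(x, y) \<in> {(u, v). u \<in> D \<and> v \<in> D \<and> adjacent u v}\<^sup>*"
    using D x y unfolding connected_shape_def by blast
  then show ?thesis using m(2)
  proof (induction rule: rtrancl_induct)
    case base
    then show ?case using m(1) by simp
  next
    case (step y z)
    show ?case
    proof (cases "m < content y")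
      case True
      then show ?thesis by (rule step.IH)
    next
      case False
      have adj: "y \<in> D" "z \<in> D" "adjacent y z" using step.hyps by auto
      then have "content z \<le> content y + 1" unfolding adjacent_def content_def by auto
      then have "content y = m" "content z = m + 1" using False step.prems by auto
      then show ?thesis using adj by blast
    qed
  qed
qed

text \<open>The contents are distinct and, by connectedness, form an interval, so they number the
  boxes. Boxes with consecutive contents are adjacent, the next one lying to the right or above, and
  \<open>S\<close> records the upward steps.\<close>

lemma border_shape_ribbon:
  assumes n: "n \<ge> 1" and D: "border_shape D" and D0: "0 \<in> fst ` D" "0 \<in> snd ` D" and card: "card D = n"
  shows "\<exists>S\<subseteq>{1..<n}. D = ribbon n S"
proof -
  have fin: "finite D" and ne: "D \<noteq> {}" using card n by (auto intro: card_ge_0_finite)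
  have inj: "inj_on content D" using border_content_inj[OF D] by (auto intro: inj_onI)
  have conn: "connected_shape D" using D by (simp add: border_shape_def)
  define K where "K = content ` D"
  have K: "finite K" "K \<noteq> {}" "card K = n" unfolding K_def using fin ne card inj by (auto simp: card_image)
  define a where "a = Min K"
  have "K = {a..Max K}"
  proof (intro equalityI subsetI)
    fix m assume m: "m \<in> {a..Max K}"
    show "m \<in> K"
    proof (cases "m = Max K")
      case True
      then show ?thesis using Max_in[OF K(1,2)] by simp
    next
      case False
      obtain x y where xy: "x \<in> D" "y \<in> D" "content x = a" "content y = Max K"
        using Min_in[OF K(1,2)] Max_in[OF K(1,2)] unfolding K_def a_def by (metis imageE)
      have "content x \<le> m" "m < content y" using m False xy by auto
      from connected_content_step[OF conn xy(1,2) this] show ?thesis unfolding K_def by blast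
    qed
  qed (use K in \<open>auto simp: a_def\<close>)
  then have KK: "K = {a..a + int n - 1}" "Max K = a + int n - 1"
  proof -
    have "card {a..Max K} = n" using \<open>K = {a..Max K}\<close> K(3) by simp
    then show "Max K = a + int n - 1" using n by auto
    then show "K = {a..a + int n - 1}" using \<open>K = {a..Max K}\<close> by simp
  qed
  have "\<exists>x\<in>D. content x = a + int p" if "p < n" for p
  proof -
    have "a + int p \<in> K" unfolding KK(1) using that by auto
    then show ?thesis unfolding K_def by (metis imageE)
  qed
  then obtain b where b: "\<And>p. p < n \<Longrightarrow> b p \<in> D" "\<And>p. p < n \<Longrightarrow> content (b p) = a + int p" by metis
  have Db: "D = b ` {..<n}"
  proof (intro equalityI subsetI)
    fix x assume x: "x \<in> D"
    then have "content x \<in> {a..a + int n - 1}" unfolding KK(1)[symmetric] K_def by blast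
    then have p: "nat (content x - a) < n" "content x = a + int (nat (content x - a))" using n by auto
    then have "x = b (nat (content x - a))" using border_content_inj[OF D x] b by metis
    then show "x \<in> b ` {..<n}" using p(1) by blast
  qed (use b(1) in auto)
  have step: "fst (b (Suc p)) = fst (b p) \<and> snd (b (Suc p)) = Suc (snd (b p)) \<or>
      fst (b p) = Suc (fst (b (Suc p))) \<and> snd (b (Suc p)) = snd (b p)" if p: "Suc p < n" for p
  proof -
    have p': "p < n" using p by simp
    have "content (b p) \<le> a + int p" "a + int p < content (b (Suc p))" using b(2)[OF p'] b(2)[OF p] by auto
    from connected_content_step[OF conn b(1)[OF p'] b(1)[OF p] this]
    obtain u v where uv: "u \<in> D" "v \<in> D" "adjacent u v" "content u = a + int p" "content v = a + int p + 1"
      by blast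
    have "u = b p" using border_content_inj[OF D uv(1) b(1)[of p]] uv(4) b(2)[of p] p by simp
    moreover have "v = b (Suc p)" using border_content_inj[OF D uv(2) b(1)[OF p]] uv(5) b(2)[OF p] by simp
    ultimately show ?thesis using uv(3-5) unfolding adjacent_def content_def by auto
  qed
  define S where "S = {s \<in> {1..<n}. fst (b (s - 1)) = Suc (fst (b s))}"
  have S: "S \<subseteq> {1..<n}" by (auto simp: S_def)
  note Sf = S_fin[OF S n]
  have pos: "fst (b p) + steps S p = fst (b 0) \<and> snd (b p) + steps S p = snd (b 0) + p" if "p < n" for p
    using that
  proof (induction p)
    case 0
    then show ?case using steps_0[OF S n] by simp
  next
    case (Suc p)
    then have ih: "fst (b p) + steps S p = fst (b 0)" "snd (b p) + steps S p = snd (b 0) + p" by auto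
    have mem: "Suc p \<in> S \<longleftrightarrow> fst (b p) = Suc (fst (b (Suc p)))" using Suc.prems by (auto simp: S_def)
    from step[OF Suc.prems] show ?case
    proof (elim disjE conjE)
      assume *: "fst (b (Suc p)) = fst (b p)" "snd (b (Suc p)) = Suc (snd (b p))"
      then have "steps S (Suc p) = steps S p" using mem steps_Suc[OF Sf(1), of p] by simp
      then show ?case using ih * by (intro conjI) linarith+
    next
      assume *: "fst (b p) = Suc (fst (b (Suc p)))" "snd (b (Suc p)) = snd (b p)"
      then have "steps S (Suc p) = Suc (steps S p)" using mem steps_Suc[OF Sf(1), of p] by simp
      then show ?case using ih * by (intro conjI) linarith+
    qed
  qed
  \<comment> \<open>Columns do not decrease and rows do not increase along the path, so column 0 is
    met by its first box and row 0 by its last.\<close>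
  have s0: "snd (b 0) = 0"
  proof -
    obtain p where p: "p < n" "snd (b p) = 0" using D0(2) unfolding Db by auto
    then show ?thesis using pos[OF p(1)] steps_le[OF Sf(2), of p] by simp
  qed
  have f0: "fst (b 0) = card S"
  proof -
    obtain p where p: "p < n" "fst (b p) = 0" using D0(1) unfolding Db by auto
    have "steps S p \<le> steps S (n - 1)" using p by (intro steps_mono[OF Sf(1)]) simp
    then show ?thesis using pos[OF p(1)] pos[of "n - 1"] p n steps_last[OF S n] by simp
  qed
  have "b p = box_at S p" if "p < n" for p
  proof -
    have "fst (b p) + steps S p = card S" "snd (b p) + steps S p = p" using pos[OF that] s0 f0 by auto
    then have "fst (b p) = card S - steps S p" "snd (b p) = p - steps S p" by linarith+
    then show ?thesis by (simp add: box_at_def prod_eq_iff)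
  qed
  then have "D = ribbon n S" unfolding Db ribbon_def by (intro image_cong) auto
  then show ?thesis using S by blast
qed

theorem border_shapes_eq:
  assumes n: "n \<ge> 1"
  shows "border_shapes n (t + 1) = ribbon n ` {S. S \<subseteq> {1..<n} \<and> card S = t}"
proof (intro equalityI subsetI)
  fix D assume D: "D \<in> border_shapes n (t + 1)"
  then obtain S where S: "S \<subseteq> {1..<n}" "D = ribbon n S"
    using border_shape_ribbon[OF n, of D] unfolding border_shapes_def by blast
  moreover have "card (fst ` D) = t + 1" using D by (simp add: border_shapes_def)
  then have "card S = t" using fst_ribbon[OF S(1) n] S(2) by simp
  ultimately show "D \<in> ribbon n ` {S. S \<subseteq> {1..<n} \<and> card S = t}" by blast
next
  fix D assume "D \<in> ribbon n ` {S. S \<subseteq> {1..<n} \<and> card S = t}"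
  then show "D \<in> border_shapes n (t + 1)" using ribbon_border[OF _ n] by auto
qed

corollary foulkes_eq:
  assumes n: "n \<ge> 1" and \<pi>: "\<pi> permutes {1..n}"
  shows "foulkes n t \<pi> = (\<Sum>S | S \<subseteq> {1..<n} \<and> card S = t. kernel_trace n S S \<pi>)"
proof -
  have "foulkes n t \<pi> = (\<Sum>S | S \<subseteq> {1..<n} \<and> card S = t. specht_character n (ribbon n S) \<pi>)"
  proof -
    have "inj_on (ribbon n) {S. S \<subseteq> {1..<n} \<and> card S = t}"
      by (rule inj_onI, rule ribbon_inj[OF n]) auto
    then show ?thesis unfolding foulkes_def border_shapes_eq[OF n] by (simp add: sum.reindex)
  qed
  also have "\<dots> = (\<Sum>S | S \<subseteq> {1..<n} \<and> card S = t. kernel_trace n S S \<pi>)"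
    using specht_character_ribbon[OF _ \<pi>] by (intro sum.cong) auto
  finally show ?thesis .
qed

section \<open>The Worpitzky identity for Foulkes characters\<close>

definition invariant_colourings :: "nat \<Rightarrow> (nat \<Rightarrow> nat) \<Rightarrow> 'a set \<Rightarrow> (nat \<Rightarrow> 'a) set" where
  "invariant_colourings n \<pi> X = {g \<in> {1..n} \<rightarrow>\<^sub>E X. \<forall>p\<in>{1..n}. g (\<pi> p) = g p}"

definition invariant_surjections :: "nat \<Rightarrow> (nat \<Rightarrow> nat) \<Rightarrow> 'a set \<Rightarrow> (nat \<Rightarrow> 'a) set" where
  "invariant_surjections n \<pi> X = {g \<in> invariant_colourings n \<pi> X. g ` {1..n} = X}"

definition fixed_chains :: "nat \<Rightarrow> (nat \<Rightarrow> nat) \<Rightarrow> nat set \<Rightarrow> (nat \<Rightarrow> nat set) set" where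
  "fixed_chains n \<pi> S = {C \<in> chains n S. (\<lambda>s. \<pi> ` C s) = C}"

lemma invariant_on_orbit:
  assumes g: "\<And>p. p \<in> A \<Longrightarrow> g (\<pi> p) = g p" and \<pi>: "\<pi> permutes A" and p: "p \<in> A" and q: "q \<in> orbit \<pi> p"
  shows "g q = g p"
  using q
proof induction
  case base
  show ?case using g[OF p] .
next
  case (step q)
  then have "q \<in> A" using permutes_orbit_subset[OF \<pi> p] by blast
  then show ?case using g step.IH by simp
qed

text \<open>An invariant colouring is the same as a colouring of the set of orbits.\<close>

lemma card_invariant_colourings:
  assumes \<pi>: "\<pi> permutes {1..n}" and X: "finite X"
  shows "card (invariant_colourings n \<pi> X) = card X ^ card (orbit \<pi> ` {1..n})"
proof -
  let ?O = "orbit \<pi> ` {1..n}"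
  have perm: "permutation \<pi>" using \<pi> permutes_imp_permutation by blast
  define \<Phi> where "\<Phi> \<psi> = restrict (\<lambda>p. \<psi> (orbit \<pi> p)) {1..n}" for \<psi> :: "nat set \<Rightarrow> 'a"
  have "bij_betw \<Phi> (?O \<rightarrow>\<^sub>E X) (invariant_colourings n \<pi> X)"
  proof (rule bij_betw_imageI)
    show "inj_on \<Phi> (?O \<rightarrow>\<^sub>E X)"
    proof (rule inj_onI)
      fix \<psi> \<psi>' assume a: "\<psi> \<in> ?O \<rightarrow>\<^sub>E X" "\<psi>' \<in> ?O \<rightarrow>\<^sub>E X" "\<Phi> \<psi> = \<Phi> \<psi>'"
      show "\<psi> = \<psi>'"
      proof (rule PiE_ext[OF a(1,2)])
        fix Q assume "Q \<in> ?O"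
        then obtain p where p: "p \<in> {1..n}" "Q = orbit \<pi> p" by blast
        have "\<Phi> \<psi> p = \<Phi> \<psi>' p" using a(3) by simp
        then show "\<psi> Q = \<psi>' Q" using p by (simp only: \<Phi>_def restrict_apply if_True)
      qed
    qed
    show "\<Phi> ` (?O \<rightarrow>\<^sub>E X) = invariant_colourings n \<pi> X"
    proof (intro equalityI subsetI)
      fix g assume "g \<in> \<Phi> ` (?O \<rightarrow>\<^sub>E X)"
      then obtain \<psi> where \<psi>: "\<psi> \<in> ?O \<rightarrow>\<^sub>E X" "g = \<Phi> \<psi>" by blast
      have "\<Phi> \<psi> (\<pi> p) = \<Phi> \<psi> p" if "p \<in> {1..n}" for p
        using that permutes_in_image[OF \<pi>, of p] permutation_orbit_step[OF perm, of p]
        by (simp only: \<Phi>_def restrict_apply if_True)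
      moreover have "\<Phi> \<psi> \<in> {1..n} \<rightarrow>\<^sub>E X"
        using PiE_mem[OF \<psi>(1)] unfolding \<Phi>_def by auto
      ultimately show "g \<in> invariant_colourings n \<pi> X" unfolding invariant_colourings_def \<psi>(2) by blast
    next
      fix g assume "g \<in> invariant_colourings n \<pi> X"
      then have g: "g \<in> {1..n} \<rightarrow>\<^sub>E X" "\<And>p. p \<in> {1..n} \<Longrightarrow> g (\<pi> p) = g p"
        unfolding invariant_colourings_def by auto
      define \<psi> where "\<psi> = restrict (\<lambda>Q. g (SOME q. q \<in> Q)) ?O"
      have val: "\<psi> (orbit \<pi> p) = g p" if p: "p \<in> {1..n}" for p
      proof -
        have "(SOME q. q \<in> orbit \<pi> p) \<in> orbit \<pi> p"
          using permutation_self_in_orbit[OF perm, of p] by (rule someI)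
        from invariant_on_orbit[of "{1..n}" g, OF g(2) \<pi> p this] show ?thesis using p by (simp add: \<psi>_def)
      qed
      have "\<psi> \<in> ?O \<rightarrow>\<^sub>E X"
      proof
        fix Q assume "Q \<in> ?O"
        then obtain p where "p \<in> {1..n}" "Q = orbit \<pi> p" by blast
        then show "\<psi> Q \<in> X" using val PiE_mem[OF g(1)] by metis
      qed (simp add: \<psi>_def)
      moreover have "\<Phi> \<psi> = g"
      proof
        fix p
        show "\<Phi> \<psi> p = g p"
        proof (cases "p \<in> {1..n}")
          case True
          then show ?thesis using val[OF True] by (simp only: \<Phi>_def restrict_apply if_True)
        next
          case False
          then show ?thesis using PiE_arb[OF g(1) False] by (simp only: \<Phi>_def restrict_apply if_False)
        qed
      qed
      ultimately show "g \<in> \<Phi> ` (?O \<rightarrow>\<^sub>E X)" by blast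
    qed
  qed
  then have "card (invariant_colourings n \<pi> X) = card (?O \<rightarrow>\<^sub>E X)" by (simp add: bij_betw_same_card)
  then show ?thesis using X by (simp add: card_funcsetE)
qed

lemma invariant_surjectionsD:
  assumes "g \<in> invariant_surjections n \<pi> X"
  shows "g \<in> {1..n} \<rightarrow>\<^sub>E X" "p \<in> {1..n} \<Longrightarrow> g (\<pi> p) = g p" "g ` {1..n} = X"
  using assms unfolding invariant_surjections_def invariant_colourings_def by blast+

lemma finite_invariant_surjections: "finite X \<Longrightarrow> finite (invariant_surjections n \<pi> X)"
  by (rule finite_subset[of _ "{1..n} \<rightarrow>\<^sub>E X"])
     (auto simp: invariant_surjections_def invariant_colourings_def intro: finite_PiE)

lemma card_invariant_surjections_le:
  assumes \<pi>: "\<pi> permutes {1..n}" and e: "bij_betw e X Y" and Y: "finite Y"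
  shows "card (invariant_surjections n \<pi> X) \<le> card (invariant_surjections n \<pi> Y)"
proof (rule card_inj_on_le[where f = "\<lambda>g. restrict (\<lambda>p. e (g p)) {1..n}"])
  show "inj_on (\<lambda>g. restrict (\<lambda>p. e (g p)) {1..n}) (invariant_surjections n \<pi> X)"
  proof (rule inj_onI)
    fix g h assume g: "g \<in> invariant_surjections n \<pi> X" and h: "h \<in> invariant_surjections n \<pi> X"
      and eq: "restrict (\<lambda>p. e (g p)) {1..n} = restrict (\<lambda>p. e (h p)) {1..n}"
    show "g = h"
    proof (rule PiE_ext[OF invariant_surjectionsD(1)[OF g] invariant_surjectionsD(1)[OF h]])
      fix p assume p: "p \<in> {1..n}"
      then have "e (g p) = e (h p)" using fun_cong[OF eq, of p] by (simp only: restrict_apply if_True)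
      moreover have "g p \<in> X" "h p \<in> X"
        using p PiE_mem[OF invariant_surjectionsD(1)[OF g]] PiE_mem[OF invariant_surjectionsD(1)[OF h]] by blast+
      ultimately show "g p = h p" using e unfolding bij_betw_def by (meson inj_onD)
    qed
  qed
  show "(\<lambda>g. restrict (\<lambda>p. e (g p)) {1..n}) ` invariant_surjections n \<pi> X \<subseteq> invariant_surjections n \<pi> Y"
  proof (rule image_subsetI)
    fix g assume g: "g \<in> invariant_surjections n \<pi> X"
    let ?h = "restrict (\<lambda>p. e (g p)) {1..n}"
    have "?h ` {1..n} = e ` g ` {1..n}" by (simp add: image_image)
    also have "\<dots> = Y" using invariant_surjectionsD(3)[OF g] e by (simp add: bij_betw_def)
    finally have im: "?h ` {1..n} = Y" .
    moreover have "?h \<in> {1..n} \<rightarrow>\<^sub>E Y" using im by auto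
    moreover have "?h (\<pi> p) = ?h p" if "p \<in> {1..n}" for p
      using that permutes_in_image[OF \<pi>, of p] invariant_surjectionsD(2)[OF g that]
      by (simp only: restrict_apply if_True)
    ultimately show "?h \<in> invariant_surjections n \<pi> Y"
      unfolding invariant_surjections_def invariant_colourings_def by blast
  qed
qed (rule finite_invariant_surjections[OF Y])

lemma card_invariant_surjections_cong:
  assumes \<pi>: "\<pi> permutes {1..n}" and fin: "finite X" "finite Y" and c: "card X = card Y"
  shows "card (invariant_surjections n \<pi> X) = card (invariant_surjections n \<pi> Y)"
proof -
  obtain e where e: "bij_betw e X Y" using finite_same_card_bij[OF fin c] by blast
  show ?thesis
    using card_invariant_surjections_le[OF \<pi> e fin(2)]
      card_invariant_surjections_le[OF \<pi> bij_betw_inv_into[OF e] fin(1)] by (rule le_antisym)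
qed

section \<open>Invariant surjections and fixed chains\<close>

definition sublevel :: "nat \<Rightarrow> (nat \<Rightarrow> nat) \<Rightarrow> nat \<Rightarrow> nat set" where
  "sublevel n h c = {p \<in> {1..n}. h p < c}"

lemma card_sublevel_less:
  assumes im: "h ` {1..n} = {..k}" and c: "c < c'" "c' \<le> Suc k"
  shows "card (sublevel n h c) < card (sublevel n h c')"
proof -
  have "c \<in> h ` {1..n}" unfolding im using c by simp
  then obtain p where p: "p \<in> {1..n}" "h p = c" by blast
  have "p \<in> sublevel n h c'" "p \<notin> sublevel n h c" "sublevel n h c \<subseteq> sublevel n h c'"
    using p c by (auto simp: sublevel_def)
  then have "sublevel n h c \<subset> sublevel n h c'" by blast
  then show ?thesis by (intro psubset_card_mono) (simp_all add: sublevel_def)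
qed

text \<open>The number of \<open>q\<close> with \<open>h q \<le> h p\<close> decides whether
  \<open>p\<close> belongs to a sublevel set of given size. This allows \<open>level_chain\<close>
  to be defined from the size \<open>s\<close> alone, without reference to the level.\<close>

lemma sublevel_by_card:
  assumes im: "h ` {1..n} = {..k}" and c: "c \<le> k"
  shows "{p \<in> {1..n}. card {q \<in> {1..n}. h q \<le> h p} \<le> card (sublevel n h c)} = sublevel n h c"
proof -
  have "card {q \<in> {1..n}. h q \<le> h p} \<le> card (sublevel n h c) \<longleftrightarrow> h p < c" if p: "p \<in> {1..n}" for p
  proof
    assume "h p < c"
    then have "{q \<in> {1..n}. h q \<le> h p} \<subseteq> sublevel n h c" by (auto simp: sublevel_def)
    then show "card {q \<in> {1..n}. h q \<le> h p} \<le> card (sublevel n h c)"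
      by (intro card_mono) (simp_all add: sublevel_def)
  next
    assume le: "card {q \<in> {1..n}. h q \<le> h p} \<le> card (sublevel n h c)"
    show "h p < c"
    proof (rule ccontr)
      assume "\<not> h p < c"
      moreover have "h p \<in> {..k}" using p im by blast
      ultimately have "card (sublevel n h c) < card (sublevel n h (Suc (h p)))"
        by (intro card_sublevel_less[OF im]) auto
      moreover have "sublevel n h (Suc (h p)) = {q \<in> {1..n}. h q \<le> h p}"
        by (auto simp: sublevel_def)
      ultimately show False using le by simp
    qed
  qed
  then show ?thesis unfolding sublevel_def by blast
qed

definition chain_rank :: "nat \<Rightarrow> nat set \<Rightarrow> (nat \<Rightarrow> nat set) \<Rightarrow> nat \<Rightarrow> nat" where
  "chain_rank n S C = restrict (\<lambda>p. card {s \<in> S. p \<notin> C s}) {1..n}"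

text \<open>The inverse of the passage from a chain to its rank function.\<close>

definition level_sizes :: "nat \<Rightarrow> nat \<Rightarrow> (nat \<Rightarrow> nat) \<Rightarrow> nat set" where
  "level_sizes n k h = (\<lambda>c. card (sublevel n h c)) ` {1..k}"

definition level_chain :: "nat \<Rightarrow> nat \<Rightarrow> (nat \<Rightarrow> nat) \<Rightarrow> nat \<Rightarrow> nat set" where
  "level_chain n k h s = (if s \<in> level_sizes n k h then {p \<in> {1..n}. card {q \<in> {1..n}. h q \<le> h p} \<le> s} else {})"

lemma chain_rank_sublevel:
  assumes S: "S \<subseteq> {1..<n}" and C: "C \<in> chains n S" and s: "s \<in> S"
  shows "sublevel n (chain_rank n S C) (steps S s) = C s"
proof -
  have fin: "finite S" using S finite_subset by blast
  have "p \<in> C s \<longleftrightarrow> chain_rank n S C p < steps S s" if "p \<in> {1..n}" for p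
    unfolding chain_mem_iff[OF C fin s] chain_rank_def using that by simp
  then show ?thesis unfolding sublevel_def using chainsD(1)[OF C s] by blast
qed

lemma steps_image:
  assumes S: "S \<subseteq> {1..<n}"
  shows "steps S ` S = {1..card S}"
proof (rule card_subset_eq)
  have fin: "finite S" using S finite_subset by blast
  have "0 < steps S s" if "s \<in> S" for s
    unfolding steps_def using fin that by (subst card_gt_0_iff) auto
  then show "steps S ` S \<subseteq> {1..card S}" using steps_le_card[OF fin] by (auto simp: Suc_le_eq)
  have "inj_on (steps S) S"
  proof (rule inj_onI)
    fix s t assume "s \<in> S" "t \<in> S" "steps S s = steps S t"
    then have "\<not> s < t" "\<not> t < s" using steps_less_iff[OF fin, of t s] steps_less_iff[OF fin, of s t] by auto
    then show "s = t" by simp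
  qed
  then show "card (steps S ` S) = card {1..card S}" by (simp add: card_image)
qed simp

text \<open>The sublevel sets have the sizes 0, the elements of \<open>S\<close> in increasing
  order, and \<open>n\<close>. As \<open>S\<close> lies strictly between 0 and \<open>n\<close>,
  these sizes are strictly increasing, so every rank is attained.\<close>

lemma chain_rank_surjection:
  assumes n: "n \<ge> 1" and S: "S \<subseteq> {1..<n}" and \<pi>: "\<pi> permutes {1..n}" and C: "C \<in> fixed_chains n \<pi> S"
  shows "chain_rank n S C \<in> invariant_surjections n \<pi> {..card S}"
proof -
  have fin: "finite S" using S finite_subset by blast
  have Cc: "C \<in> chains n S" and Cf: "\<And>s. \<pi> ` C s = C s"
    using C unfolding fixed_chains_def by (auto dest: fun_cong)
  let ?h = "chain_rank n S C"
  have le: "?h p \<le> card S" if "p \<in> {1..n}" for p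
    using that fin by (simp add: chain_rank_def card_mono)
  have ext: "?h \<in> {1..n} \<rightarrow>\<^sub>E {..card S}"
    using le by (auto simp: chain_rank_def PiE_def)
  have inv: "?h (\<pi> p) = ?h p" if p: "p \<in> {1..n}" for p
  proof -
    have "\<pi> p \<in> C s \<longleftrightarrow> p \<in> C s" for s
      using Cf[of s] inj_image_mem_iff[OF permutes_inj[OF \<pi>], of p "C s"] by simp
    moreover have "\<pi> p \<in> {1..n}" using p permutes_in_image[OF \<pi>] by blast
    ultimately show ?thesis using p by (simp add: chain_rank_def)
  qed
  define v where "v c = card (sublevel n ?h c)" for c
  have vs: "v (steps S s) = s" if "s \<in> S" for s
    unfolding v_def chain_rank_sublevel[OF S Cc that] by (rule chainsD(2)[OF Cc that])
  have v0: "v 0 = 0" by (simp add: v_def sublevel_def)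
  have vn: "v (Suc (card S)) = n"
  proof -
    have "sublevel n ?h (Suc (card S)) = {1..n}" using le by (auto simp: sublevel_def less_Suc_eq_le)
    then show ?thesis by (simp add: v_def)
  qed
  have at: "\<exists>s\<in>S. steps S s = c" if "c \<in> {1..card S}" for c
    using that unfolding steps_image[OF S, symmetric] by auto
  have vless: "v c < v (Suc c)" if c: "c \<le> card S" for c
  proof -
    have lo: "c = 0 \<or> (\<exists>s\<in>S. steps S s = c)" using at[of c] c by (cases "c = 0") auto
    have hi: "c = card S \<or> (\<exists>s\<in>S. steps S s = Suc c)" using at[of "Suc c"] c by (cases "c = card S") auto
    have vlo: "v c < n" "\<And>t. t \<in> S \<Longrightarrow> steps S t = Suc c \<Longrightarrow> v c < t"
    proof -
      show "v c < n" using lo v0 vs n S by fastforce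
      fix t assume t: "t \<in> S" "steps S t = Suc c"
      from lo show "v c < t"
      proof
        assume "c = 0"
        then show ?thesis using v0 t S by auto
      next
        assume "\<exists>s\<in>S. steps S s = c"
        then obtain s where "s \<in> S" "steps S s = c" by blast
        then show ?thesis using steps_less_iff[OF fin t(1), of s] vs t(2) by auto
      qed
    qed
    from hi show ?thesis
    proof
      assume "c = card S"
      then show ?thesis using vlo(1) vn by simp
    next
      assume "\<exists>s\<in>S. steps S s = Suc c"
      then obtain s where s: "s \<in> S" "steps S s = Suc c" by blast
      then show ?thesis using vlo(2)[OF s] vs[OF s(1)] by simp
    qed
  qed
  have "{..card S} \<subseteq> ?h ` {1..n}"
  proof
    fix c assume c: "c \<in> {..card S}"
    show "c \<in> ?h ` {1..n}"
    proof (rule ccontr)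
      assume "c \<notin> ?h ` {1..n}"
      then have "sublevel n ?h (Suc c) = sublevel n ?h c" by (auto simp: sublevel_def less_Suc_eq)
      then have "v (Suc c) = v c" by (simp only: v_def)
      then show False using vless[of c] c by simp
    qed
  qed
  moreover have "?h ` {1..n} \<subseteq> {..card S}" using le by auto
  ultimately show ?thesis
    using ext inv unfolding invariant_surjections_def invariant_colourings_def by blast
qed

lemma level_sizes_inj:
  assumes "h ` {1..n} = {..k}"
  shows "inj_on (\<lambda>c. card (sublevel n h c)) {..Suc k}"
proof (rule inj_onI)
  fix c c' assume c: "c \<in> {..Suc k}" "c' \<in> {..Suc k}" "card (sublevel n h c) = card (sublevel n h c')"
  then have "\<not> c < c'" "\<not> c' < c" using card_sublevel_less[OF assms, of c c'] card_sublevel_less[OF assms, of c' c] by auto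
  then show "c = c'" by simp
qed

lemma level_chain_sublevel:
  assumes "h ` {1..n} = {..k}" "c \<in> {1..k}"
  shows "level_chain n k h (card (sublevel n h c)) = sublevel n h c"
  using assms sublevel_by_card[OF assms(1), of c] by (auto simp: level_chain_def level_sizes_def)

lemma level_chain_fixed:
  assumes \<pi>: "\<pi> permutes {1..n}" and h: "h \<in> invariant_surjections n \<pi> {..k}"
  shows "level_sizes n k h \<subseteq> {1..<n}" "card (level_sizes n k h) = k"
    "level_chain n k h \<in> fixed_chains n \<pi> (level_sizes n k h)"
    "chain_rank n (level_sizes n k h) (level_chain n k h) = h"
proof -
  let ?S = "level_sizes n k h" and ?C = "level_chain n k h"
  note im = invariant_surjectionsD(3)[OF h]
  have inj: "inj_on (\<lambda>c. card (sublevel n h c)) {1..k}"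
    by (rule inj_on_subset[OF level_sizes_inj[OF im]]) auto
  show "?S \<subseteq> {1..<n}"
  proof
    fix s assume "s \<in> ?S"
    then obtain c where c: "c \<in> {1..k}" "s = card (sublevel n h c)" unfolding level_sizes_def by blast
    have "card (sublevel n h 0) < s" unfolding c(2) using c(1) by (intro card_sublevel_less[OF im]) auto
    moreover have "s < card (sublevel n h (Suc k))" unfolding c(2) using c(1) by (intro card_sublevel_less[OF im]) auto
    moreover have "card (sublevel n h (Suc k)) \<le> card {1..n}"
      unfolding sublevel_def by (intro card_mono) auto
    ultimately show "s \<in> {1..<n}" by simp
  qed
  show "card ?S = k" unfolding level_sizes_def using inj by (simp add: card_image)
  have lev: "\<exists>c\<in>{1..k}. s = card (sublevel n h c) \<and> ?C s = sublevel n h c" if "s \<in> ?S" for s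
    using that level_chain_sublevel[OF im] unfolding level_sizes_def by blast
  have "\<pi> ` sublevel n h c = sublevel n h c" for c
  proof (rule card_subset_eq)
    show "finite (sublevel n h c)" by (simp add: sublevel_def)
    show "\<pi> ` sublevel n h c \<subseteq> sublevel n h c"
      using invariant_surjectionsD(2)[OF h] permutes_in_image[OF \<pi>] unfolding sublevel_def by fastforce
    show "card (\<pi> ` sublevel n h c) = card (sublevel n h c)"
      using permutes_inj[OF \<pi>] by (intro card_image) (auto intro: inj_on_subset)
  qed
  then have "\<pi> ` ?C s = ?C s" for s
    using lev[of s] by (cases "s \<in> ?S") (auto simp: level_chain_def)
  moreover have "?C \<in> chains n ?S"
    unfolding chains_def
  proof (intro CollectI conjI ballI allI impI)
    fix s assume s: "s \<in> ?S"
    show "?C s \<subseteq> {1..n}" by (auto simp: level_chain_def)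
    show "card (?C s) = s" using lev[OF s] by auto
    fix t assume "t \<in> ?S" "s < t"
    then show "?C s \<subseteq> ?C t" using s by (auto simp: level_chain_def)
  next
    fix s assume "s \<notin> ?S"
    then show "?C s = {}" by (simp add: level_chain_def)
  qed
  ultimately show "?C \<in> fixed_chains n \<pi> ?S" unfolding fixed_chains_def by blast
  show "chain_rank n ?S ?C = h"
  proof
    fix p
    show "chain_rank n ?S ?C p = h p"
    proof (cases "p \<in> {1..n}")
      case True
      \<comment> \<open>Different levels have different sizes, so the members that miss
        \<open>p\<close> can be counted by their levels, which are
        \<open>1, \<dots>, h p\<close>.\<close>
      have "{s \<in> ?S. p \<notin> ?C s} = (\<lambda>c. card (sublevel n h c)) ` {c \<in> {1..k}. p \<notin> sublevel n h c}"
        using level_chain_sublevel[OF im] unfolding level_sizes_def by auto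
      moreover have "{c \<in> {1..k}. p \<notin> sublevel n h c} \<subseteq> {1..k}" by auto
      ultimately have "card {s \<in> ?S. p \<notin> ?C s} = card {c \<in> {1..k}. p \<notin> sublevel n h c}"
        using card_image[OF inj_on_subset[OF inj]] by (simp only:)
      also have "{c \<in> {1..k}. p \<notin> sublevel n h c} = {1..h p}"
      proof -
        have "h p \<le> k" using True im by blast
        then show ?thesis using True by (auto simp: sublevel_def)
      qed
      finally show ?thesis using True by (simp add: chain_rank_def)
    next
      case False
      then show ?thesis using PiE_arb[OF invariant_surjectionsD(1)[OF h] False] by (simp only: chain_rank_def restrict_apply if_False)
    qed
  qed
qed

lemma card_invariant_surjections:
  assumes n: "n \<ge> 1" and \<pi>: "\<pi> permutes {1..n}"
  shows "card (invariant_surjections n \<pi> {..k}) = (\<Sum>S | S \<subseteq> {1..<n} \<and> card S = k. card (fixed_chains n \<pi> S))"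
proof -
  let ?T = "Sigma {S. S \<subseteq> {1..<n} \<and> card S = k} (fixed_chains n \<pi>)"
  have "bij_betw (\<lambda>(S, C). chain_rank n S C) ?T (invariant_surjections n \<pi> {..k})"
  proof (rule bij_betw_byWitness[where f' = "\<lambda>h. (level_sizes n k h, level_chain n k h)"])
    show "\<forall>h\<in>invariant_surjections n \<pi> {..k}. (\<lambda>(S, C). chain_rank n S C) (level_sizes n k h, level_chain n k h) = h"
      using level_chain_fixed(4)[OF \<pi>] by simp
    show "(\<lambda>(S, C). chain_rank n S C) ` ?T \<subseteq> invariant_surjections n \<pi> {..k}"
      using chain_rank_surjection[OF n _ \<pi>] by auto
    show "(\<lambda>h. (level_sizes n k h, level_chain n k h)) ` invariant_surjections n \<pi> {..k} \<subseteq> ?T"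
      using level_chain_fixed(1-3)[OF \<pi>] by auto
    show "\<forall>a\<in>?T. (\<lambda>h. (level_sizes n k h, level_chain n k h)) ((\<lambda>(S, C). chain_rank n S C) a) = a"
    proof
      fix a assume "a \<in> ?T"
      then obtain S C where a: "a = (S, C)" and S: "S \<subseteq> {1..<n}" "k = card S" and C: "C \<in> fixed_chains n \<pi> S"
        by auto
      have Cc: "C \<in> chains n S" using C by (simp add: fixed_chains_def)
      let ?h = "chain_rank n S C"
      have im: "?h ` {1..n} = {..card S}"
        by (rule invariant_surjectionsD(3)[OF chain_rank_surjection[OF n S(1) \<pi> C]])
      have v: "card (sublevel n ?h (steps S s)) = s" if "s \<in> S" for s
        unfolding chain_rank_sublevel[OF S(1) Cc that] by (rule chainsD(2)[OF Cc that])
      have LS: "level_sizes n (card S) ?h = S"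
        unfolding level_sizes_def steps_image[OF S(1), symmetric] image_image using v by auto
      have "level_chain n (card S) ?h s = C s" for s
      proof (cases "s \<in> S")
        case True
        then have "steps S s \<in> {1..card S}" using steps_image[OF S(1)] by blast
        from level_chain_sublevel[OF im this] show ?thesis
          unfolding chain_rank_sublevel[OF S(1) Cc True] chainsD(2)[OF Cc True] .
      next
        case False
        then show ?thesis using chainsD(6)[OF Cc False] by (simp only: level_chain_def LS if_False)
      qed
      then have "level_chain n (card S) ?h = C" by (rule ext)
      then show "(\<lambda>h. (level_sizes n k h, level_chain n k h)) ((\<lambda>(S, C). chain_rank n S C) a) = a"
        unfolding a S(2) using LS by simp
    qed
  qed
  then have "card (invariant_surjections n \<pi> {..k}) = card ?T" by (simp add: bij_betw_same_card)
  also have "\<dots> = (\<Sum>S | S \<subseteq> {1..<n} \<and> card S = k. card (fixed_chains n \<pi> S))"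
  proof (rule card_SigmaI)
    show "finite {S. S \<subseteq> {1..<n} \<and> card S = k}" by (rule finite_subset[of _ "Pow {1..<n}"]) auto
    show "\<forall>S\<in>{S. S \<subseteq> {1..<n} \<and> card S = k}. finite (fixed_chains n \<pi> S)"
    proof
      fix S assume "S \<in> {S. S \<subseteq> {1..<n} \<and> card S = k}"
      then have "finite S" using finite_subset by blast
      then show "finite (fixed_chains n \<pi> S)" unfolding fixed_chains_def using finite_chains by simp
    qed
  qed
  finally show ?thesis .
qed

text \<open>Colourings are sorted by the set \<open>I\<close> of colours in use, and their number
  depends on \<open>card I\<close> only. A chain with \<open>card S\<close> members has
  \<open>card S + 1\<close> blocks, whence the index of the binomial.\<close>

lemma power_cycles_chains:
  assumes n: "n \<ge> 1" and \<pi>: "\<pi> permutes {1..n}"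
  shows "x ^ card (orbit \<pi> ` {1..n}) = (\<Sum>S\<in>Pow {1..<n}. (x choose (card S + 1)) * card (fixed_chains n \<pi> S))"
proof -
  have fin: "finite (invariant_colourings n \<pi> {..<x})"
    by (rule finite_subset[of _ "{1..n} \<rightarrow>\<^sub>E {..<x}"]) (auto simp: invariant_colourings_def intro: finite_PiE)
  have surj: "card (invariant_surjections n \<pi> I) = (\<Sum>S\<in>Pow {1..<n}. of_bool (card I = card S + 1) * card (fixed_chains n \<pi> S))"
    if I: "I \<subseteq> {..<x}" for I
  proof (cases "card I")
    case 0
    moreover have "finite I" using I by (rule finite_subset) simp
    ultimately have "I = {}" by simp
    have "invariant_surjections n \<pi> I = {}"
    proof (rule ccontr)
      assume "invariant_surjections n \<pi> I \<noteq> {}"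
      then obtain g where "g \<in> invariant_surjections n \<pi> I" by blast
      from invariant_surjectionsD(3)[OF this] \<open>I = {}\<close> n show False by simp
    qed
    then show ?thesis using 0 by simp
  next
    case (Suc k)
    have "card (invariant_surjections n \<pi> I) = card (invariant_surjections n \<pi> {..k})"
      by (rule card_invariant_surjections_cong[OF \<pi>]) (use I finite_subset Suc in auto)
    also have "\<dots> = (\<Sum>S | S \<subseteq> {1..<n} \<and> card S = k. card (fixed_chains n \<pi> S))"
      by (rule card_invariant_surjections[OF n \<pi>])
    also have "\<dots> = (\<Sum>S\<in>Pow {1..<n}. of_bool (card I = card S + 1) * card (fixed_chains n \<pi> S))"
      by (rule sum.mono_neutral_cong_left) (auto simp: Suc)
    finally show ?thesis .
  qed
  have "x ^ card (orbit \<pi> ` {1..n}) = card (invariant_colourings n \<pi> {..<x})"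
    using card_invariant_colourings[OF \<pi>, of "{..<x}"] by simp
  also have "\<dots> = (\<Sum>I\<in>Pow {..<x}. card {g \<in> invariant_colourings n \<pi> {..<x}. g ` {1..n} = I})"
  proof -
    have "(\<Sum>I\<in>Pow {..<x}. \<Sum>g | g \<in> invariant_colourings n \<pi> {..<x} \<and> g ` {1..n} = I. 1) =
      (\<Sum>g\<in>invariant_colourings n \<pi> {..<x}. 1 :: nat)"
      by (rule sum.group[OF fin]) (auto simp: invariant_colourings_def)
    then show ?thesis by simp
  qed
  also have "\<dots> = (\<Sum>I\<in>Pow {..<x}. card (invariant_surjections n \<pi> I))"
  proof (intro sum.cong refl arg_cong[where f = card])
    fix I assume "I \<in> Pow {..<x}"
    then show "{g \<in> invariant_colourings n \<pi> {..<x}. g ` {1..n} = I} = invariant_surjections n \<pi> I"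
      unfolding invariant_surjections_def invariant_colourings_def by (auto simp: PiE_iff)
  qed
  also have "\<dots> = (\<Sum>I\<in>Pow {..<x}. \<Sum>S\<in>Pow {1..<n}. of_bool (card I = card S + 1) * card (fixed_chains n \<pi> S))"
    using surj by (intro sum.cong refl) auto
  also have "\<dots> = (\<Sum>S\<in>Pow {1..<n}. (\<Sum>I\<in>Pow {..<x}. of_bool (card I = card S + 1)) * card (fixed_chains n \<pi> S))"
    unfolding sum_distrib_right by (rule sum.swap)
  also have "\<dots> = (\<Sum>S\<in>Pow {1..<n}. (x choose (card S + 1)) * card (fixed_chains n \<pi> S))"
  proof -
    have "(\<Sum>I\<in>Pow {..<x}. of_bool (card I = m)) = (x choose m)" for m
    proof -
      have "(\<Sum>I\<in>Pow {..<x}. of_bool (card I = m)) = card {I \<in> Pow {..<x}. card I = m}"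
        by (simp add: Int_def)
      also have "\<dots> = (x choose m)" using n_subsets[of "{..<x}" m] by simp
      finally show ?thesis .
    qed
    then show ?thesis by simp
  qed
  finally show ?thesis .
qed

text \<open>Writing \<open>S\<close> as \<open>T\<close> plus \<open>j\<close> of the remaining
  \<open>n - 1 - card T\<close> positions turns the sum into Vandermonde's convolution.\<close>

lemma sum_supersets_choose:
  assumes T: "T \<subseteq> {1..<n}" and n: "n \<ge> 1"
  shows "(\<Sum>S | T \<subseteq> S \<and> S \<subseteq> {1..<n}. x choose (card S + 1)) = (x + n - 1 - card T) choose n"
proof -
  let ?m = "n - 1 - card T"
  have finT: "finite T" using T finite_subset by blast
  have cT: "card T \<le> n - 1" using card_mono[OF _ T] by simp
  have cR: "card ({1..<n} - T) = ?m" using T finT by (simp add: card_Diff_subset)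
  have "(\<Sum>S | T \<subseteq> S \<and> S \<subseteq> {1..<n}. x choose (card S + 1)) =
    (\<Sum>R\<in>Pow ({1..<n} - T). x choose (card T + card R + 1))"
  proof (rule sum.reindex_bij_witness[where i = "\<lambda>R. T \<union> R" and j = "\<lambda>S. S - T"])
    fix S assume S: "S \<in> {S. T \<subseteq> S \<and> S \<subseteq> {1..<n}}"
    then have "finite S" using finite_subset by blast
    then have "card T + card (S - T) = card S" using S finT by (simp add: card_Diff_subset card_mono)
    then show "x choose (card T + card (S - T) + 1) = x choose (card S + 1)" by simp
  qed (use T in auto)
  also have "\<dots> = (\<Sum>j\<le>?m. \<Sum>R | R \<in> Pow ({1..<n} - T) \<and> card R = j. x choose (card T + card R + 1))"
  proof (rule sum.group[symmetric])
    show "card ` Pow ({1..<n} - T) \<subseteq> {..?m}" unfolding cR[symmetric] by (auto intro!: card_mono)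
  qed auto
  also have "\<dots> = (\<Sum>j\<le>?m. (?m choose j) * (x choose (card T + j + 1)))"
  proof (rule sum.cong[OF refl])
    fix j
    have "(\<Sum>R | R \<in> Pow ({1..<n} - T) \<and> card R = j. x choose (card T + card R + 1)) =
      (\<Sum>R | R \<subseteq> {1..<n} - T \<and> card R = j. x choose (card T + j + 1))"
      by (rule sum.cong) auto
    also have "\<dots> = (?m choose j) * (x choose (card T + j + 1))"
      using n_subsets[of "{1..<n} - T" j] cR by simp
    finally show "(\<Sum>R | R \<in> Pow ({1..<n} - T) \<and> card R = j. x choose (card T + card R + 1)) =
      (?m choose j) * (x choose (card T + j + 1))" .
  qed
  also have "\<dots> = (\<Sum>k\<le>?m. (?m choose k) * (x choose (n - k)))"
  proof (rule sum.reindex_bij_witness[where i = "\<lambda>k. ?m - k" and j = "\<lambda>j. ?m - j"])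
    fix j assume j: "j \<in> {..?m}"
    then have "n - (?m - j) = card T + j + 1" using cT n by auto
    moreover have "(?m choose (?m - j)) = (?m choose j)" by (rule binomial_symmetric[symmetric]) (use j in simp)
    ultimately show "(?m choose (?m - j)) * (x choose (n - (?m - j))) = (?m choose j) * (x choose (card T + j + 1))"
      by (simp only:)
  qed auto
  also have "\<dots> = (\<Sum>k\<le>n. (?m choose k) * (x choose (n - k)))"
    by (rule sum.mono_neutral_left) auto
  also have "\<dots> = (?m + x) choose n" by (rule vandermonde)
  also have "?m + x = x + n - 1 - card T" using cT n by simp
  finally show ?thesis .
qed

theorem foulkes_worpitzky:
  assumes n: "n \<ge> 1" and \<pi>: "\<pi> permutes {1..n}"
  shows "of_nat x ^ num_cycles n \<pi> = (\<Sum>t<n. foulkes n t \<pi> * of_nat ((x + n - 1 - t) choose n))"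
proof -
  let ?P = "\<lambda>t. of_nat ((x + n - 1 - t) choose n) :: complex"
  let ?k = "\<lambda>T. kernel_trace n T T \<pi>"
  have fx: "of_nat (card (fixed_chains n \<pi> S)) = (\<Sum>T\<in>Pow S. ?k T)" if S: "S \<subseteq> {1..<n}" for S
    unfolding fixed_chains_def by (rule card_fixed_chains[OF _ _ \<pi>]) (use S finite_subset in auto)
  have "of_nat x ^ num_cycles n \<pi> =
      (\<Sum>S\<in>Pow {1..<n}. of_nat (x choose (card S + 1)) * of_nat (card (fixed_chains n \<pi> S)) :: complex)"
    using arg_cong[OF power_cycles_chains[OF n \<pi>, of x], where f = "of_nat :: nat \<Rightarrow> complex"]
    unfolding num_cycles_def of_nat_power of_nat_sum of_nat_mult .
  also have "\<dots> = (\<Sum>S\<in>Pow {1..<n}. \<Sum>T\<in>Pow S. of_nat (x choose (card S + 1)) * ?k T)"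
    using fx by (intro sum.cong refl) (simp add: sum_distrib_left)
  also have "\<dots> = (\<Sum>S\<in>Pow {1..<n}. \<Sum>T | T \<in> Pow {1..<n} \<and> T \<subseteq> S. of_nat (x choose (card S + 1)) * ?k T)"
    by (intro sum.cong refl) auto
  also have "\<dots> = (\<Sum>T\<in>Pow {1..<n}. \<Sum>S | S \<in> Pow {1..<n} \<and> T \<subseteq> S. of_nat (x choose (card S + 1)) * ?k T)"
    by (rule sum.swap_restrict) auto
  also have "\<dots> = (\<Sum>T\<in>Pow {1..<n}. ?k T * ?P (card T))"
  proof (rule sum.cong[OF refl])
    fix T assume T: "T \<in> Pow {1..<n}"
    have "(\<Sum>S | S \<in> Pow {1..<n} \<and> T \<subseteq> S. of_nat (x choose (card S + 1)) * ?k T) =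
      of_nat (\<Sum>S | T \<subseteq> S \<and> S \<subseteq> {1..<n}. x choose (card S + 1)) * ?k T"
      unfolding of_nat_sum sum_distrib_right by (rule sum.cong) auto
    also have "\<dots> = ?k T * ?P (card T)"
      using sum_supersets_choose[OF _ n, of T x] T by simp
    finally show "(\<Sum>S | S \<in> Pow {1..<n} \<and> T \<subseteq> S. of_nat (x choose (card S + 1)) * ?k T) = ?k T * ?P (card T)" .
  qed
  also have "\<dots> = (\<Sum>t<n. \<Sum>T | T \<in> Pow {1..<n} \<and> card T = t. ?k T * ?P (card T))"
  proof (rule sum.group[symmetric])
    have "card T < n" if "T \<subseteq> {1..<n}" for T using card_mono[OF _ that] n by simp
    then show "card ` Pow {1..<n} \<subseteq> {..<n}" by auto
  qed auto
  also have "\<dots> = (\<Sum>t<n. foulkes n t \<pi> * ?P t)"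
    unfolding foulkes_eq[OF n \<pi>] sum_distrib_right by (intro sum.cong) auto
  finally show ?thesis .
qed

section \<open>The carries chain\<close>

definition small_sums :: "nat \<Rightarrow> nat \<Rightarrow> (nat \<Rightarrow> nat) set" where
  "small_sums n m = {y. (\<forall>p. p \<notin> {1..n} \<longrightarrow> y p = 0) \<and> (\<Sum>p=1..n. y p) < m}"

text \<open>For \<open>m = Suc k\<close> a slack entry, \<open>k\<close> minus the sum of
  \<open>y\<close>, turns the inequality into an equation for \<open>n + 1\<close> naturals with sum
  \<open>k\<close>.\<close>

lemma card_small_sums:
  assumes n: "n \<ge> 1"
  shows "card (small_sums n m) = (m + n - 1) choose n"
proof (cases m)
  case 0
  then show ?thesis using n by (simp add: small_sums_def)
next
  case (Suc k)
  define l where "l y = map y [1..<Suc n] @ [k - (\<Sum>p=1..n. y p)]" for y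
  define f where "f l p = (if p \<in> {1..n} then l ! (p - 1) else 0)" for l :: "nat list" and p
  have sum_l: "sum_list (map y [1..<Suc n]) = (\<Sum>p=1..n. y p)" for y :: "nat \<Rightarrow> nat"
    by (subst sum_list_distinct_conv_sum_set) (auto intro: sum.cong)
  have "bij_betw l (small_sums n m) {xs. length xs = n + 1 \<and> sum_list xs = k}"
  proof (rule bij_betw_byWitness[where f' = f])
    show "\<forall>y\<in>small_sums n m. f (l y) = y"
    proof
      fix y assume y: "y \<in> small_sums n m"
      have "f (l y) p = y p" for p
      proof (cases "p \<in> {1..n}")
        case True
        then obtain q where q: "p = Suc q" "q < n" by (cases p) auto
        then have "l y ! q = y (Suc q)" by (simp add: l_def nth_append del: upt_Suc)
        then show ?thesis using True by (simp only: f_def if_True q(1) diff_Suc_1)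
      next
        case False
        moreover have "y p = 0" using y False unfolding small_sums_def by blast
        ultimately show ?thesis by (simp only: f_def if_False)
      qed
      then show "f (l y) = y" by (rule ext)
    qed
    have sum_f: "(\<Sum>p=1..n. f xs p) = sum_list (take n xs)" if "length xs = n + 1" for xs
    proof -
      have "(\<Sum>p=1..n. f xs p) = (\<Sum>p=1..n. xs ! (p - 1))" by (intro sum.cong) (simp_all add: f_def)
      also have "\<dots> = (\<Sum>p<n. xs ! p)"
        by (rule sum.reindex_bij_witness[where i = Suc and j = "\<lambda>p. p - 1"]) auto
      also have "\<dots> = sum_list (take n xs)"
        using that by (simp add: sum_list_sum_nth atLeast0LessThan)
      finally show ?thesis .
    qed
    have split: "xs = take n xs @ [xs ! n]" if "length xs = n + 1" for xs :: "nat list"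
      using that take_Suc_conv_app_nth[of n xs] by simp
    have sum_xs: "sum_list xs = (\<Sum>p=1..n. f xs p) + xs ! n" if "length xs = n + 1" for xs
      using arg_cong[OF split[OF that], of sum_list] sum_f[OF that] by simp
    show "\<forall>xs\<in>{xs. length xs = n + 1 \<and> sum_list xs = k}. l (f xs) = xs"
    proof
      fix xs assume "xs \<in> {xs. length xs = n + 1 \<and> sum_list xs = k}"
      then have xs: "length xs = n + 1" "sum_list xs = k" by auto
      have "map (f xs) [1..<Suc n] = take n xs"
        by (rule nth_equalityI) (use xs(1) in \<open>auto simp: f_def simp del: upt_Suc\<close>)
      moreover have "k - (\<Sum>p=1..n. f xs p) = xs ! n" using sum_xs[OF xs(1)] xs(2) by simp
      ultimately show "l (f xs) = xs" unfolding l_def using split[OF xs(1)] by (simp only:)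
    qed
    show "l ` small_sums n m \<subseteq> {xs. length xs = n + 1 \<and> sum_list xs = k}"
    proof (rule image_subsetI)
      fix y assume "y \<in> small_sums n m"
      then have "(\<Sum>p=1..n. y p) \<le> k" by (simp add: small_sums_def Suc)
      then have "sum_list (l y) = k" unfolding l_def sum_list_append sum_l by simp
      moreover have "length (l y) = n + 1" by (simp add: l_def)
      ultimately show "l y \<in> {xs. length xs = n + 1 \<and> sum_list xs = k}" by simp
    qed
    show "f ` {xs. length xs = n + 1 \<and> sum_list xs = k} \<subseteq> small_sums n m"
    proof (rule image_subsetI)
      fix xs assume "xs \<in> {xs. length xs = n + 1 \<and> sum_list xs = k}"
      then have xs: "length xs = n + 1" "sum_list xs = k" by auto
      then show "f xs \<in> small_sums n m"
        using sum_xs[OF xs(1)] by (simp add: small_sums_def Suc) (simp add: f_def)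
    qed
  qed
  then have "card (small_sums n m) = card {xs :: nat list. length xs = n + 1 \<and> sum_list xs = k}"
    by (rule bij_betw_same_card)
  also have "\<dots> = (k + n) choose k" by (subst card_length_sum_list) simp
  also have "\<dots> = (k + n) choose n" using binomial_symmetric[of k "k + n"] by simp
  finally show ?thesis using Suc by simp
qed

text \<open>If \<open>i > x\<close>, truncated subtraction makes both sides 0.\<close>

lemma card_small_sums_diff:
  assumes n: "n \<ge> 1"
  shows "card (small_sums n (x - i)) = (x + n - 1 - i) choose n"
proof (cases "i \<le> x")
  case True
  then have "x - i + n - 1 = x + n - 1 - i" using n by simp
  then show ?thesis using card_small_sums[OF n, of "x - i"] by (simp only:)
next
  case False
  then show ?thesis using card_small_sums[OF n, of "x - i"] n by (simp add: binomial_eq_0)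
qed

definition digit_words :: "nat \<Rightarrow> nat \<Rightarrow> (nat \<Rightarrow> nat) set" where
  "digit_words n b = PiE_dflt {1..n} 0 (\<lambda>_. {0..<b})"

lemma digit_words_iff: "U \<in> digit_words n b \<longleftrightarrow> (\<forall>p. (p \<in> {1..n} \<longrightarrow> U p < b) \<and> (p \<notin> {1..n} \<longrightarrow> U p = 0))"
  unfolding digit_words_def PiE_dflt_def by auto

lemma finite_digit_words: "finite (digit_words n b)"
  unfolding digit_words_def by (rule finite_PiE_dflt) auto

lemma carries_card:
  assumes b: "b \<ge> 1"
  shows "real b ^ n * carries n b i k = real (card {U \<in> digit_words n b. (i + (\<Sum>p=1..n. U p)) div b = k})"
proof -
  have ne: "digit_words n b \<noteq> {}"
  proof -
    have "(\<lambda>_. 0) \<in> digit_words n b" using b by (simp add: digit_words_iff)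
    then show ?thesis by blast
  qed
  have c: "card (digit_words n b) = b ^ n"
    unfolding digit_words_def by (subst card_PiE_dflt) auto
  have "Pi_pmf {1..n} 0 (\<lambda>_. pmf_of_set {0..<b}) = pmf_of_set (digit_words n b)"
    unfolding digit_words_def using b by (intro Pi_pmf_of_set) auto
  then have "carries n b i k = real (card (digit_words n b \<inter> {U. (i + (\<Sum>p=1..n. U p)) div b = k})) / real (b ^ n)"
    unfolding carries_def using measure_pmf_of_set[OF ne finite_digit_words] c by simp
  moreover have "digit_words n b \<inter> {U. (i + (\<Sum>p=1..n. U p)) div b = k} = {U \<in> digit_words n b. (i + (\<Sum>p=1..n. U p)) div b = k}"
    by blast
  ultimately show ?thesis using b by simp
qed

text \<open>Division of every summand by \<open>b\<close> with remainder.\<close>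

lemma card_small_sums_digits:
  assumes b: "b \<ge> 1"
  shows "card (small_sums n (b * x - i)) =
    (\<Sum>U\<in>digit_words n b. card (small_sums n (x - (i + (\<Sum>p=1..n. U p)) div b)))"
proof -
  let ?T = "SIGMA U:digit_words n b. small_sums n (x - (i + (\<Sum>p=1..n. U p)) div b)"
  \<comment> \<open>Here the carry appears: \<open>b * x\<close> is a multiple of \<open>b\<close>,
    so the inequality can be divided by \<open>b\<close>, and the remainders contribute only the
    quotient of their sum plus \<open>i\<close>.\<close>
  have key: "(\<Sum>p=1..n. b * q p + U p) < b * x - i \<longleftrightarrow> (\<Sum>p=1..n. q p) < x - (i + (\<Sum>p=1..n. U p)) div b"
    for q U :: "nat \<Rightarrow> nat"
  proof -
    let ?q = "\<Sum>p=1..n. q p" and ?u = "i + (\<Sum>p=1..n. U p)"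
    have "(\<Sum>p=1..n. b * q p + U p) < b * x - i \<longleftrightarrow> ?u + b * ?q < b * x"
      by (auto simp: sum.distrib sum_distrib_left)
    also have "\<dots> \<longleftrightarrow> (?u + b * ?q) div b < x"
      by (subst div_less_iff_less_mult) (use b in \<open>simp_all add: mult.commute\<close>)
    also have "(?u + b * ?q) div b = ?u div b + ?q" using b by simp
    finally show ?thesis by auto
  qed
  have "bij_betw (\<lambda>(U, q) p. b * q p + U p) ?T (small_sums n (b * x - i))"
  proof (rule bij_betw_byWitness[where f' = "\<lambda>y. (\<lambda>p. y p mod b, \<lambda>p. y p div b)"])
    show "\<forall>a\<in>?T. (\<lambda>y. (\<lambda>p. y p mod b, \<lambda>p. y p div b)) ((\<lambda>(U, q) p. b * q p + U p) a) = a"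
    proof
      fix a assume "a \<in> ?T"
      then obtain U q where a: "a = (U, q)" and U: "U \<in> digit_words n b" by auto
      have "U p < b" for p using U b unfolding digit_words_iff by (cases "p \<in> {1..n}") auto
      then show "(\<lambda>y. (\<lambda>p. y p mod b, \<lambda>p. y p div b)) ((\<lambda>(U, q) p. b * q p + U p) a) = a"
        unfolding a using b by simp
    qed
    show "\<forall>y\<in>small_sums n (b * x - i). (\<lambda>(U, q) p. b * q p + U p) (\<lambda>p. y p mod b, \<lambda>p. y p div b) = y"
      by simp
    show "(\<lambda>(U, q) p. b * q p + U p) ` ?T \<subseteq> small_sums n (b * x - i)"
    proof (rule image_subsetI)
      fix a assume "a \<in> ?T"
      then obtain U q where a: "a = (U, q)" and U: "U \<in> digit_words n b"
        and q: "q \<in> small_sums n (x - (i + (\<Sum>p=1..n. U p)) div b)" by auto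
      have "(\<lambda>p. b * q p + U p) \<in> small_sums n (b * x - i)"
        unfolding small_sums_def mem_Collect_eq key using q U unfolding small_sums_def digit_words_iff by simp
      then show "(\<lambda>(U, q) p. b * q p + U p) a \<in> small_sums n (b * x - i)" unfolding a by simp
    qed
    show "(\<lambda>y. (\<lambda>p. y p mod b, \<lambda>p. y p div b)) ` small_sums n (b * x - i) \<subseteq> ?T"
    proof (rule image_subsetI)
      fix y assume y: "y \<in> small_sums n (b * x - i)"
      have "(\<lambda>p. y p mod b) \<in> digit_words n b" using y b unfolding digit_words_iff small_sums_def by simp
      moreover have "(\<Sum>p=1..n. b * (y p div b) + y p mod b) < b * x - i" using y by (simp add: small_sums_def)
      then have "(\<Sum>p=1..n. y p div b) < x - (i + (\<Sum>p=1..n. y p mod b)) div b" unfolding key .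
      then have "(\<lambda>p. y p div b) \<in> small_sums n (x - (i + (\<Sum>p=1..n. y p mod b)) div b)"
        using y unfolding small_sums_def by simp
      ultimately show "(\<lambda>y. (\<lambda>p. y p mod b, \<lambda>p. y p div b)) y \<in> ?T" by simp
    qed
  qed
  then have "card (small_sums n (b * x - i)) = card ?T" by (simp add: bij_betw_same_card)
  also have "\<dots> = (\<Sum>U\<in>digit_words n b. card (small_sums n (x - (i + (\<Sum>p=1..n. U p)) div b)))"
  proof (rule card_SigmaI[OF finite_digit_words], rule ballI)
    fix U
    have "small_sums n m \<subseteq> PiE_dflt {1..n} 0 (\<lambda>_. {..<m})" for m
    proof
      fix y assume y: "y \<in> small_sums n m"
      have "y p < m" if "p \<in> {1..n}" for p
        using member_le_sum[of p "{1..n}" y] that y unfolding small_sums_def by simp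
      then show "y \<in> PiE_dflt {1..n} 0 (\<lambda>_. {..<m})" using y unfolding small_sums_def PiE_dflt_def by auto
    qed
    then show "finite (small_sums n (x - (i + (\<Sum>p=1..n. U p)) div b))"
      by (rule finite_subset) (rule finite_PiE_dflt, auto)
  qed
  finally show ?thesis .
qed

text \<open>The digit words are grouped by the carry they produce. With a carry-in of at most
  \<open>n - 1\<close> the total is at most \<open>(n - 1) + n * (b - 1) = n * b - 1\<close>, so the
  next carry is again below \<open>n\<close>.\<close>

lemma carries_amazing_matrix:
  assumes n: "n \<ge> 1" and b: "b \<ge> 1" and i: "i \<le> n - 1"
  shows "real ((b * x + n - 1 - i) choose n) =
    real b ^ n * (\<Sum>k<n. carries n b i k * real ((x + n - 1 - k) choose n))"
proof -
  let ?c = "\<lambda>U. (i + (\<Sum>p=1..n. U p)) div b"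
  have c: "?c U < n" if U: "U \<in> digit_words n b" for U
  proof -
    have "(\<Sum>p=1..n. U p) \<le> of_nat (card {1..n}) * (b - 1)"
      by (rule sum_bounded_above) (use U b in \<open>auto simp: digit_words_iff Suc_le_eq[symmetric]\<close>)
    then have "i + (\<Sum>p=1..n. U p) \<le> (n - 1) + n * (b - 1)" using i by simp
    also have "\<dots> < n * b" using n b by (cases b) auto
    finally show ?thesis using b by (simp add: div_less_iff_less_mult)
  qed
  have "real ((b * x + n - 1 - i) choose n) = (\<Sum>U\<in>digit_words n b. real ((x + n - 1 - ?c U) choose n))"
    using card_small_sums_digits[OF b, of n x i] unfolding card_small_sums_diff[OF n] by simp
  also have "\<dots> = (\<Sum>k<n. \<Sum>U | U \<in> digit_words n b \<and> ?c U = k. real ((x + n - 1 - ?c U) choose n))"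
    using c by (intro sum.group[symmetric] finite_digit_words) auto
  also have "\<dots> = (\<Sum>k<n. real b ^ n * carries n b i k * real ((x + n - 1 - k) choose n))"
    unfolding carries_card[OF b] by (intro sum.cong refl) simp
  finally show ?thesis by (simp add: sum_distrib_left mult.assoc)
qed

text \<open>For \<open>x < s\<close> the binomial vanishes, and for \<open>x = s\<close> it is
  \<open>n choose n\<close>, so the system is unitriangular.\<close>

lemma worpitzky_inverse:
  "\<exists>a :: nat \<Rightarrow> real. \<forall>s<n. (\<Sum>x<n. a x * real ((Suc x + n - 1 - s) choose n)) = of_bool (s = t)"
proof -
  have "\<exists>a :: nat \<Rightarrow> real. \<forall>s\<in>{..<n}. (\<Sum>x\<in>{..<n}. a x * real ((Suc x + n - 1 - s) choose n)) = of_bool (s = t)"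
  proof (rule triangular_system_solvable[where w = "\<lambda>x. x"])
    fix s x assume sx: "s \<in> {..<n}" "x \<in> {..<n}" "real ((Suc s + n - 1 - x) choose n) \<noteq> 0"
    have "n \<le> Suc s + n - 1 - x"
    proof (rule ccontr)
      assume "\<not> ?thesis"
      then have "(Suc s + n - 1 - x) choose n = 0" by (simp add: binomial_eq_0)
      with sx(3) show False by simp
    qed
    then show "s = x \<or> x < s" using sx by auto
  qed auto
  then show ?thesis by (simp only: Ball_def lessThan_iff)
qed

section \<open>The inner product as a sum of products of convolutions\<close>

lemma pair_pmf_of_set:
  assumes "finite A" "A \<noteq> {}" "finite B" "B \<noteq> {}"
  shows "pair_pmf (pmf_of_set A) (pmf_of_set B) = pmf_of_set (A \<times> B)"
proof (rule pmf_eqI)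
  fix x :: "'a \<times> 'b"
  obtain a b where x: "x = (a, b)" by (cases x)
  show "pmf (pair_pmf (pmf_of_set A) (pmf_of_set B)) x = pmf (pmf_of_set (A \<times> B)) x"
    using assms unfolding x pmf_pair by (simp add: card_cartesian_product indicator_def)
qed

lemma num_cycles_cyc: "num_cycles n \<pi> = cyc \<pi> {1..n}"
  unfolding num_cycles_def cyc_def ..

lemma num_cycles_bounds:
  assumes "n \<ge> 1"
  shows "num_cycles n \<pi> \<in> {1..n}"
proof -
  have "card (orbit \<pi> ` {1..n}) \<le> n" using card_image_le[of "{1..n}" "orbit \<pi>"] by simp
  moreover have "1 \<le> card (orbit \<pi> ` {1..n})" using assms by (simp add: Suc_le_eq card_gt_0_iff)
  ultimately show ?thesis by (simp only: num_cycles_def atLeastAtMost_iff)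
qed

lemma class_value_eq:
  assumes "\<And>\<pi>. \<pi> \<in> Sym n \<Longrightarrow> \<theta> \<pi> = f (num_cycles n \<pi>)" and "cycle_class n i \<noteq> {}"
  shows "class_value n \<theta> i = f i"
proof -
  have "\<theta> \<pi> = f i" if "\<pi> \<in> cycle_class n i" for \<pi>
    using that assms(1) unfolding cycle_class_def by auto
  then show ?thesis unfolding class_value_def using assms(2) by (intro the_equality) auto
qed

lemma card_cycle_class_1:
  assumes "n \<ge> 1"
  shows "card (cycle_class n 1) = fact (n - 1)" "finite (cycle_class n 1)" "cycle_class n 1 \<noteq> {}"
proof -
  have N: "{1..n} = insert 1 {2..n}" using assms by auto
  have "cycle_class n 1 = {p. p permutes insert 1 {2..n} \<and> cyc p (insert 1 {2..n}) = 1}"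
    unfolding cycle_class_def Sym_def num_cycles_cyc N by auto
  then show c: "card (cycle_class n 1) = fact (n - 1)"
    using card_cyc_1[of "{2..n}" 1] by simp
  then show "cycle_class n 1 \<noteq> {}" by force
  show "finite (cycle_class n 1)" unfolding cycle_class_def Sym_def by (simp add: finite_permutations)
qed

lemma card_translates:
  assumes \<sigma>: "\<sigma> \<in> Sym n" and \<tau>: "\<tau> \<in> Sym n"
  shows "card ((\<lambda>x. \<sigma> \<circ> x) ` cycle_class n i \<inter> (\<lambda>x. \<tau> \<circ> x) ` cycle_class n j) =
    (\<Sum>\<pi>\<in>Sym n. of_bool (num_cycles n (inv \<sigma> \<circ> \<pi>) = i) * of_bool (num_cycles n (inv \<tau> \<circ> \<pi>) = j))"
proof -
  have tr: "(\<lambda>x. \<sigma> \<circ> x) ` cycle_class n i = {\<pi> \<in> Sym n. num_cycles n (inv \<sigma> \<circ> \<pi>) = i}" if "\<sigma> \<in> Sym n" for \<sigma> i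
  proof (intro equalityI subsetI)
    have s: "\<sigma> permutes {1..n}" using that by (simp add: Sym_def)
    {
      fix \<pi> assume "\<pi> \<in> (\<lambda>x. \<sigma> \<circ> x) ` cycle_class n i"
      then obtain x where x: "x \<in> cycle_class n i" "\<pi> = \<sigma> \<circ> x" by blast
      then have "x permutes {1..n}" by (simp add: cycle_class_def Sym_def)
      then show "\<pi> \<in> {\<pi> \<in> Sym n. num_cycles n (inv \<sigma> \<circ> \<pi>) = i}"
        using x permutes_compose[OF _ s] unfolding x(2) by (simp add: cycle_class_def Sym_def o_inv_cancel[OF s])
    next
      fix \<pi> assume \<pi>: "\<pi> \<in> {\<pi> \<in> Sym n. num_cycles n (inv \<sigma> \<circ> \<pi>) = i}"
      show "\<pi> \<in> (\<lambda>x. \<sigma> \<circ> x) ` cycle_class n i"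
        unfolding image_iff
      proof (rule bexI[of _ "inv \<sigma> \<circ> \<pi>"])
        show "\<pi> = \<sigma> \<circ> (inv \<sigma> \<circ> \<pi>)" by (simp only: o_inv_cancel[OF s])
        show "inv \<sigma> \<circ> \<pi> \<in> cycle_class n i"
          using \<pi> permutes_compose[OF _ permutes_inv[OF s]] by (simp add: cycle_class_def Sym_def)
      qed
    }
  qed
  have fin: "finite (Sym n)" unfolding Sym_def by (simp add: finite_permutations)
  have "(\<lambda>x. \<sigma> \<circ> x) ` cycle_class n i \<inter> (\<lambda>x. \<tau> \<circ> x) ` cycle_class n j =
    {\<pi> \<in> Sym n. num_cycles n (inv \<sigma> \<circ> \<pi>) = i \<and> num_cycles n (inv \<tau> \<circ> \<pi>) = j}"
    unfolding tr[OF \<sigma>] tr[OF \<tau>] by blast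
  then show ?thesis using fin by (simp add: of_bool_conj[symmetric] Int_def)
qed

text \<open>Each overlap is a sum over \<open>\<pi>\<close> of a product of two indicators, one
  depending on \<open>\<sigma>\<close> and one on \<open>\<tau>\<close>, so summing over the classes
  separates the two functions. The denominator collects \<open>card (Sym n)\<close> and the squared
  number of n-cycles.\<close>

lemma cf_inner_conv:
  assumes n: "n \<ge> 1"
    and \<theta>: "\<And>\<pi>. \<pi> \<in> Sym n \<Longrightarrow> \<theta> \<pi> = f (num_cycles n \<pi>)"
    and \<psi>: "\<And>\<pi>. \<pi> \<in> Sym n \<Longrightarrow> \<psi> \<pi> = g (num_cycles n \<pi>)"
  shows "cf_inner n \<theta> \<psi> = (\<Sum>\<pi> | \<pi> permutes {1..n}.
      conv {1..n} (\<lambda>\<sigma>. of_bool (cyc \<sigma> {1..n} = 1)) (\<lambda>\<sigma>. f (cyc \<sigma> {1..n})) \<pi> *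
      conv {1..n} (\<lambda>\<sigma>. of_bool (cyc \<sigma> {1..n} = 1)) (\<lambda>\<sigma>. cnj (g (cyc \<sigma> {1..n}))) \<pi>) /
    (fact n * (fact (n - 1))\<^sup>2)"
proof -
  let ?C = "cycle_class n 1"
  let ?l = "num_cycles n"
  note C1 = card_cycle_class_1[OF n]
  have fin: "finite (Sym n)" unfolding Sym_def by (simp add: finite_permutations)
  have CS: "\<sigma> \<in> Sym n" if "\<sigma> \<in> ?C" for \<sigma> using that by (simp add: cycle_class_def)
  have mo: "complex_of_real (mean_overlap n i j) = (\<Sum>\<sigma>\<in>?C. \<Sum>\<tau>\<in>?C. \<Sum>\<pi>\<in>Sym n.
      of_bool (?l (inv \<sigma> \<circ> \<pi>) = i) * of_bool (?l (inv \<tau> \<circ> \<pi>) = j)) / (fact (n - 1))\<^sup>2" for i j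
  proof -
    have "mean_overlap n i j = (\<Sum>(\<sigma>, \<tau>)\<in>?C \<times> ?C.
        real (card ((\<lambda>x. \<sigma> \<circ> x) ` cycle_class n i \<inter> (\<lambda>x. \<tau> \<circ> x) ` cycle_class n j))) / real (card (?C \<times> ?C))"
      unfolding mean_overlap_def pair_pmf_of_set[OF C1(2,3) C1(2,3)]
      using C1 by (subst integral_pmf_of_set) auto
    also have "(\<Sum>(\<sigma>, \<tau>)\<in>?C \<times> ?C.
        real (card ((\<lambda>x. \<sigma> \<circ> x) ` cycle_class n i \<inter> (\<lambda>x. \<tau> \<circ> x) ` cycle_class n j))) =
      (\<Sum>\<sigma>\<in>?C. \<Sum>\<tau>\<in>?C. \<Sum>\<pi>\<in>Sym n. of_bool (?l (inv \<sigma> \<circ> \<pi>) = i) * of_bool (?l (inv \<tau> \<circ> \<pi>) = j))"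
      unfolding sum.cartesian_product[symmetric] by (intro sum.cong refl) (simp add: card_translates CS)
    finally have "mean_overlap n i j = (\<Sum>\<sigma>\<in>?C. \<Sum>\<tau>\<in>?C. \<Sum>\<pi>\<in>Sym n.
        of_bool (?l (inv \<sigma> \<circ> \<pi>) = i) * of_bool (?l (inv \<tau> \<circ> \<pi>) = j)) / real (card (?C \<times> ?C))" .
    moreover have "complex_of_real (of_bool P) = of_bool P" for P by (cases P) auto
    ultimately show ?thesis using C1(1) by (simp add: card_cartesian_product power2_eq_square)
  qed
  have cv: "class_value n \<theta> i * cnj (class_value n \<psi> j) * complex_of_real (mean_overlap n i j) =
    f i * cnj (g j) * complex_of_real (mean_overlap n i j)" for i j
  \<comment> \<open>On an empty class \<open>class_value\<close> is unspecified, but then the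
    overlap is 0.\<close>
  proof (cases "cycle_class n i = {} \<or> cycle_class n j = {}")
    case True
    then have "mean_overlap n i j = 0" unfolding mean_overlap_def by (auto simp: case_prod_unfold)
    then show ?thesis by simp
  next
    case False
    then show ?thesis
      using class_value_eq[of n \<theta> f i, OF \<theta>] class_value_eq[of n \<psi> g j, OF \<psi>] by simp
  qed
  have pick: "(\<Sum>i=1..n. \<Sum>j=1..n. f i * cnj (g j) * (of_bool (a = i) * of_bool (b = j))) = f a * cnj (g b)"
    if "a \<in> {1..n}" "b \<in> {1..n}" for a b
  proof -
    have "(\<Sum>j=1..n. f i * cnj (g j) * (of_bool (a = i) * of_bool (b = j))) = (if i = a then f a * cnj (g b) else 0)" for i
    proof -
      have "(\<Sum>j=1..n. f i * cnj (g j) * (of_bool (a = i) * of_bool (b = j))) =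
        (\<Sum>j=1..n. if j = b then (if i = a then f a * cnj (g b) else 0) else 0)"
        by (intro sum.cong refl) auto
      then show ?thesis using that by simp
    qed
    then show ?thesis using that by simp
  qed
  have "(\<Sum>i=1..n. \<Sum>j=1..n. class_value n \<theta> i * cnj (class_value n \<psi> j) * complex_of_real (mean_overlap n i j)) =
    (\<Sum>i=1..n. \<Sum>j=1..n. \<Sum>\<sigma>\<in>?C. \<Sum>\<tau>\<in>?C. \<Sum>\<pi>\<in>Sym n.
      f i * cnj (g j) * (of_bool (?l (inv \<sigma> \<circ> \<pi>) = i) * of_bool (?l (inv \<tau> \<circ> \<pi>) = j))) / (fact (n - 1))\<^sup>2"
    unfolding cv unfolding mo by (simp add: sum_distrib_left sum_divide_distrib)
  also have "(\<Sum>i=1..n. \<Sum>j=1..n. \<Sum>\<sigma>\<in>?C. \<Sum>\<tau>\<in>?C. \<Sum>\<pi>\<in>Sym n.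
      f i * cnj (g j) * (of_bool (?l (inv \<sigma> \<circ> \<pi>) = i) * of_bool (?l (inv \<tau> \<circ> \<pi>) = j))) =
    (\<Sum>\<pi>\<in>Sym n. \<Sum>\<sigma>\<in>?C. \<Sum>\<tau>\<in>?C. \<Sum>i=1..n. \<Sum>j=1..n.
      f i * cnj (g j) * (of_bool (?l (inv \<sigma> \<circ> \<pi>) = i) * of_bool (?l (inv \<tau> \<circ> \<pi>) = j)))"
    (is "?L = ?R")
  proof -
    let ?t = "\<lambda>i j \<sigma> \<tau> \<pi>. f i * cnj (g j) * (of_bool (?l (inv \<sigma> \<circ> \<pi>) = i) * of_bool (?l (inv \<tau> \<circ> \<pi>) = j))"
    have "?L = (\<Sum>((i, j), \<sigma>, \<tau>, \<pi>)\<in>({1..n} \<times> {1..n}) \<times> ?C \<times> ?C \<times> Sym n. ?t i j \<sigma> \<tau> \<pi>)"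
      by (simp add: sum.cartesian_product')
    also have "\<dots> = (\<Sum>(\<pi>, \<sigma>, \<tau>, i, j)\<in>Sym n \<times> ?C \<times> ?C \<times> {1..n} \<times> {1..n}. ?t i j \<sigma> \<tau> \<pi>)"
      by (rule sum.reindex_bij_witness[where i = "\<lambda>(\<pi>, \<sigma>, \<tau>, i, j). ((i, j), \<sigma>, \<tau>, \<pi>)" and j = "\<lambda>((i, j), \<sigma>, \<tau>, \<pi>). (\<pi>, \<sigma>, \<tau>, i, j)"]) auto
    also have "\<dots> = ?R" by (simp add: sum.cartesian_product')
    finally show ?thesis .
  qed
  also have "\<dots> = (\<Sum>\<pi>\<in>Sym n. \<Sum>\<sigma>\<in>?C. \<Sum>\<tau>\<in>?C. f (?l (inv \<sigma> \<circ> \<pi>)) * cnj (g (?l (inv \<tau> \<circ> \<pi>))))"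
    using num_cycles_bounds[OF n] by (intro sum.cong refl pick)
  also have "\<dots> = (\<Sum>\<pi>\<in>Sym n. (\<Sum>\<sigma>\<in>?C. f (?l (inv \<sigma> \<circ> \<pi>))) * (\<Sum>\<tau>\<in>?C. cnj (g (?l (inv \<tau> \<circ> \<pi>)))))"
    unfolding sum_product ..
  also have "\<dots> = (\<Sum>\<pi> | \<pi> permutes {1..n}.
      conv {1..n} (\<lambda>\<sigma>. of_bool (cyc \<sigma> {1..n} = 1)) (\<lambda>\<sigma>. f (cyc \<sigma> {1..n})) \<pi> *
      conv {1..n} (\<lambda>\<sigma>. of_bool (cyc \<sigma> {1..n} = 1)) (\<lambda>\<sigma>. cnj (g (cyc \<sigma> {1..n}))) \<pi>)"
  proof -
    have cv: "(\<Sum>\<sigma>\<in>?C. F (?l (inv \<sigma> \<circ> \<pi>))) = conv {1..n} (\<lambda>\<sigma>. of_bool (cyc \<sigma> {1..n} = 1)) (\<lambda>\<sigma>. F (cyc \<sigma> {1..n})) \<pi>"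
      for F :: "nat \<Rightarrow> complex" and \<pi>
    proof -
      have "(\<Sum>\<sigma>\<in>?C. F (?l (inv \<sigma> \<circ> \<pi>))) = (\<Sum>\<sigma>\<in>Sym n. of_bool (cyc \<sigma> {1..n} = 1) * F (?l (inv \<sigma> \<circ> \<pi>)))"
        by (rule sum.mono_neutral_cong_left[OF fin]) (auto simp: cycle_class_def num_cycles_cyc)
      then show ?thesis unfolding conv_def Sym_def num_cycles_cyc .
    qed
    show ?thesis unfolding cv[of f] cv[of "\<lambda>c. cnj (g c)"] Sym_def ..
  qed
  finally have "(\<Sum>i=1..n. \<Sum>j=1..n. class_value n \<theta> i * cnj (class_value n \<psi> j) * complex_of_real (mean_overlap n i j)) =
    (\<Sum>\<pi> | \<pi> permutes {1..n}.
      conv {1..n} (\<lambda>\<sigma>. of_bool (cyc \<sigma> {1..n} = 1)) (\<lambda>\<sigma>. f (cyc \<sigma> {1..n})) \<pi> *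
      conv {1..n} (\<lambda>\<sigma>. of_bool (cyc \<sigma> {1..n} = 1)) (\<lambda>\<sigma>. cnj (g (cyc \<sigma> {1..n}))) \<pi>) / (fact (n - 1))\<^sup>2" .
  moreover have "card (Sym n) = fact n" unfolding Sym_def by (subst card_permutations) auto
  ultimately show ?thesis unfolding cf_inner_def by simp
qed

lemma conv_sum_right: "conv S F (\<lambda>\<sigma>. \<Sum>x\<in>I. c x * G x \<sigma>) \<pi> = (\<Sum>x\<in>I. c x * conv S F (G x) \<pi>)"
  unfolding conv_def sum_distrib_left by (subst sum.swap) (simp add: mult.left_commute)

theorem theorem2p12:
  fixes n b i j :: nat
  assumes "n \<ge> 1" and "b \<ge> 2" and "i \<le> n - 1" and "j \<le> n - 1"
  shows "complex_of_real (carries n b i j) =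
    cf_inner n (foulkes n i)
      (\<lambda>\<pi>. of_nat b powi (int (num_cycles n \<pi>) - int n) * foulkes n j \<pi>)"
proof -
  note n = assms(1)
  have b: "b \<ge> 1" using assms(2) by simp
  let ?P = "\<lambda>t x. real ((x + n - 1 - t) choose n)"
  obtain a where a: "\<And>t s. s < n \<Longrightarrow> (\<Sum>x<n. a t x * ?P s (Suc x)) = of_bool (s = t)"
    using worpitzky_inverse[of n] by metis
  \<comment> \<open>The Worpitzky identity inverted at the points \<open>1, \<dots>, n\<close>: the
    index \<open>x < n\<close> stands for the point \<open>Suc x\<close>, and \<open>f t l\<close>
    is the value of the character at \<open>l\<close> cycles.\<close>
  define f :: "nat \<Rightarrow> nat \<Rightarrow> complex" where "f t l = (\<Sum>x<n. of_real (a t x) * of_nat (Suc x) ^ l)" for t l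
  have foulkes: "foulkes n t \<pi> = f t (num_cycles n \<pi>)" if t: "t < n" and \<pi>: "\<pi> \<in> Sym n" for t \<pi>
  proof -
    have "f t (num_cycles n \<pi>) = (\<Sum>x<n. of_real (a t x) * (\<Sum>s<n. foulkes n s \<pi> * of_nat ((Suc x + n - 1 - s) choose n)))"
    proof -
      have "\<pi> permutes {1..n}" using \<pi> by (simp add: Sym_def)
      from foulkes_worpitzky[OF n this] show ?thesis unfolding f_def by (simp only:)
    qed
    also have "\<dots> = (\<Sum>s<n. \<Sum>x<n. foulkes n s \<pi> * of_real (a t x * ?P s (Suc x)))"
      unfolding sum_distrib_left by (subst sum.swap) (simp add: mult.left_commute)
    also have "\<dots> = (\<Sum>s<n. foulkes n s \<pi> * of_real (\<Sum>x<n. a t x * ?P s (Suc x)))"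
      by (simp only: sum_distrib_left of_real_sum)
    also have "\<dots> = (\<Sum>s<n. if s = t then foulkes n t \<pi> else 0)"
      using a by (intro sum.cong refl) auto
    finally show ?thesis using t by simp
  qed
  \<comment> \<open>Multiplying by \<open>b\<close> to the power \<open>l - n\<close> turns
    \<open>x ^ l\<close> into \<open>(b * x) ^ l / b ^ n\<close>, so it moves the evaluation points
    from \<open>x\<close> to \<open>b * x\<close>.\<close>
  define g :: "nat \<Rightarrow> complex" where "g l = (\<Sum>y<n. of_real (a j y / real b ^ n) * of_nat (b * Suc y) ^ l)" for l
  have powi: "of_nat b powi (int l - int n) * f j l = g l" for l
  proof -
    have "of_nat b powi (int l - int n) = (of_nat b ^ l / of_nat b ^ n :: complex)"
      using b by (simp add: power_int_diff)
    then show ?thesis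
      unfolding f_def g_def sum_distrib_left of_nat_mult power_mult_distrib of_real_divide of_real_power of_real_of_nat_eq
      by (simp only: times_divide_eq_left times_divide_eq_right mult_ac)
  qed
  have jn: "j < n" and i_n: "i < n" using assms by auto
  let ?conv = "\<lambda>x. conv {1..n} (\<lambda>\<sigma>. of_bool (cyc \<sigma> {1..n} = 1)) (\<lambda>\<sigma>. of_nat x ^ cyc \<sigma> {1..n} :: complex)"
  have inner: "(\<Sum>\<pi> | \<pi> permutes {1..n}. ?conv x \<pi> * ?conv y \<pi>) =
    (fact (n - 1))\<^sup>2 * fact n * of_real (\<Sum>t<n. ?P t x * ?P t y)" if "x \<ge> 1" "y \<ge> 1" for x y
  proof -
    have N: "{1..n} = insert 1 {2..n}" "n = Suc (card {2..n})" using n by auto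
    show ?thesis
      using cycle_conv_inner[of "{2..n}" 1 x y, where ?'b = complex] that unfolding N(1)[symmetric] N(2)[symmetric]
      by simp
  qed
  have cnj_g: "cnj (g l) = g l" for l unfolding g_def by simp
  have "cf_inner n (foulkes n i) (\<lambda>\<pi>. of_nat b powi (int (num_cycles n \<pi>) - int n) * foulkes n j \<pi>) =
    (\<Sum>\<pi> | \<pi> permutes {1..n}.
      conv {1..n} (\<lambda>\<sigma>. of_bool (cyc \<sigma> {1..n} = 1)) (\<lambda>\<sigma>. f i (cyc \<sigma> {1..n})) \<pi> *
      conv {1..n} (\<lambda>\<sigma>. of_bool (cyc \<sigma> {1..n} = 1)) (\<lambda>\<sigma>. g (cyc \<sigma> {1..n})) \<pi>) / (fact n * (fact (n - 1))\<^sup>2)"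
  proof -
    have "of_nat b powi (int (num_cycles n \<pi>) - int n) * foulkes n j \<pi> = g (num_cycles n \<pi>)"
      if "\<pi> \<in> Sym n" for \<pi>
      unfolding foulkes[OF jn that] by (rule powi)
    from cf_inner_conv[of n "foulkes n i" "f i" _ g, OF n foulkes[OF i_n] this] show ?thesis
      by (simp only: cnj_g)
  qed
  also have "(\<Sum>\<pi> | \<pi> permutes {1..n}.
      conv {1..n} (\<lambda>\<sigma>. of_bool (cyc \<sigma> {1..n} = 1)) (\<lambda>\<sigma>. f i (cyc \<sigma> {1..n})) \<pi> *
      conv {1..n} (\<lambda>\<sigma>. of_bool (cyc \<sigma> {1..n} = 1)) (\<lambda>\<sigma>. g (cyc \<sigma> {1..n})) \<pi>) =
    (\<Sum>\<pi> | \<pi> permutes {1..n}. \<Sum>x<n. \<Sum>y<n. of_real (a i x * (a j y / real b ^ n)) * (?conv (Suc x) \<pi> * ?conv (b * Suc y) \<pi>))"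
    unfolding f_def g_def conv_sum_right sum_product by (intro sum.cong refl) simp
  also have "\<dots> = (\<Sum>x<n. \<Sum>\<pi> | \<pi> permutes {1..n}. \<Sum>y<n. of_real (a i x * (a j y / real b ^ n)) * (?conv (Suc x) \<pi> * ?conv (b * Suc y) \<pi>))"
    by (rule sum.swap)
  also have "\<dots> = (\<Sum>x<n. \<Sum>y<n. of_real (a i x * (a j y / real b ^ n)) * (\<Sum>\<pi> | \<pi> permutes {1..n}. ?conv (Suc x) \<pi> * ?conv (b * Suc y) \<pi>))"
    unfolding sum_distrib_left by (intro sum.cong refl sum.swap)
  also have "\<dots> = (\<Sum>x<n. \<Sum>y<n. of_real (a i x * (a j y / real b ^ n)) *
      ((fact (n - 1))\<^sup>2 * fact n * of_real (\<Sum>t<n. ?P t (Suc x) * ?P t (b * Suc y))))"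
    using b by (intro sum.cong refl arg_cong2[where f = times] inner) auto
  also have "\<dots> = (fact n * (fact (n - 1))\<^sup>2) *
      of_real (\<Sum>x<n. \<Sum>y<n. a i x * (a j y / real b ^ n) * (\<Sum>t<n. ?P t (Suc x) * ?P t (b * Suc y)))"
    unfolding of_real_sum sum_distrib_left by (intro sum.cong refl) (simp add: mult_ac)
  also have "\<dots> / (fact n * (fact (n - 1))\<^sup>2) =
      of_real (\<Sum>x<n. \<Sum>y<n. a i x * (a j y / real b ^ n) * (\<Sum>t<n. ?P t (Suc x) * ?P t (b * Suc y)))"
    by (rule nonzero_mult_div_cancel_left) simp
  also have "(\<Sum>x<n. \<Sum>y<n. a i x * (a j y / real b ^ n) * (\<Sum>t<n. ?P t (Suc x) * ?P t (b * Suc y))) =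
    carries n b i j"
  proof -
    have "(\<Sum>x<n. \<Sum>y<n. a i x * (a j y / real b ^ n) * (\<Sum>t<n. ?P t (Suc x) * ?P t (b * Suc y))) =
      (\<Sum>y<n. \<Sum>x<n. \<Sum>t<n. (a j y / real b ^ n) * ?P t (b * Suc y) * (a i x * ?P t (Suc x)))"
      unfolding sum_distrib_left by (subst sum.swap) (simp only: mult_ac)
    \<comment> \<open>The coefficients \<open>a i\<close> single out \<open>t = i\<close>. Below,
      the carries identity leads from \<open>b * Suc y\<close> back to \<open>Suc y\<close>, and
      \<open>a j\<close> selects the state \<open>j\<close>.\<close>
    also have "\<dots> = (\<Sum>y<n. \<Sum>t<n. (a j y / real b ^ n) * ?P t (b * Suc y) * (\<Sum>x<n. a i x * ?P t (Suc x)))"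
      unfolding sum_distrib_left by (intro sum.cong refl sum.swap)
    also have "\<dots> = (\<Sum>y<n. \<Sum>t<n. if t = i then (a j y / real b ^ n) * ?P i (b * Suc y) else 0)"
      using a by (intro sum.cong refl) auto
    also have "\<dots> = (\<Sum>y<n. (a j y / real b ^ n) * ?P i (b * Suc y))"
      using i_n by simp
    also have "\<dots> = (\<Sum>y<n. \<Sum>k<n. carries n b i k * (a j y * ?P k (Suc y)))"
      unfolding carries_amazing_matrix[OF n b assms(3)] sum_distrib_left
      using b by (intro sum.cong refl) simp
    also have "\<dots> = (\<Sum>k<n. carries n b i k * (\<Sum>y<n. a j y * ?P k (Suc y)))"
      unfolding sum_distrib_left by (rule sum.swap)
    also have "\<dots> = (\<Sum>k<n. if k = j then carries n b i j else 0)"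
      using a by (intro sum.cong refl) auto
    finally show ?thesis using jn by simp
  qed
  finally show ?thesis by simp
qed

end
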